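(* Let $n\ge2$, let $K\subset\mathbb{R}^n$ be a convex body, let $U\supset K$ be an open set, and let $\varphi:U\to(0,+\infty)$ be continuous and integrable. Extend $\varphi$ to $\mathbb{R}^n$ by setting $\varphi(\mathbf{y})=0$ for $\mathbf{y}\notin U$. Then for all $\mathbf{z}\in\mathbb{R}^n$, $$V_K^\varphi(\mathbf{z})=-\frac12\mathrm{vol}_n^\varphi(K)+\frac12\int_{\partial K}|(\mathbf{z}-\mathbf{x})\cdot\mathbf{n}_K(\mathbf{x})|\left(\int_0^1\varphi([\mathbf{z},\mathbf{x}]_s)\,s^{n-1}\,\mathrm{d}s\right)\mathcal{H}^{n-1}(\mathrm{d}\mathbf{x}),$$ where $[\mathbf{z},\mathbf{x}]_s=(1-s)\mathbf{z}+s\mathbf{x}$. In particular, $V_K^\varphi$ is continuous.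
   Context: A convex body in $\mathbb{R}^n$ is a compact convex set with nonempty interior. For measurable $A\subset\mathbb{R}^n$, $\mathrm{vol}_n^\varphi(A)=\int_{A\cap U}\varphi\,\mathrm{d}\lambda_n$, with $\lambda_n$ Lebesgue measure. $[\mathbf{z},K]$ is the convex hull of $\{\mathbf{z}\}\cup K$, and $V_K^\varphi:\mathbb{R}^n\to[0,+\infty)$ is defined by $V_K^\varphi(\mathbf{z})=\mathrm{vol}_n^\varphi([\mathbf{z},K]\setminus K)$. $\mathbf{n}_K(\mathbf{x})$ is the Euclidean outward unit normal of $\partial K$ at $\mathbf{x}$, which exists uniquely for $\mathcal{H}^{n-1}$-almost all $\mathbf{x}\in\partial K$; $\mathcal{H}^{n-1}$ is $(n-1)$-dimensional Hausdorff measure. *)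

theory Defs
  imports "HOL-Analysis.Analysis"
begin

section \<open>Hausdorff measure\<close>

text \<open>The normalisation \<open>unit_ball_vol d / 2^d\<close> is the one for which the \<open>d\<close>-dimensional
  Hausdorff measure on a \<open>d\<close>-dimensional Euclidean space is Lebesgue measure.  The empty set gets
  size 0 in every dimension, also for \<open>d = 0\<close>, where \<open>0 ^ 0 = 1\<close>.\<close>

definition hausdorff_size :: "nat \<Rightarrow> 'a::metric_space set \<Rightarrow> ennreal" where
  "hausdorff_size d S =
     (if S = {} then 0 else ennreal (unit_ball_vol (real d) * (diameter S / 2) ^ d))"

text \<open>Covering sets are required to be bounded because \<^const>\<open>diameter\<close> is meaningful only for
  bounded sets.\<close>

definition hausdorff_covers :: "real \<Rightarrow> 'a::metric_space set \<Rightarrow> (nat \<Rightarrow> 'a set) set" where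
  "hausdorff_covers \<delta> A =
     {C. A \<subseteq> (\<Union>i. C i) \<and> (\<forall>i. bounded (C i) \<and> diameter (C i) \<le> \<delta>)}"

definition hausdorff_pre :: "nat \<Rightarrow> real \<Rightarrow> 'a::metric_space set \<Rightarrow> ennreal" where
  "hausdorff_pre d \<delta> A = (INF C \<in> hausdorff_covers \<delta> A. \<Sum>i. hausdorff_size d (C i))"

definition hausdorff_outer :: "nat \<Rightarrow> 'a::metric_space set \<Rightarrow> ennreal" where
  "hausdorff_outer d A = (SUP \<delta> \<in> {0<..}. hausdorff_pre d \<delta> A)"

text \<open>\<^const>\<open>lambda_system\<close> is the sigma-algebra of Caratheodory-measurable sets.\<close>

definition hausdorff_measure :: "nat \<Rightarrow> 'a::metric_space measure" where
  "hausdorff_measure d =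
     measure_of UNIV (lambda_system UNIV UNIV (hausdorff_outer d)) (hausdorff_outer d)"

text \<open>\<^const>\<open>measure_of\<close> yields the null measure when its arguments do not form a measure space; the
  following facts show that this does not happen here.\<close>

lemma hausdorff_pre_mono: "A \<subseteq> B \<Longrightarrow> hausdorff_pre d \<delta> A \<le> hausdorff_pre d \<delta> B"
  unfolding hausdorff_pre_def hausdorff_covers_def by (rule INF_superset_mono) auto

lemma hausdorff_pre_countably_subadditive:
  "hausdorff_pre d \<delta> (\<Union>i. A i) \<le> (\<Sum>i. hausdorff_pre d \<delta> (A i))"
proof (rule ennreal_le_epsilon)
  fix e :: real
  assume e: "0 < e" and fin: "(\<Sum>i. hausdorff_pre d \<delta> (A i)) < top"
  have "\<exists>C \<in> hausdorff_covers \<delta> (A n). (\<Sum>i. hausdorff_size d (C i)) \<le>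
      hausdorff_pre d \<delta> (A n) + ennreal (e * (1/2) ^ Suc n)" for n
  proof -
    have "hausdorff_pre d \<delta> (A n) \<noteq> top"
      using fin by (metis ennreal_suminf_lessD less_irrefl)
    then have "hausdorff_pre d \<delta> (A n) < hausdorff_pre d \<delta> (A n) + ennreal (e * (1/2) ^ Suc n)"
      using e by (simp add: ennreal_zero_less_mult_iff)
    then show ?thesis
      unfolding hausdorff_pre_def[of d \<delta> "A n"] INF_less_iff by (auto intro: less_imp_le)
  qed
  then obtain C where C: "\<And>n. C n \<in> hausdorff_covers \<delta> (A n)"
    and le: "\<And>n. (\<Sum>i. hausdorff_size d (C n i)) \<le>
        hausdorff_pre d \<delta> (A n) + ennreal (e * (1/2) ^ Suc n)"
    by metis
  define D where "D = (\<lambda>k. case prod_decode k of (n, i) \<Rightarrow> C n i)"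
  have "D \<in> hausdorff_covers \<delta> (\<Union>i. A i)"
  proof -
    have "\<exists>k. x \<in> D k" if x: "x \<in> A n" for x n
    proof -
      obtain i where "x \<in> C n i"
        using x C[of n] unfolding hausdorff_covers_def by auto
      then have "x \<in> D (prod_encode (n, i))" by (simp add: D_def)
      then show ?thesis ..
    qed
    then show ?thesis
      using C unfolding hausdorff_covers_def D_def by (auto split: prod.split)
  qed
  then have "hausdorff_pre d \<delta> (\<Union>i. A i) \<le> (\<Sum>k. hausdorff_size d (D k))"
    unfolding hausdorff_pre_def by (rule INF_lower)
  also have "\<dots> = (\<Sum>n. \<Sum>i. hausdorff_size d (C n i))"
  proof -
    have "(\<lambda>k. hausdorff_size d (D k)) = (\<lambda>(n, i). hausdorff_size d (C n i)) \<circ> prod_decode"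
      by (auto simp: D_def fun_eq_iff split: prod.split)
    then show ?thesis
      using suminf_ennreal_2dimen[of "\<lambda>n. \<Sum>i. hausdorff_size d (C n i)"
          "\<lambda>(n, i). hausdorff_size d (C n i)"] by (simp add: comp_def)
  qed
  also have "\<dots> \<le> (\<Sum>n. hausdorff_pre d \<delta> (A n) + ennreal (e * (1/2) ^ Suc n))"
    by (intro suminf_le le) auto
  also have "\<dots> = (\<Sum>n. hausdorff_pre d \<delta> (A n)) + (\<Sum>n. ennreal (e * (1/2) ^ Suc n))"
    by (intro suminf_add[symmetric]) auto
  also have "(\<Sum>n. ennreal (e * (1/2) ^ Suc n)) = ennreal e"
    using sums_mult[OF power_half_series, of e] e
    by (intro suminf_ennreal_eq) auto
  finally show "hausdorff_pre d \<delta> (\<Union>i. A i) \<le> (\<Sum>i. hausdorff_pre d \<delta> (A i)) + ennreal e" .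
qed

lemma outer_measure_space_hausdorff_outer:
  "outer_measure_space UNIV (hausdorff_outer d :: 'a::metric_space set \<Rightarrow> ennreal)"
proof -
  have "hausdorff_pre d \<delta> ({} :: 'a set) = 0" if "0 < \<delta>" for \<delta>
  proof -
    define C where "C = (\<lambda>_::nat. {} :: 'a set)"
    have "C \<in> hausdorff_covers \<delta> {}"
      using that by (simp add: hausdorff_covers_def C_def)
    then have "hausdorff_pre d \<delta> ({} :: 'a set) \<le> (\<Sum>i. hausdorff_size d (C i))"
      unfolding hausdorff_pre_def by (rule INF_lower)
    then show ?thesis by (simp add: hausdorff_size_def C_def)
  qed
  then have "hausdorff_outer d ({} :: 'a set) = 0"
    unfolding hausdorff_outer_def by (simp add: SUP_eq_const)
  moreover have "hausdorff_outer d A \<le> hausdorff_outer d B" if "A \<subseteq> B" for A B :: "'a set"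
    unfolding hausdorff_outer_def using that by (intro SUP_mono') (rule hausdorff_pre_mono)
  moreover have "hausdorff_outer d (\<Union>i. A i) \<le> (\<Sum>i. hausdorff_outer d (A i))" 
    for A :: "nat \<Rightarrow> 'a set"
    unfolding hausdorff_outer_def[of d "\<Union>i. A i"]
  proof (rule SUP_least)
    fix \<delta> :: real assume "\<delta> \<in> {0<..}"
    then have "hausdorff_pre d \<delta> (A i) \<le> hausdorff_outer d (A i)" for i
      unfolding hausdorff_outer_def by (rule SUP_upper)
    then have "(\<Sum>i. hausdorff_pre d \<delta> (A i)) \<le> (\<Sum>i. hausdorff_outer d (A i))"
      by (intro suminf_le) auto
    with hausdorff_pre_countably_subadditive[of d \<delta> A]
    show "hausdorff_pre d \<delta> (\<Union>i. A i) \<le> (\<Sum>i. hausdorff_outer d (A i))" by order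
  qed
  ultimately show ?thesis
    by (auto simp: outer_measure_space_def positive_def increasing_def countably_subadditive_def)
qed

lemma
  fixes A :: "'a::metric_space set"
  shows space_hausdorff_measure [simp]: "space (hausdorff_measure d :: 'a measure) = UNIV"
    and sets_hausdorff_measure:
      "sets (hausdorff_measure d :: 'a measure) = lambda_system UNIV UNIV (hausdorff_outer d)"
    and emeasure_hausdorff_measure:
      "A \<in> sets (hausdorff_measure d) \<Longrightarrow> emeasure (hausdorff_measure d) A = hausdorff_outer d A"
proof -
  let ?L = "lambda_system UNIV UNIV (hausdorff_outer d :: 'a set \<Rightarrow> ennreal)"
  have ms: "measure_space UNIV ?L (hausdorff_outer d)"
    using sigma_algebra.caratheodory_lemma[OF sigma_algebra_Pow, of UNIV "hausdorff_outer d"]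
      outer_measure_space_hausdorff_outer[of d] by simp
  then have sa: "sigma_algebra UNIV ?L" by (simp add: measure_space_def)
  show "space (hausdorff_measure d :: 'a measure) = UNIV"
    by (simp add: hausdorff_measure_def space_measure_of_conv)
  show *: "sets (hausdorff_measure d :: 'a measure) = ?L"
    using sigma_algebra.sets_measure_of_eq[OF sa] by (simp add: hausdorff_measure_def)
  show "A \<in> sets (hausdorff_measure d) \<Longrightarrow> emeasure (hausdorff_measure d) A = hausdorff_outer d A"
    unfolding * unfolding hausdorff_measure_def
    using ms by (intro emeasure_measure_of_sigma) (auto simp: measure_space_def)
qed


section \<open>Convex bodies and weighted volume\<close>

definition convex_body :: "'a::euclidean_space set \<Rightarrow> bool" where
  "convex_body K \<longleftrightarrow> compact K \<and> convex K \<and> interior K \<noteq> {}"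

text \<open>The value 0 at boundary points with more than one outward unit normal is irrelevant for
  integrals over the boundary, as those points form a null set.\<close>

definition outer_unit_normal :: "'a::euclidean_space set \<Rightarrow> 'a \<Rightarrow> 'a" where
  "outer_unit_normal K x =
     (if \<exists>!u. norm u = 1 \<and> (\<forall>y\<in>K. (y - x) \<bullet> u \<le> 0)
      then THE u. norm u = 1 \<and> (\<forall>y\<in>K. (y - x) \<bullet> u \<le> 0)
      else 0)"

definition weighted_vol :: "'a::euclidean_space set \<Rightarrow> ('a \<Rightarrow> real) \<Rightarrow> 'a set \<Rightarrow> real" where
  "weighted_vol U \<phi> A = (LINT y:A \<inter> U|lebesgue. \<phi> y)"

definition added_vol :: "'a::euclidean_space set \<Rightarrow> ('a \<Rightarrow> real) \<Rightarrow> 'a set \<Rightarrow> 'a \<Rightarrow> real" where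
  "added_vol U \<phi> K z = weighted_vol U \<phi> (convex hull (insert z K) - K)"

end

theory Submission
  imports Defs
begin

text \<open>
  For a set \<open>B\<close> of boundary points let the cone over \<open>B\<close> consist of the points \<open>z + s (x - z)\<close> with
  \<open>x\<close> in \<open>B\<close> and \<open>0 < s < 1\<close>.  The core is the formula \<open>cone_formula\<close>: if every point of \<open>B\<close> has a
  unique normal and no ray from \<open>z\<close> meets \<open>B\<close> twice, then the \<open>\<phi>\<close>-volume of the cone over \<open>B\<close> is
  the integral over \<open>B\<close> of the density in the theorem.  It is applied to two parts of the
  boundary: the visible part, where the normal is turned towards \<open>z\<close>, and the hidden part, where it
  is turned away.  A ray from \<open>z\<close> enters \<open>K\<close> through the visible part and leaves it through the
  hidden part, so up to null sets the cone over the hidden part is \<open>[z, K]\<close> and the cone over the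
  visible part is \<open>[z, K] - K\<close> (\<open>AE_cones\<close>).  Hence the boundary integral is
  \<open>vol [z, K] + vol ([z, K] - K) = vol K + 2 V z\<close>, wherever \<open>z\<close> lies.

  The exceptional points on the rays are negligible for two reasons.  Cones over points
  with a tangent plane through \<open>z\<close> lie in the frontier of \<open>[z, K]\<close>.  At a point with several normals
  the normal cone contains a plane sector, which meets one of countably many rational flats
  of codimension two; such points are therefore nearest-point projections of these flats, and the
  cones over them are Lipschitz images of null sets (\<open>negligible_cone_singular\<close>).

  For the cone formula, fix a unit vector \<open>u\<close> and consider the boundary points with a normal close to
  \<open>u\<close>.  Convexity alone makes the orthogonal projection of these points to the hyperplane orthogonal
  to \<open>u\<close> injective and nearly isometric (\<open>boundary_chart.cap_flat\<close>), so that their Hausdorff measure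
  almost equals the Lebesgue measure of the projection.  The inverse of the projection is
  differentiable at smooth points, since the normal is continuous there; the change of variables
  formula then expresses the volume of the cone by an integral over the projection whose
  Jacobian is \<open>s ^ (n - 1)\<close> times \<open>\<bar>(z - x) \<bullet> n\<bar> / (n \<bullet> u)\<close>.  The two sides of the formula thus
  differ by a factor close to 1.  Finitely many directions \<open>u\<close> suffice, and the factor tends
  to 1 when the caps of normals shrink.

  All this rests on the equality of \<open>d\<close>-dimensional Hausdorff measure and Lebesgue measure in
  dimension \<open>d\<close>.  One inequality is the isodiametric inequality, proved by Steiner symmetrization;
  the other follows from Vitali coverings by balls.  The continuity of the added volume is
  independent of the formula: the indicator functions of the hulls \<open>[z, K]\<close> depend continuously on
  \<open>z\<close> almost everywhere, and dominated convergence applies.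
\<close>

section \<open>The isodiametric inequality\<close>

lemma nn_integral_lborel_translate:
  fixes F :: "'a::euclidean_space \<Rightarrow> ennreal"
  assumes [measurable]: "F \<in> borel_measurable borel"
  shows "(\<integral>\<^sup>+y. F (c + y) \<partial>lborel) = (\<integral>\<^sup>+y. F y \<partial>lborel)"
proof -
  have "(\<integral>\<^sup>+y. F y \<partial>lborel) = (\<integral>\<^sup>+y. F y \<partial>distr lborel borel ((+) c))"
    by (simp add: lborel_distr_plus)
  also have "\<dots> = (\<integral>\<^sup>+y. F (c + y) \<partial>lborel)"
    by (subst nn_integral_distr) auto
  finally show ?thesis ..
qed

text \<open>Fubini's theorem in the direction \<open>i\<close> without coordinates on a complement: the slab
  \<open>0 < y \<bullet> i < 1\<close> represents the hyperplane orthogonal to \<open>i\<close>,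
  being its product with an interval of length 1. The proof consists of Tonelli's theorem and
  translations.\<close>

lemma nn_integral_slices:
  fixes F :: "'a::euclidean_space \<Rightarrow> ennreal"
  assumes F [measurable]: "F \<in> borel_measurable borel" and i: "i \<bullet> i = 1"
  shows "(\<integral>\<^sup>+y. F y \<partial>lborel) =
    (\<integral>\<^sup>+y. indicator {0<..<1} (y \<bullet> i) * (\<integral>\<^sup>+s. F (y + (s - y \<bullet> i) *\<^sub>R i) \<partial>lborel) \<partial>lborel)"
proof -
  let ?I = "indicator {0<..<1::real} :: real \<Rightarrow> ennreal"
  have shift: "(\<integral>\<^sup>+s. F (y + (s - y \<bullet> i) *\<^sub>R i) \<partial>lborel) = (\<integral>\<^sup>+t. F (y + t *\<^sub>R i) \<partial>lborel)" for y
    using nn_integral_lborel_translate[of "\<lambda>s. F (y + (s - y \<bullet> i) *\<^sub>R i)" "y \<bullet> i"] by simp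
  have "(\<integral>\<^sup>+y. ?I (y \<bullet> i) * (\<integral>\<^sup>+s. F (y + (s - y \<bullet> i) *\<^sub>R i) \<partial>lborel) \<partial>lborel) =
      (\<integral>\<^sup>+y. \<integral>\<^sup>+t. ?I (y \<bullet> i) * F (y + t *\<^sub>R i) \<partial>lborel \<partial>lborel)"
    by (simp add: shift nn_integral_cmult)
  also have "\<dots> = (\<integral>\<^sup>+t. \<integral>\<^sup>+y. ?I (y \<bullet> i) * F (y + t *\<^sub>R i) \<partial>lborel \<partial>lborel)"
    by (rule lborel_pair.Fubini') measurable
  also have "\<dots> = (\<integral>\<^sup>+t. \<integral>\<^sup>+y. ?I (y \<bullet> i - t) * F y \<partial>lborel \<partial>lborel)"
  proof (rule nn_integral_cong)
    fix t :: real
    show "(\<integral>\<^sup>+y. ?I (y \<bullet> i) * F (y + t *\<^sub>R i) \<partial>lborel) = (\<integral>\<^sup>+y. ?I (y \<bullet> i - t) * F y \<partial>lborel)"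
      using nn_integral_lborel_translate[of "\<lambda>y. ?I (y \<bullet> i - t) * F y" "t *\<^sub>R i"]
      by (simp add: i inner_add_left add.commute)
  qed
  also have "\<dots> = (\<integral>\<^sup>+y. \<integral>\<^sup>+t. ?I (y \<bullet> i - t) * F y \<partial>lborel \<partial>lborel)"
    by (rule lborel_pair.Fubini') measurable
  also have "\<dots> = (\<integral>\<^sup>+y. F y \<partial>lborel)"
  proof (rule nn_integral_cong)
    fix y :: 'a
    have "(\<lambda>t. ?I (y \<bullet> i - t) * F y) = (\<lambda>t. indicator {y \<bullet> i - 1<..<y \<bullet> i} t * F y)"
      by (auto simp: fun_eq_iff indicator_def)
    then show "(\<integral>\<^sup>+t. ?I (y \<bullet> i - t) * F y \<partial>lborel) = F y"
      by (simp add: nn_integral_multc)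
  qed
  finally show ?thesis ..
qed

text \<open>Slices are parametrized by the coordinate along \<open>i\<close>, so that all points of a line
  have the same slice.\<close>

definition slice :: "'a::euclidean_space \<Rightarrow> 'a set \<Rightarrow> 'a \<Rightarrow> real set" where
  "slice i E x = {s. x + (s - x \<bullet> i) *\<^sub>R i \<in> E}"

text \<open>On each line in direction \<open>i\<close> the set is replaced by the centred open interval
  whose length is the measure of its slice. The strict inequality discards lines with a null
  slice, so every slice that remains comes from a nonempty one.\<close>

definition steiner :: "'a::euclidean_space \<Rightarrow> 'a set \<Rightarrow> 'a set" where
  "steiner i E = {x. ennreal (2 * \<bar>x \<bullet> i\<bar>) < emeasure lborel (slice i E x)}"

lemma slice_borel [measurable]:
  assumes [measurable]: "E \<in> sets borel"
  shows "slice i E x \<in> sets borel"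
  unfolding slice_def by measurable

lemma emeasure_slice:
  assumes [measurable]: "E \<in> sets borel"
  shows "emeasure lborel (slice i E x) = (\<integral>\<^sup>+s. indicator E (x + (s - x \<bullet> i) *\<^sub>R i) \<partial>lborel)"
proof -
  have "(\<lambda>s. indicator E (x + (s - x \<bullet> i) *\<^sub>R i)) = (indicator (slice i E x) :: real \<Rightarrow> ennreal)"
    by (auto simp: slice_def indicator_def)
  then show ?thesis by simp
qed

lemma steiner_borel [measurable]:
  assumes [measurable]: "E \<in> sets borel"
  shows "steiner i E \<in> sets borel"
  unfolding steiner_def emeasure_slice[OF assms] by measurable

lemma emeasure_steiner:
  fixes E :: "'a::euclidean_space set"
  assumes [measurable]: "E \<in> sets borel" and i: "i \<bullet> i = 1"
  shows "emeasure lborel (steiner i E) = emeasure lborel E"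
proof -
  have on_slice: "emeasure lborel {s. ennreal (2 * \<bar>s\<bar>) < L} = L" for L :: ennreal
  proof (cases L)
    case (real l)
    then have "{s. ennreal (2 * \<bar>s\<bar>) < L} = {- l/2<..<l/2}"
      by (auto simp: ennreal_less_iff abs_if split: if_splits)
    then show ?thesis using real by simp
  qed simp
  have same: "slice i (steiner i E) y = {s. ennreal (2 * \<bar>s\<bar>) < emeasure lborel (slice i E y)}" for y
  proof -
    have "slice i E (y + (s - y \<bullet> i) *\<^sub>R i) = slice i E y" for s
      by (simp add: slice_def inner_add_left i algebra_simps)
    then have "y + (s - y \<bullet> i) *\<^sub>R i \<in> steiner i E \<longleftrightarrow>
        ennreal (2 * \<bar>s\<bar>) < emeasure lborel (slice i E y)" for s
      by (simp add: steiner_def inner_add_left i)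
    then show ?thesis by (simp add: slice_def[of i "steiner i E"])
  qed
  have eq: "emeasure lborel A = (\<integral>\<^sup>+y. indicator {0<..<1} (y \<bullet> i) * emeasure lborel (slice i A y) \<partial>lborel)"
    if [measurable]: "A \<in> sets borel" for A
    using nn_integral_slices[of "indicator A" i] by (simp add: i emeasure_slice)
  show ?thesis
    by (simp add: eq[of E] eq[of "steiner i E"] same on_slice)
qed

lemma norm_sq_split:
  fixes v :: "'a::real_inner"
  assumes "i \<bullet> i = 1"
  shows "(norm v)\<^sup>2 = (norm (v - (v \<bullet> i) *\<^sub>R i))\<^sup>2 + (v \<bullet> i)\<^sup>2"
  using assms unfolding power2_norm_eq_inner
  by (simp add: inner_diff_left inner_diff_right inner_commute power2_eq_square)

text \<open>Two slices \<open>A\<close> and \<open>B\<close> of lengths \<open>a\<close> and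
  \<open>b\<close> satisfy \<open>a + b \<le> (sup A - inf B) + (sup B - inf A)\<close>, so one
  of these two differences is at least \<open>(a + b) / 2\<close>, which bounds the difference
  of coordinates between the two centred intervals.\<close>

lemma dist_steiner_le:
  fixes E :: "'a::euclidean_space set"
  assumes [measurable]: "E \<in> sets borel" and i: "i \<bullet> i = 1"
    and E: "\<And>x y. x \<in> E \<Longrightarrow> y \<in> E \<Longrightarrow> dist x y \<le> D"
    and x: "x \<in> steiner i E" and y: "y \<in> steiner i E"
  shows "dist x y \<le> D"
proof -
  define h where "h = norm ((x - y) - ((x - y) \<bullet> i) *\<^sub>R i)"
  define R where "R = sqrt (D\<^sup>2 - h\<^sup>2)"
  have pq: "\<bar>p - q\<bar> \<le> R \<and> h\<^sup>2 \<le> D\<^sup>2 \<and> 0 \<le> D" if "p \<in> slice i E x" "q \<in> slice i E y" for p q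
  proof -
    let ?v = "(x + (p - x \<bullet> i) *\<^sub>R i) - (y + (q - y \<bullet> i) *\<^sub>R i)"
    have le: "norm ?v \<le> D" using E that by (simp add: slice_def dist_norm)
    have "?v \<bullet> i = p - q" by (simp add: inner_diff_left inner_add_left i)
    moreover have "?v - (p - q) *\<^sub>R i = (x - y) - ((x - y) \<bullet> i) *\<^sub>R i"
      by (simp add: inner_diff_left algebra_simps)
    ultimately have "(norm ?v)\<^sup>2 = h\<^sup>2 + (p - q)\<^sup>2"
      using norm_sq_split[OF i, of ?v] by (simp only: h_def)
    moreover have "(norm ?v)\<^sup>2 \<le> D\<^sup>2" using le by (intro power_mono) auto
    ultimately have "(p - q)\<^sup>2 \<le> D\<^sup>2 - h\<^sup>2" by simp
    then show ?thesis
      using real_sqrt_le_mono[of "(p - q)\<^sup>2" "D\<^sup>2 - h\<^sup>2"] zero_le_power2[of "p - q"] order_trans[OF norm_ge_zero le]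
      unfolding R_def real_sqrt_abs by (intro conjI) linarith+
  qed
  have ne: "slice i E z \<noteq> {}" if "z \<in> steiner i E" for z
    using that by (auto simp: steiner_def)
  have width: "2 * \<bar>z \<bullet> i\<bar> < Sup (slice i E z) - Inf (slice i E z)"
    if z: "z \<in> steiner i E" and bd: "bounded (slice i E z)" for z
  proof -
    let ?A = "slice i E z"
    have "?A \<subseteq> {Inf ?A..Sup ?A}"
      using bd by (auto intro!: cInf_lower cSup_upper bounded_imp_bdd_above bounded_imp_bdd_below)
    moreover have "Inf ?A \<le> Sup ?A"
      using ne[OF z] bd by (intro cInf_le_cSup bounded_imp_bdd_above bounded_imp_bdd_below)
    ultimately have "emeasure lborel ?A \<le> ennreal (Sup ?A - Inf ?A)"
      by (metis emeasure_lborel_Icc emeasure_mono sets_lborel borel_closed closed_atLeastAtMost)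
    then have "ennreal (2 * \<bar>z \<bullet> i\<bar>) < ennreal (Sup ?A - Inf ?A)"
      using z by (auto simp: steiner_def)
    then show ?thesis by (auto simp: ennreal_less_iff)
  qed
  obtain p0 q0 where p0: "p0 \<in> slice i E x" and q0: "q0 \<in> slice i E y"
    using ne x y by blast
  have R: "0 \<le> R" "h\<^sup>2 \<le> D\<^sup>2" "0 \<le> D" using pq[OF p0 q0] by auto
  have bd: "bounded (slice i E x)" "bounded (slice i E y)"
  proof -
    have "dist q0 p \<le> R" if "p \<in> slice i E x" for p
      using pq[OF that q0] by (simp add: dist_real_def abs_minus_commute)
    moreover have "dist p0 q \<le> R" if "q \<in> slice i E y" for q
      using pq[OF p0 that] by (simp add: dist_real_def)
    ultimately have "slice i E x \<subseteq> cball q0 R" "slice i E y \<subseteq> cball p0 R" by auto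
    then show "bounded (slice i E x)" "bounded (slice i E y)"
      using bounded_subset bounded_cball by blast+
  qed
  have gap: "Sup A - Inf B \<le> R"
    if "A \<noteq> {}" "B \<noteq> {}" "\<And>p q. p \<in> A \<Longrightarrow> q \<in> B \<Longrightarrow> \<bar>p - q\<bar> \<le> R" for A B :: "real set"
  proof -
    have "p \<le> Inf B + R" if "p \<in> A" for p
    proof -
      have "p - R \<le> q" if "q \<in> B" for q
        using \<open>\<And>p q. p \<in> A \<Longrightarrow> q \<in> B \<Longrightarrow> \<bar>p - q\<bar> \<le> R\<close>[OF \<open>p \<in> A\<close> that] by linarith
      then have "p - R \<le> Inf B" using \<open>B \<noteq> {}\<close> by (intro cInf_greatest)
      then show ?thesis by simp
    qed
    then have "Sup A \<le> Inf B + R" using \<open>A \<noteq> {}\<close> by (intro cSup_least)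
    then show ?thesis by simp
  qed
  have le1: "Sup (slice i E x) - Inf (slice i E y) \<le> R"
    using pq by (intro gap ne x y) auto
  have le2: "Sup (slice i E y) - Inf (slice i E x) \<le> R"
  proof (intro gap ne x y)
    show "\<bar>q - p\<bar> \<le> R" if "q \<in> slice i E y" "p \<in> slice i E x" for q p
      using pq[OF that(2,1)] by (simp add: abs_minus_commute)
  qed
  have "\<bar>(x - y) \<bullet> i\<bar> \<le> R"
    using width[OF x bd(1)] width[OF y bd(2)] le1 le2 by (simp add: inner_diff_left)
  then have "((x - y) \<bullet> i)\<^sup>2 \<le> R\<^sup>2"
    by (metis abs_le_square_iff abs_of_nonneg R(1))
  also have "R\<^sup>2 = D\<^sup>2 - h\<^sup>2" using R by (simp add: R_def)
  finally have "(norm (x - y))\<^sup>2 \<le> D\<^sup>2"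
    using norm_sq_split[OF i, of "x - y"] by (simp add: h_def)
  then show ?thesis using R(3) unfolding dist_norm by (rule power2_le_imp_le)
qed

definition reflect :: "'a::euclidean_space \<Rightarrow> 'a \<Rightarrow> 'a" where
  "reflect i x = x - (2 * (x \<bullet> i)) *\<^sub>R i"

lemma reflect_steiner_self:
  assumes "i \<bullet> i = 1" "x \<in> steiner i E"
  shows "reflect i x \<in> steiner i E"
proof -
  have r: "reflect i x \<bullet> i = - (x \<bullet> i)"
    using assms(1) by (simp add: reflect_def inner_diff_left)
  have "reflect i x + (s - reflect i x \<bullet> i) *\<^sub>R i = x + ((s - reflect i x \<bullet> i) - 2 * (x \<bullet> i)) *\<^sub>R i" for s
    by (simp only: reflect_def scaleR_left_diff_distrib) simp
  then have "reflect i x + (s - reflect i x \<bullet> i) *\<^sub>R i = x + (s - x \<bullet> i) *\<^sub>R i" for s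
    by (simp add: r)
  then show ?thesis using assms(2) by (simp add: steiner_def slice_def r)
qed

text \<open>Symmetrization in a new direction keeps the symmetries in the directions orthogonal to it.\<close>

lemma reflect_steiner_orthogonal:
  assumes i: "i \<bullet> i = 1" and ij: "i \<bullet> j = 0"
    and E: "\<And>x. x \<in> E \<Longrightarrow> reflect i x \<in> E" and x: "x \<in> steiner j E"
  shows "reflect i x \<in> steiner j E"
proof -
  have "reflect i (reflect i z) = z" for z
    by (simp add: reflect_def inner_diff_left i algebra_simps)
  then have E': "reflect i z \<in> E \<longleftrightarrow> z \<in> E" for z using E by metis
  have "reflect i x + (s - reflect i x \<bullet> j) *\<^sub>R j = reflect i (x + (s - x \<bullet> j) *\<^sub>R j)" for s
    using ij by (simp add: reflect_def inner_diff_left inner_add_left inner_commute[of j i] algebra_simps)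
  then have "slice j E (reflect i x) = slice j E x"
    by (simp add: slice_def E')
  moreover have "reflect i x \<bullet> j = x \<bullet> j" using ij by (simp add: reflect_def inner_diff_left)
  ultimately show ?thesis using x by (simp add: steiner_def)
qed

lemma steiner_symmetrize:
  fixes E S :: "'a::euclidean_space set"
  assumes "finite S" "S \<subseteq> Basis" and E: "E \<in> sets borel"
    and D: "\<And>x y. x \<in> E \<Longrightarrow> y \<in> E \<Longrightarrow> dist x y \<le> D"
  shows "\<exists>F \<in> sets borel. emeasure lborel F = emeasure lborel E \<and>
    (\<forall>x\<in>F. \<forall>y\<in>F. dist x y \<le> D) \<and> (\<forall>i\<in>S. \<forall>x\<in>F. reflect i x \<in> F)"
  using assms(1,2)
proof (induction S rule: finite_induct)
  case empty
  show ?case by (rule bexI[where x = E]) (use E D in auto)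
next
  case (insert j S)
  then obtain F where F: "F \<in> sets borel" "emeasure lborel F = emeasure lborel E"
    "\<forall>x\<in>F. \<forall>y\<in>F. dist x y \<le> D" "\<forall>i\<in>S. \<forall>x\<in>F. reflect i x \<in> F" by auto
  have j: "j \<bullet> j = 1" using insert.prems by (simp add: inner_Basis)
  show ?case
  proof (intro bexI[of _ "steiner j F"] conjI ballI)
    show "steiner j F \<in> sets borel" using F by simp
    show "emeasure lborel (steiner j F) = emeasure lborel E"
      using F j by (simp add: emeasure_steiner)
    show "dist x y \<le> D" if "x \<in> steiner j F" "y \<in> steiner j F" for x y
      using dist_steiner_le[OF F(1) j] F(3) that by blast
    show "reflect i x \<in> steiner j F" if "i \<in> insert j S" "x \<in> steiner j F" for i x
    proof (cases "i = j")
      case True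
      then show ?thesis using that j reflect_steiner_self by blast
    next
      case False
      then have "i \<bullet> i = 1" "i \<bullet> j = 0"
        using that insert.prems by (auto simp: inner_Basis)
      then show ?thesis using reflect_steiner_orthogonal[of i j F x] F(4) that False by auto
    qed
  qed
qed

text \<open>Symmetrization in all coordinate directions makes the set invariant under \<open>x \<mapsto> -
  x\<close>; then each of its points lies within half the diameter of the origin.\<close>

theorem isodiametric_inequality:
  fixes E :: "'a::euclidean_space set"
  assumes E: "E \<in> sets borel" and D: "\<And>x y. x \<in> E \<Longrightarrow> y \<in> E \<Longrightarrow> dist x y \<le> D" and "0 \<le> D"
  shows "emeasure lborel E \<le> ennreal (unit_ball_vol (DIM('a)) * (D / 2) ^ DIM('a))"
proof -
  obtain F :: "'a set" where F: "F \<in> sets borel" "emeasure lborel F = emeasure lborel E"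
    "\<forall>x\<in>F. \<forall>y\<in>F. dist x y \<le> D" "\<forall>i\<in>Basis. \<forall>x\<in>F. reflect i x \<in> F"
    using steiner_symmetrize[OF finite_Basis subset_refl E D] by auto
  have "F \<subseteq> cball 0 (D / 2)"
  proof
    fix x assume x: "x \<in> F"
    have "x - (\<Sum>i\<in>T. (2 * (x \<bullet> i)) *\<^sub>R i) \<in> F" if "finite T" "T \<subseteq> Basis" for T
      using that
    proof (induction T rule: finite_induct)
      case (insert j T)
      let ?y = "x - (\<Sum>i\<in>T. (2 * (x \<bullet> i)) *\<^sub>R i)"
      have "i \<bullet> j = 0" if "i \<in> T" for i
        using insert that inner_Basis[of i j] by auto
      then have "(\<Sum>i\<in>T. (2 * (x \<bullet> i)) *\<^sub>R i) \<bullet> j = 0"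
        unfolding inner_sum_left by (intro sum.neutral) simp
      then have "reflect j ?y = x - (\<Sum>i\<in>insert j T. (2 * (x \<bullet> i)) *\<^sub>R i)"
        using insert by (simp add: reflect_def inner_diff_left algebra_simps)
      then show ?case using F(4) insert by (metis insert_subset)
    qed (use x in simp)
    from this[OF finite_Basis subset_refl]
    have "x - 2 *\<^sub>R (\<Sum>i\<in>Basis. (x \<bullet> i) *\<^sub>R i) \<in> F"
      by (simp add: scaleR_sum_right)
    then have "- x \<in> F" by (simp add: euclidean_representation scaleR_2)
    then have "dist x (- x) \<le> D" using F x by blast
    then show "x \<in> cball 0 (D / 2)" by (simp add: dist_norm flip: scaleR_2)
  qed
  then have "emeasure lborel F \<le> emeasure lborel (cball 0 (D / 2) :: 'a set)"
    by (intro emeasure_mono) auto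
  then show ?thesis using F \<open>0 \<le> D\<close> by (simp add: emeasure_cball)
qed

section \<open>Hausdorff measure\<close>

lemma hausdorff_outer_mono: "A \<subseteq> B \<Longrightarrow> hausdorff_outer d A \<le> hausdorff_outer d B"
  using outer_measure_space_hausdorff_outer[of d]
  by (auto simp: outer_measure_space_def increasing_def)

lemma hausdorff_outer_UN_le: "hausdorff_outer d (\<Union>i. A i) \<le> (\<Sum>i. hausdorff_outer d (A i))"
  unfolding hausdorff_outer_def[of d "\<Union>i. A i"]
proof (rule SUP_least)
  fix \<delta> :: real assume "\<delta> \<in> {0<..}"
  then have "(\<Sum>i. hausdorff_pre d \<delta> (A i)) \<le> (\<Sum>i. hausdorff_outer d (A i))"
    unfolding hausdorff_outer_def by (intro suminf_le SUP_upper) auto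
  with hausdorff_pre_countably_subadditive[of d \<delta> A]
  show "hausdorff_pre d \<delta> (\<Union>i. A i) \<le> (\<Sum>i. hausdorff_outer d (A i))" by order
qed

lemma hausdorff_outer_empty [simp]: "hausdorff_outer d {} = 0"
  using outer_measure_space_hausdorff_outer[of d]
  by (auto simp: outer_measure_space_def positive_def)

lemma suminf_two:
  fixes a b :: ennreal
  shows "(\<Sum>i::nat. if i = 0 then a else if i = 1 then b else 0) = a + b"
  by (subst suminf_finite[of "{0, 1}"]) auto

lemma hausdorff_outer_Un_le: "hausdorff_outer d (A \<union> B) \<le> hausdorff_outer d A + hausdorff_outer d B"
proof -
  let ?C = "\<lambda>i::nat. if i = 0 then A else if i = 1 then B else {}"
  have "A \<union> B = (\<Union>i. ?C i)" by (auto split: if_splits)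
  also have "hausdorff_outer d \<dots> \<le> (\<Sum>i. hausdorff_outer d (?C i))" by (rule hausdorff_outer_UN_le)
  also have "\<dots> = (\<Sum>i::nat. if i = 0 then hausdorff_outer d A else if i = 1 then hausdorff_outer d B else 0)"
    by (intro suminf_cong) auto
  finally show ?thesis by (simp add: suminf_two)
qed

lemma hausdorff_pre_Un_le:
  assumes "0 \<le> \<delta>"
  shows "hausdorff_pre d \<delta> (A \<union> B) \<le> hausdorff_pre d \<delta> A + hausdorff_pre d \<delta> B"
proof -
  have e: "hausdorff_pre d \<delta> ({} :: 'a set) = 0"
  proof -
    have "(\<lambda>_. {}) \<in> hausdorff_covers \<delta> ({} :: 'a set)"
      using assms by (simp add: hausdorff_covers_def)
    then have "hausdorff_pre d \<delta> ({} :: 'a set) \<le> (\<Sum>i::nat. hausdorff_size d ({} :: 'a set))"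
      unfolding hausdorff_pre_def by (rule INF_lower)
    then show ?thesis by (simp add: hausdorff_size_def)
  qed
  let ?C = "\<lambda>i::nat. if i = 0 then A else if i = 1 then B else {}"
  have "A \<union> B = (\<Union>i. ?C i)" by (auto split: if_splits)
  also have "hausdorff_pre d \<delta> \<dots> \<le> (\<Sum>i. hausdorff_pre d \<delta> (?C i))"
    by (rule hausdorff_pre_countably_subadditive)
  also have "\<dots> = (\<Sum>i::nat. if i = 0 then hausdorff_pre d \<delta> A else if i = 1 then hausdorff_pre d \<delta> B else 0)"
    by (intro suminf_cong) (auto simp: e)
  finally show ?thesis by (simp add: suminf_two)
qed

lemma hausdorff_pre_antimono: "\<delta> \<le> \<delta>' \<Longrightarrow> hausdorff_pre d \<delta>' A \<le> hausdorff_pre d \<delta> A"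
  unfolding hausdorff_pre_def hausdorff_covers_def
  by (rule INF_superset_mono) (auto intro: order_trans)

lemma hausdorff_pre_le_outer: "0 < \<delta> \<Longrightarrow> hausdorff_pre d \<delta> A \<le> hausdorff_outer d A"
  unfolding hausdorff_outer_def by (intro SUP_upper) auto

lemma hausdorff_size_lipschitz_image:
  fixes f :: "'a::metric_space \<Rightarrow> 'b::metric_space"
  assumes lip: "\<And>x y. x \<in> S \<Longrightarrow> y \<in> S \<Longrightarrow> dist (f x) (f y) \<le> L * dist x y" and L: "0 < L"
    and C: "bounded C"
  shows "bounded (f ` (C \<inter> S))" "diameter (f ` (C \<inter> S)) \<le> L * diameter C"
    "hausdorff_size d (f ` (C \<inter> S)) \<le> ennreal (L ^ d) * hausdorff_size d C"
proof -
  have d: "dist (f x) (f y) \<le> L * diameter C" if "x \<in> C \<inter> S" "y \<in> C \<inter> S" for x y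
  proof -
    have "dist (f x) (f y) \<le> L * dist x y" using that lip by auto
    also have "\<dots> \<le> L * diameter C"
      using that C L by (intro mult_left_mono diameter_bounded_bound) auto
    finally show ?thesis .
  qed
  then show b: "bounded (f ` (C \<inter> S))" unfolding bounded_two_points by blast
  have 0: "0 \<le> diameter C" using C by (rule diameter_ge_0)
  show diam: "diameter (f ` (C \<inter> S)) \<le> L * diameter C"
  proof (cases "C \<inter> S = {}")
    case False
    let ?F = "f ` (C \<inter> S)"
    have "diameter ?F = (SUP (x, y)\<in>?F \<times> ?F. dist x y)"
      using False by (auto simp: diameter_def)
    also have "\<dots> \<le> L * diameter C" using d False by (intro cSUP_least) auto
    finally show ?thesis .
  qed (use 0 L in simp)
  show "hausdorff_size d (f ` (C \<inter> S)) \<le> ennreal (L ^ d) * hausdorff_size d C"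
  proof (cases "C \<inter> S = {}")
    case True
    then show ?thesis by (simp add: hausdorff_size_def)
  next
    case False
    have "(diameter (f ` (C \<inter> S)) / 2) ^ d \<le> (L * diameter C / 2) ^ d"
      using diam diameter_ge_0[OF b] by (intro power_mono) auto
    also have "\<dots> = L ^ d * (diameter C / 2) ^ d" by (simp flip: power_mult_distrib)
    finally have "unit_ball_vol d * (diameter (f ` (C \<inter> S)) / 2) ^ d \<le>
        L ^ d * (unit_ball_vol d * (diameter C / 2) ^ d)"
      using mult_left_mono[OF _ unit_ball_vol_nonneg[of "real d"]] by (simp add: mult_ac)
    then show ?thesis using False L
      by (auto simp: hausdorff_size_def 0 simp flip: ennreal_mult)
  qed
qed

lemma hausdorff_outer_lipschitz_image:
  fixes f :: "'a::metric_space \<Rightarrow> 'b::metric_space"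
  assumes lip: "\<And>x y. x \<in> S \<Longrightarrow> y \<in> S \<Longrightarrow> dist (f x) (f y) \<le> L * dist x y" and L: "0 < L"
  shows "hausdorff_outer d (f ` S) \<le> ennreal (L ^ d) * hausdorff_outer d S"
  unfolding hausdorff_outer_def[of d "f ` S"]
proof (rule SUP_least)
  fix \<delta> :: real assume "\<delta> \<in> {0<..}"
  then have \<delta>: "0 < \<delta>" by simp
  let ?c = "ennreal (L ^ d)"
  have c: "0 < ?c" "?c < top" using L by auto
  have "hausdorff_pre d \<delta> (f ` S) \<le> ?c * (\<Sum>i. hausdorff_size d (C i))"
    if C: "C \<in> hausdorff_covers (\<delta> / L) S" for C
  proof -
    have b: "bounded (C i)" "diameter (C i) \<le> \<delta> / L" for i
      using C by (auto simp: hausdorff_covers_def)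
    have "L * diameter (C i) \<le> \<delta>" for i using b(2)[of i] L by (simp add: field_simps)
    then have "(\<lambda>i. f ` (C i \<inter> S)) \<in> hausdorff_covers \<delta> (f ` S)"
      using C hausdorff_size_lipschitz_image(1)[OF lip L b(1)]
        order_trans[OF hausdorff_size_lipschitz_image(2)[OF lip L b(1)]]
      unfolding hausdorff_covers_def by blast
    then have "hausdorff_pre d \<delta> (f ` S) \<le> (\<Sum>i. hausdorff_size d (f ` (C i \<inter> S)))"
      unfolding hausdorff_pre_def by (rule INF_lower)
    also have "\<dots> \<le> (\<Sum>i. ?c * hausdorff_size d (C i))"
      by (intro suminf_le hausdorff_size_lipschitz_image(3)[OF lip L b(1)]) auto
    finally show ?thesis by simp
  qed
  then have "hausdorff_pre d \<delta> (f ` S) / ?c \<le> hausdorff_pre d (\<delta> / L) S"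
    unfolding hausdorff_pre_def[of d "\<delta> / L"] using c
    by (intro INF_greatest divide_le_posI_ennreal) auto
  then have "hausdorff_pre d \<delta> (f ` S) \<le> ?c * hausdorff_pre d (\<delta> / L) S"
    using c by (metis divide_right_mono_ennreal ennreal_mult_divide_eq less_irrefl mult.commute
        mult_divide_eq_ennreal mult_left_mono ennreal_times_divide zero_le)
  also have "\<dots> \<le> ?c * hausdorff_outer d S"
    using \<delta> L by (intro mult_left_mono hausdorff_pre_le_outer) auto
  finally show "hausdorff_pre d \<delta> (f ` S) \<le> ?c * hausdorff_outer d S" .
qed

subsection \<open>Borel sets are measurable\<close>

text \<open>A covering set of diameter less than \<open>\<epsilon>\<close> meets at most one of the two
  sets, so a fine cover splits into covers of the two.\<close>

lemma hausdorff_outer_separated: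
  fixes A B :: "'a::metric_space set"
  assumes sep: "\<And>x y. x \<in> A \<Longrightarrow> y \<in> B \<Longrightarrow> \<epsilon> \<le> dist x y" and "0 < \<epsilon>"
  shows "hausdorff_outer d A + hausdorff_outer d B \<le> hausdorff_outer d (A \<union> B)"
proof -
  have pre: "hausdorff_pre d \<delta> A + hausdorff_pre d \<delta> B \<le> hausdorff_pre d \<delta> (A \<union> B)"
    if \<delta>: "0 < \<delta>" "\<delta> < \<epsilon>" for \<delta>
    unfolding hausdorff_pre_def[of d \<delta> "A \<union> B"]
  proof (rule INF_greatest)
    fix C assume C: "C \<in> hausdorff_covers \<delta> (A \<union> B)"
    define D where "D X i = (if C i \<inter> X = {} then {} else C i)" for X i
    have cov: "D X \<in> hausdorff_covers \<delta> X" if "X \<subseteq> A \<union> B" for X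
      using C that \<delta> unfolding hausdorff_covers_def D_def by fastforce
    have "hausdorff_size d (D A i) + hausdorff_size d (D B i) \<le> hausdorff_size d (C i)" for i
    proof -
      have False if "x \<in> C i" "x \<in> A" "y \<in> C i" "y \<in> B" for x y
      proof -
        have "dist x y \<le> diameter (C i)" "diameter (C i) \<le> \<delta>"
          using C that by (auto simp: hausdorff_covers_def diameter_bounded_bound)
        then show False using sep[of x y] that \<delta> by simp
      qed
      then have "C i \<inter> A = {} \<or> C i \<inter> B = {}" by blast
      then show ?thesis by (auto simp: D_def hausdorff_size_def)
    qed
    then have "(\<Sum>i. hausdorff_size d (D A i) + hausdorff_size d (D B i)) \<le> (\<Sum>i. hausdorff_size d (C i))"
      by (intro suminf_le) auto
    also have "(\<Sum>i. hausdorff_size d (D A i) + hausdorff_size d (D B i)) =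
        (\<Sum>i. hausdorff_size d (D A i)) + (\<Sum>i. hausdorff_size d (D B i))"
      by (intro suminf_add[symmetric]) auto
    finally show "hausdorff_pre d \<delta> A + hausdorff_pre d \<delta> B \<le> (\<Sum>i. hausdorff_size d (C i))"
      using add_mono[OF INF_lower[OF cov[of A]] INF_lower[OF cov[of B]],
          of "\<lambda>C. \<Sum>i. hausdorff_size d (C i)" "\<lambda>C. \<Sum>i. hausdorff_size d (C i)"]
      unfolding hausdorff_pre_def by auto
  qed
  have "hausdorff_outer d A + hausdorff_outer d B =
      (SUP \<delta>\<in>{0<..}. hausdorff_pre d \<delta> A + hausdorff_pre d \<delta> B)"
    unfolding hausdorff_outer_def
  proof (rule SUP_add_directed_ennreal[symmetric])
    fix \<delta> \<delta>' :: real assume "\<delta> \<in> {0<..}" "\<delta>' \<in> {0<..}"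
    then show "\<exists>k\<in>{0<..}. hausdorff_pre d \<delta> A + hausdorff_pre d \<delta>' B \<le> hausdorff_pre d k A + hausdorff_pre d k B"
      by (intro bexI[of _ "min \<delta> \<delta>'"] add_mono hausdorff_pre_antimono) auto
  qed
  also have "\<dots> \<le> hausdorff_outer d (A \<union> B)"
  proof (rule SUP_least)
    fix \<delta> :: real assume "\<delta> \<in> {0<..}"
    then have k: "0 < min \<delta> (\<epsilon> / 2)" "min \<delta> (\<epsilon> / 2) < \<epsilon>" using \<open>0 < \<epsilon>\<close> by auto
    have "hausdorff_pre d \<delta> A + hausdorff_pre d \<delta> B \<le>
        hausdorff_pre d (min \<delta> (\<epsilon> / 2)) A + hausdorff_pre d (min \<delta> (\<epsilon> / 2)) B"
      by (intro add_mono hausdorff_pre_antimono) auto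
    also have "\<dots> \<le> hausdorff_pre d (min \<delta> (\<epsilon> / 2)) (A \<union> B)" by (rule pre[OF k])
    also have "\<dots> \<le> hausdorff_outer d (A \<union> B)" by (rule hausdorff_pre_le_outer[OF k(1)])
    finally show "hausdorff_pre d \<delta> A + hausdorff_pre d \<delta> B \<le> hausdorff_outer d (A \<union> B)" .
  qed
  finally show ?thesis .
qed

text \<open>The sets \<open>A k\<close> of the points of \<open>T\<close> with distance at least \<open>1 /
  (k + 1)\<close> from \<open>C\<close> are separated from \<open>C\<close> and exhaust \<open>T
  - C\<close>. What \<open>A k\<close> misses is a union of shells, and the measures of all
  shells have a finite sum, so the missing part tends to 0.\<close>

lemma caratheodory_closed:
  fixes C T :: "'a::metric_space set"
  assumes C: "closed C"
  shows "hausdorff_outer d (C \<inter> T) + hausdorff_outer d (T - C) \<le> hausdorff_outer d T"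
proof (cases "C = {} \<or> hausdorff_outer d T = top")
  case True
  then show ?thesis by auto
next
  case False
  then have ne: "C \<noteq> {}" and fin: "hausdorff_outer d T < top" by (auto simp: less_top)
  let ?H = "hausdorff_outer d"
  define A where "A k = {x \<in> T. 1 / real (k + 1) \<le> infdist x C}" for k :: nat
  define R where "R k = A (Suc k) - A k" for k
  have lip: "infdist x C \<le> infdist y C + dist x y" for x y
    by (rule infdist_triangle)
  have A_T: "A k \<subseteq> T" for k by (auto simp: A_def)
  have sepA: "?H (C \<inter> T) + ?H (A k) \<le> ?H T" for k
  proof -
    have "1 / real (k + 1) \<le> dist x y" if "x \<in> C \<inter> T" "y \<in> A k" for x y
      using that lip[of y x] by (auto simp: A_def dist_commute)
    then have "?H (C \<inter> T) + ?H (A k) \<le> ?H (C \<inter> T \<union> A k)"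
      by (rule hausdorff_outer_separated) auto
    also have "\<dots> \<le> ?H T" using A_T by (intro hausdorff_outer_mono) auto
    finally show ?thesis .
  qed
  \<comment> \<open>Shells whose indices have equal parity are separated, so their sizes add up.\<close>
  have part: "(\<Sum>j<m. ?H (R (2 * j + p))) \<le> ?H (\<Union>j<m. R (2 * j + p))" for m p
  proof (induction m)
    case (Suc m)
    let ?U = "\<Union>j<m. R (2 * j + p)"
    let ?e = "1 / real (2 * m + p) - 1 / real (2 * m + p + 1)"
    have sum: "?H ?U + ?H (R (2 * m + p)) \<le> ?H (?U \<union> R (2 * m + p))"
    proof (cases "m = 0")
      case False
      have low: "1 / real (2 * m + p) \<le> infdist x C" if x: "x \<in> ?U" for x
      proof -
        obtain j where j: "j < m" "x \<in> A (Suc (2 * j + p))" using x by (auto simp: R_def)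
        have "1 / real (2 * m + p) \<le> 1 / real (Suc (2 * j + p) + 1)"
          using j(1) by (intro divide_left_mono) auto
        then show ?thesis using j(2) unfolding A_def by auto
      qed
      have high: "infdist y C < 1 / real (2 * m + p + 1)" if "y \<in> R (2 * m + p)" for y
        using that by (auto simp: R_def A_def)
      have "?e \<le> dist x y" if "x \<in> ?U" "y \<in> R (2 * m + p)" for x y
        using low[OF that(1)] high[OF that(2)] lip[of x y] by linarith
      moreover have "0 < ?e"
        using False divide_strict_left_mono[of "real (2 * m + p)" "real (2 * m + p + 1)" 1] by simp
      ultimately show ?thesis by (rule hausdorff_outer_separated)
    qed simp
    have "(\<Union>j<Suc m. R (2 * j + p)) = ?U \<union> R (2 * m + p)" by (auto simp: less_Suc_eq)
    then have "?H (\<Union>j<Suc m. R (2 * j + p)) = ?H (?U \<union> R (2 * m + p))" by (rule arg_cong)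
    then show ?case using order_trans[OF add_right_mono[OF Suc.IH] sum] by simp
  qed simp
  have "(\<Sum>j. ?H (R (2 * j + p))) \<le> ?H T" for p
  proof (rule suminf_le_const)
    fix m
    have "(\<Sum>j<m. ?H (R (2 * j + p))) \<le> ?H (\<Union>j<m. R (2 * j + p))" by (rule part)
    also have "\<dots> \<le> ?H T" using A_T by (intro hausdorff_outer_mono) (auto simp: R_def)
    finally show "(\<Sum>j<m. ?H (R (2 * j + p))) \<le> ?H T" .
  qed auto
  then have finp: "(\<Sum>j. ?H (R (2 * j + p))) < top" for p using fin by (meson le_less_trans)
  have "(\<Sum>j<m. ?H (R j)) \<le> (\<Sum>j. ?H (R (2 * j + 0))) + (\<Sum>j. ?H (R (2 * j + 1)))" for m
  proof -
    have "(\<Sum>j<m. ?H (R j)) \<le> (\<Sum>j<2 * m. ?H (R j))" by (intro sum_mono2) auto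
    also have "\<dots> = (\<Sum>j<m. ?H (R (2 * j + 0))) + (\<Sum>j<m. ?H (R (2 * j + 1)))"
      by (induction m) (auto simp: ac_simps)
    also have "\<dots> \<le> (\<Sum>j. ?H (R (2 * j + 0))) + (\<Sum>j. ?H (R (2 * j + 1)))"
      by (intro add_mono sum_le_suminf) auto
    finally show ?thesis .
  qed
  then have "(\<Sum>j. ?H (R j)) \<le> (\<Sum>j. ?H (R (2 * j + 0))) + (\<Sum>j. ?H (R (2 * j + 1)))"
    by (intro suminf_le_const) auto
  also have "\<dots> < top" using finp[of 0] finp[of 1] by simp
  finally have finR: "(\<Sum>j. ?H (R j)) < top" .
  have tail0: "(\<lambda>k. \<Sum>j. ?H (R (j + k))) \<longlonglongrightarrow> 0"
  proof -
    have off: "(\<Sum>j. ?H (R j)) = (\<Sum>j. ?H (R (j + k))) + (\<Sum>j<k. ?H (R j))" for k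
      by (rule suminf_offset) auto
    have "(\<Sum>j. ?H (R (j + k))) = (\<Sum>j. ?H (R j)) - (\<Sum>j<k. ?H (R j))" for k
    proof -
      have "(\<Sum>j<k. ?H (R j)) \<noteq> top"
        using le_less_trans[OF sum_le_suminf finR, of "{..<k}"] by (auto simp: less_top)
      then show ?thesis by (simp add: off[of k])
    qed
    moreover have "(\<lambda>k. (\<Sum>j. ?H (R j)) - (\<Sum>j<k. ?H (R j))) \<longlonglongrightarrow> (\<Sum>j. ?H (R j)) - (\<Sum>j. ?H (R j))"
      using finR by (intro tendsto_diff_ennreal tendsto_const summable_LIMSEQ) auto
    ultimately show ?thesis using finR by simp
  qed
  have cover: "T - C \<subseteq> A k \<union> (\<Union>j. R (j + k))" for k
  proof
    fix x assume x: "x \<in> T - C"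
    then have "0 < infdist x C" using C ne in_closed_iff_infdist_zero[OF C ne, of x] infdist_nonneg[of x C]
      by auto
    then obtain n where "1 / real (n + 1) < infdist x C"
      using reals_Archimedean[of "infdist x C"] by (auto simp: inverse_eq_divide)
    then have ex: "\<exists>n. x \<in> A n" using x by (auto simp: A_def intro!: exI[of _ n])
    show "x \<in> A k \<union> (\<Union>j. R (j + k))"
    proof (rule ccontr)
      assume no: "x \<notin> A k \<union> (\<Union>j. R (j + k))"
      have "x \<notin> A (j + k)" for j
        by (induction j) (use no in \<open>auto simp: R_def\<close>)
      moreover have "A n \<subseteq> A (n + k)" for n
      proof -
        have "1 / real (n + k + 1) \<le> 1 / real (n + 1)" by (intro divide_left_mono) auto
        then show ?thesis unfolding A_def by auto
      qed
      ultimately show False using ex by blast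
    qed
  qed
  have "?H (C \<inter> T) + ?H (T - C) \<le> ?H T + (\<Sum>j. ?H (R (j + k)))" for k
  proof -
    have "?H (T - C) \<le> ?H (A k) + ?H (\<Union>j. R (j + k))"
      by (rule order_trans[OF hausdorff_outer_mono[OF cover] hausdorff_outer_Un_le])
    also have "\<dots> \<le> ?H (A k) + (\<Sum>j. ?H (R (j + k)))"
      by (intro add_left_mono hausdorff_outer_UN_le)
    finally have "?H (C \<inter> T) + ?H (T - C) \<le> ?H (C \<inter> T) + (?H (A k) + (\<Sum>j. ?H (R (j + k))))"
      by (rule add_left_mono)
    also have "\<dots> \<le> ?H T + (\<Sum>j. ?H (R (j + k)))"
      unfolding add.assoc[symmetric] by (intro add_right_mono sepA)
    finally show ?thesis .
  qed
  then show ?thesis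
    using tendsto_add[OF tendsto_const[of "?H T"] tail0]
    by (intro LIMSEQ_le_const[of _ "?H T"]) auto
qed

lemma borel_subset_hausdorff_measure:
  "sets (borel :: 'a::metric_space measure) \<subseteq> sets (hausdorff_measure d)"
proof -
  have *: "closed C \<Longrightarrow> C \<in> sets (hausdorff_measure d)" for C :: "'a set"
  proof -
    assume C: "closed C"
    have "hausdorff_outer d (C \<inter> x) + hausdorff_outer d ((UNIV - C) \<inter> x) = hausdorff_outer d x" for x
    proof -
      have "C \<inter> x \<union> (x - C) = x" "(UNIV - C) \<inter> x = x - C" by auto
      then show ?thesis
        using caratheodory_closed[OF C, of d x] hausdorff_outer_Un_le[of d "C \<inter> x" "x - C"]
        by (auto intro: antisym)
    qed
    then show "C \<in> sets (hausdorff_measure d)"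
      by (simp add: sets_hausdorff_measure lambda_system_def)
  qed
  then show ?thesis
    using sets.sigma_sets_subset[of "Collect closed" "hausdorff_measure d :: 'a measure"]
    by (auto simp: borel_eq_closed)
qed

lemma borel_measurable_hausdorff_measure:
  assumes "g \<in> borel_measurable (borel :: 'a::metric_space measure)"
  shows "g \<in> borel_measurable (hausdorff_measure d)"
proof -
  have "(\<lambda>x. x) \<in> hausdorff_measure d \<rightarrow>\<^sub>M (borel :: 'a measure)"
    using borel_subset_hausdorff_measure by (intro measurableI) auto
  from measurable_compose[OF this assms] show ?thesis .
qed

subsection \<open>In top dimension, Hausdorff measure is Lebesgue measure\<close>

text \<open>By the isodiametric inequality a covering set has no more volume than size.\<close>

lemma emeasure_lebesgue_le_hausdorff:
  fixes E :: "'a::euclidean_space set"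
  shows "emeasure lebesgue E \<le> hausdorff_outer (DIM('a)) E"
proof (cases "E \<in> sets lebesgue")
  case True
  have "emeasure lebesgue E \<le> (\<Sum>i. hausdorff_size (DIM('a)) (C i))"
    if C: "C \<in> hausdorff_covers 1 E" for C
  proof -
    have b: "bounded (C i)" for i using C by (auto simp: hausdorff_covers_def)
    have "emeasure lborel (closure (C i)) \<le> hausdorff_size (DIM('a)) (C i)" for i
    proof (cases "C i = {}")
      case False
      have "dist x y \<le> diameter (C i)" if "x \<in> closure (C i)" "y \<in> closure (C i)" for x y
        using diameter_bounded_bound[OF bounded_closure[OF b] that] by (simp add: diameter_closure b)
      then have "emeasure lborel (closure (C i)) \<le>
          ennreal (unit_ball_vol (DIM('a)) * (diameter (C i) / 2) ^ DIM('a))"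
        by (intro isodiametric_inequality diameter_ge_0 b) auto
      then show ?thesis using False by (simp add: hausdorff_size_def)
    qed simp
    moreover have "emeasure lebesgue E \<le> (\<Sum>i. emeasure lborel (closure (C i)))"
    proof -
      have "E \<subseteq> (\<Union>i. closure (C i))"
        using C closure_subset unfolding hausdorff_covers_def by blast
      then have "emeasure lebesgue E \<le> emeasure lebesgue (\<Union>i. closure (C i))"
        by (intro emeasure_mono sets_completionI_sets) auto
      also have "\<dots> \<le> (\<Sum>i. emeasure lebesgue (closure (C i)))"
        by (intro emeasure_subadditive_countably) auto
      finally show ?thesis by (simp cong: suminf_cong)
    qed
    ultimately show ?thesis by (meson order_trans suminf_le summableI)
  qed
  then have "emeasure lebesgue E \<le> hausdorff_pre (DIM('a)) 1 E"
    unfolding hausdorff_pre_def by (rule INF_greatest)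
  also have "\<dots> \<le> hausdorff_outer (DIM('a)) E" by (rule hausdorff_pre_le_outer) simp
  finally show ?thesis .
qed (simp add: emeasure_notin_sets)

text \<open>Covers whose sizes are controlled by the measures of disjoint sets \<open>B i\<close>. It serves
  twice: for cubes with their interiors, and for the disjoint balls of a Vitali covering.\<close>

lemma hausdorff_pre_le_packing:
  fixes C :: "'i \<Rightarrow> 'a::metric_space set"
  assumes I: "countable I" and cov: "A \<subseteq> (\<Union>i\<in>I. C i)" and "0 \<le> \<delta>"
    and C: "\<And>i. i \<in> I \<Longrightarrow> bounded (C i)" "\<And>i. i \<in> I \<Longrightarrow> diameter (C i) \<le> \<delta>"
    and le: "\<And>i. i \<in> I \<Longrightarrow> hausdorff_size d (C i) \<le> \<kappa> * emeasure M (B i)"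
    and B: "\<And>i. i \<in> I \<Longrightarrow> B i \<in> sets M" "\<And>i. i \<in> I \<Longrightarrow> B i \<subseteq> X" "disjoint_family_on B I"
    and X: "X \<in> sets M"
  shows "hausdorff_pre d \<delta> A \<le> \<kappa> * emeasure M X"
proof -
  define N where "N = to_nat_on I ` I"
  define g where "g = from_nat_into I"
  have gI: "g n \<in> I" if "n \<in> N" for n using that I by (auto simp: N_def g_def)
  have gto: "g (to_nat_on I i) = i" if "i \<in> I" for i using that I by (simp add: g_def)
  define C' where "C' n = (if n \<in> N then C (g n) else {})" for n
  define B' where "B' n = (if n \<in> N then B (g n) else {})" for n
  have cov': "C' \<in> hausdorff_covers \<delta> A"
  proof -
    have "A \<subseteq> (\<Union>n. C' n)"
    proof
      fix x assume "x \<in> A"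
      then obtain i where i: "i \<in> I" "x \<in> C i" using cov by blast
      then have "x \<in> C' (to_nat_on I i)" by (simp add: C'_def N_def gto)
      then show "x \<in> (\<Union>n. C' n)" by blast
    qed
    moreover have "bounded (C' n) \<and> diameter (C' n) \<le> \<delta>" for n
      using C[OF gI, of n] \<open>0 \<le> \<delta>\<close> by (simp add: C'_def)
    ultimately show ?thesis by (simp add: hausdorff_covers_def)
  qed
  have "disjoint_family B'"
  proof -
    have "g m \<noteq> g n" if "m \<in> N" "n \<in> N" "m \<noteq> n" for m n
      using that gto by (auto simp: N_def)
    then have "B (g m) \<inter> B (g n) = {}" if "m \<in> N" "n \<in> N" "m \<noteq> n" for m n
      using B(3) gI that by (auto simp: disjoint_family_on_def)
    then show ?thesis by (auto simp: disjoint_family_on_def B'_def)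
  qed
  moreover have B': "B' n \<in> sets M" "B' n \<subseteq> X" for n using B gI by (auto simp: B'_def)
  ultimately have "(\<Sum>n. emeasure M (B' n)) = emeasure M (\<Union>n. B' n)"
    by (intro suminf_emeasure) auto
  also have "\<dots> \<le> emeasure M X" using B' X by (intro emeasure_mono) auto
  finally have sum: "(\<Sum>n. emeasure M (B' n)) \<le> emeasure M X" .
  have "hausdorff_pre d \<delta> A \<le> (\<Sum>n. hausdorff_size d (C' n))"
    unfolding hausdorff_pre_def using cov' by (rule INF_lower)
  also have "\<dots> \<le> (\<Sum>n. \<kappa> * emeasure M (B' n))"
  proof (intro suminf_le)
    show "hausdorff_size d (C' n) \<le> \<kappa> * emeasure M (B' n)" for n
      using le[OF gI, of n] by (simp add: C'_def B'_def hausdorff_size_def[of d "{}"])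
  qed auto
  also have "\<dots> \<le> \<kappa> * emeasure M X" using sum by (simp add: mult_left_mono)
  finally show ?thesis .
qed

lemma hausdorff_size_cube:
  fixes u v :: "'a::euclidean_space"
  assumes side: "\<And>i. i \<in> Basis \<Longrightarrow> v \<bullet> i - u \<bullet> i = h" and h: "0 < h"
  shows "diameter (cbox u v) = h * sqrt (DIM('a))"
    "hausdorff_size (DIM('a)) (cbox u v) =
      ennreal (unit_ball_vol (DIM('a)) * (sqrt (DIM('a)) / 2) ^ DIM('a)) * emeasure lborel (box u v)"
proof -
  have le: "u \<bullet> i \<le> v \<bullet> i" if "i \<in> Basis" for i using side[OF that] h by simp
  have "diameter (cbox u v) = dist u v" using le by (simp add: diameter_cbox)
  also have "\<dots> = sqrt (\<Sum>i\<in>(Basis::'a set). h\<^sup>2)"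
  proof -
    have "u \<bullet> i - v \<bullet> i = - h" if "i \<in> Basis" for i using side[OF that] by simp
    then have "(dist (u \<bullet> i) (v \<bullet> i))\<^sup>2 = h\<^sup>2" if "i \<in> Basis" for i
      using that by (simp add: dist_real_def)
    then show ?thesis by (simp add: euclidean_dist_l2[of u v] L2_set_def)
  qed
  also have "\<dots> = h * sqrt (DIM('a))" using h by (simp add: real_sqrt_mult)
  finally show d: "diameter (cbox u v) = h * sqrt (DIM('a))" .
  have "emeasure lborel (box u v) = ennreal (h ^ DIM('a))"
    using le side by (simp add: emeasure_lborel_box inner_diff_left)
  moreover have "cbox u v \<noteq> {}" using le by (simp add: box_ne_empty)
  ultimately show "hausdorff_size (DIM('a)) (cbox u v) =
      ennreal (unit_ball_vol (DIM('a)) * (sqrt (DIM('a)) / 2) ^ DIM('a)) * emeasure lborel (box u v)"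
    using h by (simp add: hausdorff_size_def d mult_ac power_mult_distrib power_divide
        flip: ennreal_mult)
qed

text \<open>A null set is covered by small dyadic cubes inside an open set of measure less than
  \<open>e\<close>. Their sizes exceed their volumes by the fixed factor
  \<open>\<kappa>\<close>, the ratio of the volumes of a ball and its inscribed cube.\<close>

lemma hausdorff_pre_negligible:
  fixes N :: "'a::euclidean_space set"
  assumes N: "negligible N" "bounded N" and \<delta>: "0 < \<delta>"
  shows "hausdorff_pre (DIM('a)) \<delta> N = 0"
proof -
  define \<kappa> where "\<kappa> = unit_ball_vol (DIM('a)) * (sqrt (DIM('a)) / 2) ^ DIM('a)"
  have \<kappa>: "0 \<le> \<kappa>" by (simp add: \<kappa>_def)
  obtain r0 where r0: "\<And>x. x \<in> N \<Longrightarrow> norm x \<le> r0" using N(2) by (auto simp: bounded_iff)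
  define r where "r = max r0 1"
  have r: "0 < r" "\<And>x. x \<in> N \<Longrightarrow> norm x \<le> r" using r0 by (fastforce simp: r_def)+
  define a :: 'a where "a = r *\<^sub>R One"
  have Na: "N \<subseteq> cbox (- a) a"
  proof
    fix x assume "x \<in> N"
    then have "\<bar>x \<bullet> i\<bar> \<le> r" if "i \<in> Basis" for i using r(2) Basis_le_norm[OF that, of x] by fastforce
    then show "x \<in> cbox (- a) a" by (auto simp: mem_box a_def abs_le_iff minus_le_iff)
  qed
  have ne: "box (- a) a \<noteq> {}" using r by (auto simp: box_ne_empty a_def)
  have small: "hausdorff_pre (DIM('a)) \<delta> N \<le> ennreal \<kappa> * ennreal e" if e: "0 < e" for e
  proof -
    obtain T where T: "open T" "N \<subseteq> T" "emeasure lebesgue (T - N) < ennreal e"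
      using sets_lebesgue_outer_open[of N e] N(1) e
      by (metis negligible_imp_sets)
    have "emeasure lebesgue T = emeasure lebesgue ((T - N) \<union> N)" using T by (simp add: Un_absorb2)
    also have "\<dots> = emeasure lebesgue (T - N)"
      using N T by (intro emeasure_Un_null_set) (auto simp: negligible_iff_null_sets)
    finally have Te: "emeasure lborel T \<le> ennreal e" using T by simp
    define g where "g x = (if x \<in> N then ball x (\<delta> / 2) \<inter> T else ball x 1)" for x
    have "gauge g" using T \<delta> unfolding gauge_def g_def by auto
    from covering_lemma[OF Na ne this] obtain \<D> where \<D>: "countable \<D>"
      "\<And>K. K \<in> \<D> \<Longrightarrow> interior K \<noteq> {} \<and> (\<exists>c d. K = cbox c d)"
      "pairwise (\<lambda>A B. interior A \<inter> interior B = {}) \<D>"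
      "\<And>K. K \<in> \<D> \<Longrightarrow> \<exists>x \<in> N \<inter> K. K \<subseteq> g x"
      "\<And>u v. cbox u v \<in> \<D> \<Longrightarrow> \<exists>n. \<forall>i \<in> Basis. v \<bullet> i - u \<bullet> i = (a \<bullet> i - (- a) \<bullet> i) / 2^n"
      "N \<subseteq> \<Union>\<D>" by metis
    have sub: "bounded K \<and> diameter K \<le> \<delta> \<and> K \<subseteq> T" if K: "K \<in> \<D>" for K
    proof -
      obtain x where "K \<subseteq> ball x (\<delta> / 2) \<inter> T" using \<D>(4)[OF K] by (auto simp: g_def)
      moreover from this have "diameter K \<le> diameter (ball x (\<delta> / 2))"
        by (intro diameter_subset) auto
      ultimately show ?thesis using \<delta> by (auto intro: bounded_subset)
    qed
    have size: "hausdorff_size (DIM('a)) K \<le> ennreal \<kappa> * emeasure lborel (interior K)" if K: "K \<in> \<D>" for K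
    proof -
      obtain u v where uv: "K = cbox u v" using \<D>(2)[OF K] by auto
      obtain n :: nat where n: "\<forall>i \<in> Basis. v \<bullet> i - u \<bullet> i = (a \<bullet> i - (- a) \<bullet> i) / 2^n"
        using \<D>(5) K uv by blast
      have "v \<bullet> i - u \<bullet> i = 2 * r / 2 ^ n" if "i \<in> Basis" for i
        using n that by (simp add: a_def)
      from hausdorff_size_cube(2)[OF this] show ?thesis
        using r by (simp add: uv \<kappa>_def interior_cbox)
    qed
    have "hausdorff_pre (DIM('a)) \<delta> N \<le> ennreal \<kappa> * emeasure lborel T"
    proof (rule hausdorff_pre_le_packing[OF \<D>(1), of N "\<lambda>K. K"])
      show "disjoint_family_on interior \<D>"
        using \<D>(3) by (auto simp: disjoint_family_on_def pairwise_def)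
      show "interior K \<subseteq> T" if "K \<in> \<D>" for K
        using sub[OF that] interior_subset by blast
    qed (use \<D> sub size \<delta> T in auto)
    also have "\<dots> \<le> ennreal \<kappa> * ennreal e" using Te by (rule mult_left_mono) simp
    finally show ?thesis .
  qed
  have "hausdorff_pre (DIM('a)) \<delta> N \<le> 0 + ennreal e" if e: "0 < e" for e
  proof -
    have "ennreal \<kappa> * ennreal (e / (\<kappa> + 1)) = ennreal (\<kappa> * (e / (\<kappa> + 1)))"
      using \<kappa> e by (simp flip: ennreal_mult)
    also have "\<dots> \<le> ennreal e" using \<kappa> e by (intro ennreal_leI) (simp add: field_simps)
    finally show ?thesis using small[of "e / (\<kappa> + 1)"] \<kappa> e by (auto intro: order_trans)
  qed
  then have "hausdorff_pre (DIM('a)) \<delta> N \<le> 0" by (rule ennreal_le_epsilon)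
  then show ?thesis by simp
qed

lemma hausdorff_outer_negligible:
  fixes N :: "'a::euclidean_space set"
  assumes N: "negligible N"
  shows "hausdorff_outer (DIM('a)) N = 0"
proof -
  have "hausdorff_outer (DIM('a)) (N \<inter> ball 0 (real k)) = 0" for k
  proof -
    have "hausdorff_pre (DIM('a)) \<delta> (N \<inter> ball 0 (real k)) = 0" if "0 < \<delta>" for \<delta>
      using that N by (intro hausdorff_pre_negligible) (auto intro: negligible_subset bounded_subset)
    then show ?thesis by (simp add: hausdorff_outer_def SUP_eq_const)
  qed
  moreover have "N = (\<Union>k. N \<inter> ball 0 (real k))"
    using reals_Archimedean2 by (auto simp: mem_ball)
  ultimately show ?thesis
    using hausdorff_outer_UN_le[of "DIM('a)" "\<lambda>k. N \<inter> ball 0 (real k)"] by simp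
qed

text \<open>Small disjoint balls fill an open set up to a null set, and the size of a ball is its volume.\<close>

lemma hausdorff_outer_open_le:
  fixes T :: "'a::euclidean_space set"
  assumes T: "open T"
  shows "hausdorff_outer (DIM('a)) T \<le> emeasure lborel T"
  unfolding hausdorff_outer_def
proof (rule SUP_least)
  fix \<delta> :: real assume "\<delta> \<in> {0<..}"
  then have \<delta>: "0 < \<delta>" by simp
  define K where "K = {p :: 'a \<times> real. 0 < snd p \<and> 2 * snd p \<le> \<delta> \<and> ball (fst p) (snd p) \<subseteq> T}"
  have fine: "\<exists>i. i \<in> K \<and> x \<in> ball (fst i) (snd i) \<and> snd i < d" if x: "x \<in> T" "0 < d" for x d
  proof -
    obtain e where e: "0 < e" "ball x e \<subseteq> T" using T x open_contains_ball by blast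
    define r where "r = min e (min (\<delta> / 2) (d / 2))"
    have "ball x r \<subseteq> ball x e" by (auto simp: r_def)
    then have "(x, r) \<in> K" "snd (x, r) < d"
      using e \<delta> x by (auto simp: K_def r_def)
    moreover from this have "x \<in> ball (fst (x, r)) (snd (x, r))" by (simp add: K_def)
    ultimately show ?thesis by blast
  qed
  obtain C where C: "countable C" "C \<subseteq> K"
    "pairwise (\<lambda>i j. disjnt (ball (fst i) (snd i)) (ball (fst j) (snd j))) C"
    "negligible (T - (\<Union>i \<in> C. ball (fst i) (snd i)))"
    by (rule Vitali_covering_theorem_balls[of T K fst snd, OF fine])
  let ?U = "\<Union>i \<in> C. ball (fst i) (snd i)"
  have CK: "0 < snd i" "2 * snd i \<le> \<delta>" "ball (fst i) (snd i) \<subseteq> T" if "i \<in> C" for i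
    using that C(2) by (auto simp: K_def)
  have "hausdorff_pre (DIM('a)) \<delta> ?U \<le> 1 * emeasure lborel T"
  proof (rule hausdorff_pre_le_packing[OF C(1) subset_refl, where B = "\<lambda>i. ball (fst i) (snd i)"])
    show "disjoint_family_on (\<lambda>i. ball (fst i) (snd i)) C"
      using C(3) by (auto simp: disjoint_family_on_def pairwise_def disjnt_def)
    show "hausdorff_size (DIM('a)) (ball (fst i) (snd i)) \<le> 1 * emeasure lborel (ball (fst i) (snd i))"
      if "i \<in> C" for i
      using CK[OF that] by (simp add: hausdorff_size_def emeasure_ball)
  qed (use CK \<delta> T in \<open>auto simp: less_imp_le\<close>)
  then have U: "hausdorff_pre (DIM('a)) \<delta> ?U \<le> emeasure lborel T" by simp
  have rest: "hausdorff_pre (DIM('a)) \<delta> (T - ?U) = 0"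
    using hausdorff_pre_le_outer[OF \<delta>, of "DIM('a)" "T - ?U"] hausdorff_outer_negligible[OF C(4)] by simp
  have "hausdorff_pre (DIM('a)) \<delta> T \<le> hausdorff_pre (DIM('a)) \<delta> (?U \<union> (T - ?U))"
    by (intro hausdorff_pre_mono) auto
  also have "\<dots> \<le> hausdorff_pre (DIM('a)) \<delta> ?U + hausdorff_pre (DIM('a)) \<delta> (T - ?U)"
    using \<delta> by (intro hausdorff_pre_Un_le) simp
  finally show "hausdorff_pre (DIM('a)) \<delta> T \<le> emeasure lborel T"
    using U by (simp add: rest)
qed

theorem hausdorff_outer_eq_lebesgue:
  fixes E :: "'a::euclidean_space set"
  assumes E: "E \<in> sets lebesgue"
  shows "hausdorff_outer (DIM('a)) E = emeasure lebesgue E"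
proof (rule antisym)
  show "hausdorff_outer (DIM('a)) E \<le> emeasure lebesgue E"
  proof (rule ennreal_le_epsilon)
    fix e :: real assume "0 < e"
    then obtain T where T: "open T" "E \<subseteq> T" "emeasure lebesgue (T - E) < ennreal e"
      using sets_lebesgue_outer_open[OF E] by metis
    have "hausdorff_outer (DIM('a)) E \<le> emeasure lebesgue T"
      using order_trans[OF hausdorff_outer_mono[OF T(2)] hausdorff_outer_open_le[OF T(1)]] T(1) by simp
    also have "T = E \<union> (T - E)" using T by auto
    also have "emeasure lebesgue \<dots> \<le> emeasure lebesgue E + emeasure lebesgue (T - E)"
      using E T by (intro emeasure_subadditive) auto
    also have "\<dots> \<le> emeasure lebesgue E + ennreal e" using T by (intro add_left_mono) auto
    finally show "hausdorff_outer (DIM('a)) E \<le> emeasure lebesgue E + ennreal e" .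
  qed
qed (rule emeasure_lebesgue_le_hausdorff)

text \<open>Lebesgue measure is a Hausdorff measure and so depends on the metric only. This transports it
  between different types of equal dimension.\<close>

lemma emeasure_isometry_image:
  fixes V :: "'a::euclidean_space \<Rightarrow> 'b::euclidean_space"
  assumes dim: "DIM('a) = DIM('b)" and V: "linear V" "\<And>x. norm (V x) = norm x"
    and E: "E \<in> sets lebesgue"
  shows "V ` E \<in> sets lebesgue" "emeasure lebesgue (V ` E) = emeasure lebesgue E"
proof -
  have dist: "dist (V x) (V y) = dist x y" for x y
    by (metis V dist_norm linear_diff)
  show VE: "V ` E \<in> sets lebesgue"
    using dim E linear_imp_differentiable_on[OF V(1)]
    by (intro differentiable_image_in_sets_lebesgue) auto
  have "hausdorff_outer (DIM('b)) (V ` E) \<le> ennreal (1 ^ DIM('b)) * hausdorff_outer (DIM('b)) E"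
    by (rule hausdorff_outer_lipschitz_image) (auto simp: dist)
  moreover have "hausdorff_outer (DIM('b)) (inv V ` V ` E) \<le> ennreal (1 ^ DIM('b)) * hausdorff_outer (DIM('b)) (V ` E)"
  proof -
    have "inj V" by (metis dist dist_eq_0_iff injI)
    then show ?thesis by (intro hausdorff_outer_lipschitz_image) (auto simp: dist)
  qed
  moreover have "inv V ` V ` E = E"
    by (metis dist dist_eq_0_iff injI image_inv_f_f)
  ultimately have "hausdorff_outer (DIM('b)) (V ` E) = hausdorff_outer (DIM('b)) E" by simp
  then show "emeasure lebesgue (V ` E) = emeasure lebesgue E"
    using hausdorff_outer_eq_lebesgue[OF VE] hausdorff_outer_eq_lebesgue[OF E] dim by simp
qed

lemma distr_lebesgue_isometry:
  fixes V :: "'a::euclidean_space \<Rightarrow> 'b::euclidean_space"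
  assumes V: "linear V" "\<And>x. norm (V x) = norm x" and V': "linear V'" "\<And>y. V (V' y) = y" "\<And>x. V' (V x) = x"
    and dim: "DIM('a) = DIM('b)"
  shows "V \<in> lebesgue \<rightarrow>\<^sub>M lebesgue" "distr lebesgue lebesgue V = lebesgue"
proof -
  have vim: "V -` E = V' ` E" for E using V' by (auto simp: image_iff) metis
  have nV': "norm (V' y) = norm y" for y using V(2)[of "V' y"] V'(2) by simp
  note im = emeasure_isometry_image[OF dim[symmetric] V'(1) nV']
  show m: "V \<in> lebesgue \<rightarrow>\<^sub>M lebesgue"
    by (rule measurableI) (auto simp: vim im(1))
  show "distr lebesgue lebesgue V = lebesgue"
  proof (rule measure_eqI)
    fix E assume "E \<in> sets (distr lebesgue lebesgue V)"
    then have E: "E \<in> sets lebesgue" by simp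
    then show "emeasure (distr lebesgue lebesgue V) E = emeasure lebesgue E"
      using im(2)[OF E] by (simp add: emeasure_distr[OF m] vim)
  qed simp
qed

section \<open>Change of variables for the cone map\<close>

text \<open>For an index type \<open>'n\<close> with at least two elements this type has one element less,
  so that vectors over it model a hyperplane of \<open>real ^ 'n\<close>. It carries a
  well-order, which the change of variables theorem demands of its index type; applied to
  \<open>'n option\<close> it yields a well-ordered copy of \<open>'n\<close>. The maximum keeps
  the type nonempty.\<close>

typedef ('n::finite) pred_index = "{..<max 1 (CARD('n) - 1)}"
  by (rule exI[of _ 0]) auto

instance pred_index :: (finite) finite
proof
  have "UNIV = (Abs_pred_index :: nat \<Rightarrow> 'a pred_index) ` {..<max 1 (CARD('a) - 1)}"
    by (rule type_definition.Abs_image[OF type_definition_pred_index, symmetric])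
  then show "finite (UNIV :: 'a pred_index set)" by (metis finite_imageI finite_lessThan)
qed

lemma card_pred_index: "CARD('n::finite pred_index) = max 1 (CARD('n) - 1)"
  using type_definition.card[OF type_definition_pred_index] by simp

instantiation pred_index :: (finite) wellorder
begin

definition less_eq_pred_index :: "'a pred_index \<Rightarrow> 'a pred_index \<Rightarrow> bool" where
  "x \<le> y \<longleftrightarrow> Rep_pred_index x \<le> Rep_pred_index y"

definition less_pred_index :: "'a pred_index \<Rightarrow> 'a pred_index \<Rightarrow> bool" where
  "x < y \<longleftrightarrow> Rep_pred_index x < Rep_pred_index y"

instance
proof
  fix P and a :: "'a pred_index"
  assume step: "\<And>x :: 'a pred_index. (\<And>y. y < x \<Longrightarrow> P y) \<Longrightarrow> P x"
  show "P a"
    by (induction a rule: measure_induct_rule[of Rep_pred_index])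
      (rule step, simp add: less_pred_index_def)
qed (auto simp: less_eq_pred_index_def less_pred_index_def Rep_pred_index_inject)

end

lemma isometry_inner:
  fixes V :: "'a::euclidean_space \<Rightarrow> 'b::euclidean_space"
  assumes "linear V" "\<And>x. norm (V x) = norm x"
  shows "V x \<bullet> V y = x \<bullet> y"
  by (simp add: dot_norm assms flip: linear_add[OF assms(1)])

lemma linear_rank_one: "linear (\<lambda>x. x + (b \<bullet> x) *\<^sub>R a)"
  by (rule linearI) (simp_all add: inner_add_right algebra_simps)

text \<open>After a rotation taking \<open>b\<close> to a multiple of a coordinate vector, only one column
  differs from the identity matrix.\<close>

lemma det_rank_one:
  fixes a b :: "real ^ 'm::finite"
  shows "det (matrix (\<lambda>x. x + (b \<bullet> x) *\<^sub>R a)) = 1 + a \<bullet> b"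
proof (cases "b = 0")
  case True
  then show ?thesis by (simp add: matrix_id_mat_1[unfolded id_def])
next
  case False
  obtain k :: 'm where True by simp
  let ?e = "axis k 1 :: real ^ 'm"
  obtain Q where Q: "orthogonal_transformation Q" "Q ?e = b /\<^sub>R norm b"
    using orthogonal_transformation_exists_1[of ?e "b /\<^sub>R norm b"] False by auto
  have lin: "linear Q" using Q by (simp add: orthogonal_transformation_linear)
  obtain P where P: "orthogonal_transformation P" "\<And>x. P (Q x) = x" "\<And>x. Q (P x) = x"
    using orthogonal_transformation_inv[OF Q(1)] orthogonal_transformation_bij[OF Q(1)]
    by (metis bij_inv_eq_iff)
  have linP: "linear P" using P by (simp add: orthogonal_transformation_linear)
  have Pin: "P x \<bullet> P y = x \<bullet> y" for x y
    using P(1) by (simp add: orthogonal_transformation_def)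
  have Pb: "P b = norm b *\<^sub>R ?e"
  proof -
    have "Q (norm b *\<^sub>R ?e) = b" using False by (simp add: linear_scale[OF lin] Q(2))
    then show ?thesis using P(2) by metis
  qed
  define g where "g x = x + (P b \<bullet> x) *\<^sub>R P a" for x
  have lg: "linear g" unfolding g_def by (rule linear_rank_one)
  have "(\<lambda>x. x + (b \<bullet> x) *\<^sub>R a) = Q \<circ> (g \<circ> P)"
    by (simp add: fun_eq_iff g_def linear_add[OF lin] linear_scale[OF lin] P Pin)
  then have "det (matrix (\<lambda>x. x + (b \<bullet> x) *\<^sub>R a)) = det (matrix g) * (det (matrix Q) * det (matrix P))"
    by (simp add: matrix_compose lin linP lg linear_compose det_mul mult_ac)
  also have "det (matrix Q) * det (matrix P) = 1"
  proof -
    have "Q \<circ> P = id" using P by auto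
    then show ?thesis
      by (metis det_I det_mul lin linP matrix_compose matrix_id_mat_1)
  qed
  also have "det (matrix g) = 1 + a \<bullet> b"
  proof -
    let ?x = "?e + norm b *\<^sub>R P a"
    have "matrix g = (\<chi> i j. if j = k then (mat 1 *v ?x) $ i else mat 1 $ i $ j)"
      by (simp add: vec_eq_iff matrix_def g_def Pb inner_axis_axis) (simp add: axis_def mat_def)
    then have "det (matrix g) = ?x $ k * det (mat 1 :: real ^ 'm ^ 'm)"
      using cramer_lemma[of k "mat 1" ?x] by simp
    also have "\<dots> = 1 + P a \<bullet> P b" by (simp add: Pb inner_axis mult.commute)
    finally show ?thesis by (simp add: Pin)
  qed
  finally show ?thesis by simp
qed

text \<open>The determinant of the derivative of \<open>(x, s) \<mapsto> z + s (x - z)\<close>, where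
  \<open>a\<close> is \<open>s\<close>, \<open>v\<close> is \<open>x - z\<close> and
  \<open>x\<close> runs through a graph over the hyperplane orthogonal to \<open>u\<close> with
  normal \<open>n\<close>. The map is a composition of a shear \<open>E\<close> along
  \<open>u\<close>, which tilts the hyperplane into the tangent plane, a homothety, and a rank
  one perturbation \<open>F\<close> of the identity.\<close>

lemma det_cone_map:
  fixes n u v :: "real ^ 'm::finite"
  assumes u: "u \<bullet> u = 1" and nu: "n \<bullet> u \<noteq> 0" and a: "a \<noteq> 0"
  shows "det (matrix (\<lambda>w. a *\<^sub>R w - (a * (n \<bullet> w) / (n \<bullet> u)) *\<^sub>R u + (u \<bullet> w) *\<^sub>R v)) =
    a ^ (CARD('m) - 1) * (n \<bullet> v) / (n \<bullet> u)"
proof -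
  define n' where "n' = n - (n \<bullet> u) *\<^sub>R u"
  have n'u: "n' \<bullet> u = 0" by (simp add: n'_def inner_diff_left u)
  define v' where "v' = v + ((n' \<bullet> v) / (n \<bullet> u)) *\<^sub>R u"
  define E where "E w = w + (n' \<bullet> w) *\<^sub>R ((- 1 / (n \<bullet> u)) *\<^sub>R u)" for w
  define F where "F w = w + (u \<bullet> w) *\<^sub>R ((1 / a) *\<^sub>R (v' - a *\<^sub>R u))" for w
  have lin: "linear E" "linear F" "linear ((*\<^sub>R) a)"
    unfolding E_def F_def by (rule linear_rank_one linear_scaleR)+
  have n: "n \<bullet> w = n' \<bullet> w + (n \<bullet> u) * (u \<bullet> w)" for w
    by (simp add: n'_def inner_diff_left)
  have "(\<lambda>w. a *\<^sub>R w - (a * (n \<bullet> w) / (n \<bullet> u)) *\<^sub>R u + (u \<bullet> w) *\<^sub>R v) = E \<circ> ((*\<^sub>R) a \<circ> F)"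
  proof
    fix w
    have aF: "a *\<^sub>R F w = a *\<^sub>R w + (u \<bullet> w) *\<^sub>R (v' - a *\<^sub>R u)"
      using a by (simp add: F_def scaleR_add_right)
    have "n' \<bullet> (a *\<^sub>R F w) = a * (n' \<bullet> w) + (u \<bullet> w) * (n' \<bullet> v)"
      unfolding aF by (simp add: inner_add_right inner_diff_right n'u v'_def)
    then have "E (a *\<^sub>R F w) = a *\<^sub>R w + (u \<bullet> w) *\<^sub>R (v' - a *\<^sub>R u) +
        ((a * (n' \<bullet> w) + (u \<bullet> w) * (n' \<bullet> v)) * (- 1 / (n \<bullet> u))) *\<^sub>R u"
      by (simp only: E_def aF scaleR_scaleR)
    also have "\<dots> = a *\<^sub>R w + (u \<bullet> w) *\<^sub>R v + ((u \<bullet> w) * ((n' \<bullet> v) / (n \<bullet> u)) - (u \<bullet> w) * a +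
        (a * (n' \<bullet> w) + (u \<bullet> w) * (n' \<bullet> v)) * (- 1 / (n \<bullet> u))) *\<^sub>R u"
      by (simp add: v'_def algebra_simps)
    also have "(u \<bullet> w) * ((n' \<bullet> v) / (n \<bullet> u)) - (u \<bullet> w) * a +
        (a * (n' \<bullet> w) + (u \<bullet> w) * (n' \<bullet> v)) * (- 1 / (n \<bullet> u)) = - (a * (n \<bullet> w) / (n \<bullet> u))"
      unfolding n[of w] using nu by (simp add: field_simps)
    finally show "a *\<^sub>R w - (a * (n \<bullet> w) / (n \<bullet> u)) *\<^sub>R u + (u \<bullet> w) *\<^sub>R v = (E \<circ> ((*\<^sub>R) a \<circ> F)) w"
      by simp
  qed
  then have "det (matrix (\<lambda>w. a *\<^sub>R w - (a * (n \<bullet> w) / (n \<bullet> u)) *\<^sub>R u + (u \<bullet> w) *\<^sub>R v)) =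
      det (matrix E) * (det (matrix ((*\<^sub>R) a :: real ^ 'm \<Rightarrow> _)) * det (matrix F))"
    by (simp add: matrix_compose lin linear_compose det_mul)
  also have "det (matrix E) = 1"
    unfolding E_def det_rank_one by (simp add: inner_commute[of u] n'u)
  also have "det (matrix F) = (n \<bullet> v) / (n \<bullet> u) / a"
  proof -
    have "det (matrix F) = 1 + (1 / a) * ((v' - a *\<^sub>R u) \<bullet> u)"
      unfolding F_def det_rank_one by simp
    also have "(v' - a *\<^sub>R u) \<bullet> u = (n \<bullet> v) / (n \<bullet> u) - a"
      unfolding v'_def inner_diff_left inner_add_left inner_scaleR_left u n[of v] inner_commute[of v u]
      using nu by (simp add: field_simps)
    finally show ?thesis using a by (simp add: field_simps)
  qed
  also have "det (matrix ((*\<^sub>R) a :: real ^ 'm \<Rightarrow> _)) = a ^ CARD('m)"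
    by (rule det_matrix_scaleR)
  also have "a ^ CARD('m) = a * a ^ (CARD('m) - 1)"
    by (metis One_nat_def Suc_pred power_Suc zero_less_card_finite)
  finally show ?thesis using a by simp
qed

lemma nn_integral_lebesgue_isometry:
  fixes V :: "'a::euclidean_space \<Rightarrow> 'b::euclidean_space"
  assumes V: "linear V" "\<And>x. norm (V x) = norm x" and V': "linear V'" "\<And>y. V (V' y) = y" "\<And>x. V' (V x) = x"
    and dim: "DIM('a) = DIM('b)" and f: "f \<in> borel_measurable lebesgue"
  shows "(\<integral>\<^sup>+x. f (V x) \<partial>lebesgue) = (\<integral>\<^sup>+y. f y \<partial>lebesgue)"
proof -
  note D = distr_lebesgue_isometry[OF V V' dim]
  have "(\<integral>\<^sup>+y. f y \<partial>lebesgue) = (\<integral>\<^sup>+y. f y \<partial>distr lebesgue lebesgue V)" by (simp add: D)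
  also have "\<dots> = (\<integral>\<^sup>+x. f (V x) \<partial>lebesgue)" by (rule nn_integral_distr[OF D(1)]) (use f in simp)
  finally show ?thesis ..
qed

text \<open>Change of variables with the determinant computed above. The isometry \<open>W\<close>
  identifies the space of parameters with the ambient space; both are transported to \<open>real
  ^ 'm\<close>, where the determinant is defined.\<close>

lemma nn_integral_cone_map:
  fixes G W :: "'c::euclidean_space \<Rightarrow> 'a::euclidean_space" and f :: "'a \<Rightarrow> real"
  assumes m: "CARD('m::{finite,wellorder}) = DIM('a)" and dim: "DIM('c) = DIM('a)"
    and W: "linear W" "\<And>x. norm (W x) = norm x" and W': "linear W'" "\<And>y. W (W' y) = y" "\<And>x. W' (W x) = x"
    and S: "S \<in> sets lebesgue" and inj: "inj_on G S"
    and u: "u \<bullet> u = 1" and n: "\<And>x. x \<in> S \<Longrightarrow> n x \<bullet> u \<noteq> 0" and a: "\<And>x. x \<in> S \<Longrightarrow> 0 < a x"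
    and der: "\<And>x. x \<in> S \<Longrightarrow> (G has_derivative (\<lambda>h. a x *\<^sub>R W h - (a x * (n x \<bullet> W h) / (n x \<bullet> u)) *\<^sub>R u +
        (u \<bullet> W h) *\<^sub>R v x)) (at x within S)"
    and f: "integrable lebesgue f" "\<And>x. 0 \<le> f x"
  shows "G ` S \<in> sets lebesgue"
    and "(\<integral>\<^sup>+y. ennreal (f y) * indicator (G ` S) y \<partial>lebesgue) =
      (\<integral>\<^sup>+x. ennreal (\<bar>a x ^ (DIM('a) - 1) * (n x \<bullet> v x) / (n x \<bullet> u)\<bar> * f (G x)) * indicator S x \<partial>lebesgue)"
proof -
  have "DIM((real, 'm) vec) = DIM('a)" using m by simp
  from isomorphisms_UNIV_UNIV[OF this] obtain V :: "(real, 'm) vec \<Rightarrow> 'a" and V' where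
    V: "linear V" "\<And>x. norm (V x) = norm x" and V': "linear V'" "\<And>y. V (V' y) = y" "\<And>x. V' (V x) = x"
    and nV': "\<And>x. norm (V' x) = norm x" by metis
  define T where "T x = W' (V x)" for x
  define T' where "T' y = V' (W y)" for y
  have nW': "norm (W' y) = norm y" for y using W(2)[of "W' y"] W'(2) by simp
  have T: "linear T" "norm (T x) = norm x" "linear T'" "T (T' y) = y" "T' (T x) = x" "norm (T' y) = norm y" for x y
    unfolding T_def T'_def
    using linear_compose[OF V(1) W'(1)] linear_compose[OF W(1) V'(1)] V V' W W' nV' nW' by (auto simp: o_def)
  have dT: "DIM((real, 'm) vec) = DIM('c)" using m dim by simp
  have G_diff: "G differentiable_on S"
    using der unfolding differentiable_on_def differentiable_def by blast
  show GS: "G ` S \<in> sets lebesgue"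
    using S dim G_diff by (intro differentiable_image_in_sets_lebesgue) auto
  define J where "J x = \<bar>a x ^ (DIM('a) - 1) * (n x \<bullet> v x) / (n x \<bullet> u)\<bar>" for x
  define S' where "S' = T' ` S"
  define g where "g x = V' (G (T x))" for x
  define g' where "g' x h = V' (a (T x) *\<^sub>R V h - (a (T x) * (n (T x) \<bullet> V h) / (n (T x) \<bullet> u)) *\<^sub>R u +
        (u \<bullet> V h) *\<^sub>R v (T x))" for x h
  have S'_iff: "x \<in> S' \<longleftrightarrow> T x \<in> S" for x unfolding S'_def using T by (metis image_iff)
  have S': "S' \<in> sets lebesgue"
    unfolding S'_def by (rule emeasure_isometry_image(1)[OF dT[symmetric] T(3,6) S])
  have TS': "T ` S' = S" unfolding S'_def using T by (auto simp: image_image)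
  have der': "(g has_derivative g' x) (at x within S')" if x: "x \<in> S'" for x
  proof -
    have Tx: "T x \<in> S" using x S'_iff by simp
    have "bounded_linear T" and bV': "bounded_linear V'"
      using T(1) V'(1) by (simp_all add: linear_linear)
    then have dT: "(T has_derivative T) (at x within S')"
      by (auto intro: bounded_linear_imp_has_derivative)
    have WT: "W (T h) = V h" for h by (simp add: T_def W')
    have "((\<lambda>x. G (T x)) has_derivative (\<lambda>h. a (T x) *\<^sub>R V h - (a (T x) * (n (T x) \<bullet> V h) / (n (T x) \<bullet> u)) *\<^sub>R u +
        (u \<bullet> V h) *\<^sub>R v (T x))) (at x within S')"
      using has_derivative_in_compose[OF dT der[OF Tx, folded TS']] by (simp add: WT)
    from has_derivative_in_compose[OF this bounded_linear_imp_has_derivative[OF bV']]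
    show ?thesis unfolding g_def g'_def .
  qed
  have inj': "inj_on g S'"
  proof (rule inj_onI)
    fix x y assume "x \<in> S'" "y \<in> S'" "g x = g y"
    then have "G (T x) = G (T y)" "T x \<in> S" "T y \<in> S"
      using V' S'_iff by (auto simp: g_def) metis
    then show "x = y" using inj T(5) by (metis inj_onD)
  qed
  have det: "\<bar>det (matrix (g' x))\<bar> = J (T x)" if x: "x \<in> S'" for x
  proof -
    have iV: "V h \<bullet> w = h \<bullet> V' w" for h w using isometry_inner[OF V, of h "V' w"] V'(2) by simp
    have iV': "w \<bullet> V h = V' w \<bullet> h" for h w using iV by (simp add: inner_commute)
    have i': "V' w \<bullet> V' w' = w \<bullet> w'" for w w' by (rule isometry_inner[OF V'(1) nV'])
    have "g' x = (\<lambda>h. a (T x) *\<^sub>R h - (a (T x) * (V' (n (T x)) \<bullet> h) / (V' (n (T x)) \<bullet> V' u)) *\<^sub>R V' u +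
        (V' u \<bullet> h) *\<^sub>R V' (v (T x)))"
      unfolding g'_def
      by (simp add: linear_add[OF V'(1)] linear_diff[OF V'(1)] linear_scale[OF V'(1)] V' iV' i')
    then have "det (matrix (g' x)) = a (T x) ^ (CARD('m) - 1) * (V' (n (T x)) \<bullet> V' (v (T x))) / (V' (n (T x)) \<bullet> V' u)"
      using n[of "T x"] a[of "T x"] x u
      by (simp only: S'_iff, intro det_cone_map) (simp_all add: i')
    then show ?thesis by (simp add: J_def m i')
  qed
  have mV: "V \<in> lebesgue \<rightarrow>\<^sub>M lebesgue" and dV: "distr lebesgue lebesgue V = lebesgue"
    using distr_lebesgue_isometry[OF V V' \<open>DIM((real, 'm) vec) = DIM('a)\<close>] by auto
  have fV: "integrable lebesgue (\<lambda>x. f (V x))"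
    using f(1) integrable_distr_eq[OF mV, of f] by (simp add: dV)
  have gS': "g ` S' = V' ` G ` S"
    unfolding g_def using TS' by (metis (no_types) image_image)
  have gS'_leb: "g ` S' \<in> sets lebesgue"
    unfolding gS' by (rule emeasure_isometry_image(1)[OF _ V'(1) nV' GS]) (use m in simp)
  have abs_f: "(\<lambda>x. f (V x)) absolutely_integrable_on (g ` S')"
  proof (rule set_integrable_subset[OF _ gS'_leb subset_UNIV])
    show "set_integrable lebesgue UNIV (\<lambda>x. f (V x))" using fV by (simp add: set_integrable_def)
  qed
  have cov: "(\<lambda>x. \<bar>det (matrix (g' x))\<bar> *\<^sub>R f (V (g x))) absolutely_integrable_on S'"
    "integral S' (\<lambda>x. \<bar>det (matrix (g' x))\<bar> *\<^sub>R f (V (g x))) = integral (g ` S') (\<lambda>x. f (V x))"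
  proof -
    \<comment> \<open>The change of variables theorem is about vector-valued functions.\<close>
    let ?f = "\<lambda>x. vec (f (V x)) :: real ^ 1"
    have "?f absolutely_integrable_on (g ` S')"
      using abs_f by (simp add: absolutely_integrable_on_1_iff)
    then have "(\<lambda>x. \<bar>det (matrix (g' x))\<bar> *\<^sub>R ?f (g x)) absolutely_integrable_on S' \<and>
        integral S' (\<lambda>x. \<bar>det (matrix (g' x))\<bar> *\<^sub>R ?f (g x)) = integral (g ` S') ?f"
      using has_absolute_integral_change_of_variables[OF S' der' inj', of ?f "integral (g ` S') ?f"] by blast
    then show "(\<lambda>x. \<bar>det (matrix (g' x))\<bar> *\<^sub>R f (V (g x))) absolutely_integrable_on S'"
      "integral S' (\<lambda>x. \<bar>det (matrix (g' x))\<bar> *\<^sub>R f (V (g x))) = integral (g ` S') (\<lambda>x. f (V x))"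
      by (simp_all add: absolutely_integrable_on_1_iff integral_on_1_eq vec_eq_iff)
  qed
  have nn: "(\<integral>\<^sup>+x. ennreal (h x) * indicator A x \<partial>lebesgue) = ennreal (integral A h)"
    if h: "h absolutely_integrable_on A" "\<And>x. 0 \<le> h x" for h :: "(real, 'm) vec \<Rightarrow> real" and A
  proof -
    have "(\<integral>\<^sup>+x. ennreal (h x) * indicator A x \<partial>lebesgue) = (\<integral>\<^sup>+x. ennreal (indicator A x *\<^sub>R h x) \<partial>lebesgue)"
      by (intro nn_integral_cong) (auto simp: indicator_def)
    also have "\<dots> = ennreal (LINT x:A|lebesgue. h x)"
      using h unfolding set_integrable_def set_lebesgue_integral_def
      by (intro nn_integral_eq_integral) (auto simp: indicator_def)
    also have "(LINT x:A|lebesgue. h x) = integral A h"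
      by (rule set_lebesgue_integral_eq_integral(2)[OF h(1)])
    finally show ?thesis .
  qed
  define F where "F y = ennreal (f y) * indicator (G ` S) y" for y
  define H where "H x = ennreal (J x * f (G x)) * indicator S x" for x
  have F_eq: "F (V x) = ennreal (f (V x)) * indicator (g ` S') x" for x
    unfolding F_def gS' using V' by (auto simp: indicator_def image_iff) metis
  have H_eq: "H (T x) = ennreal (\<bar>det (matrix (g' x))\<bar> *\<^sub>R f (V (g x))) * indicator S' x" for x
    by (auto simp: H_def S'_iff det g_def V' indicator_def)
  have "(\<integral>\<^sup>+y. F y \<partial>lebesgue) = (\<integral>\<^sup>+x. F (V x) \<partial>lebesgue)"
  proof (rule nn_integral_lebesgue_isometry[OF V V' \<open>DIM((real, 'm) vec) = DIM('a)\<close>, symmetric])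
    show "F \<in> borel_measurable lebesgue"
      using borel_measurable_integrable[OF f(1)] GS unfolding F_def
      by (intro borel_measurable_times_ennreal borel_measurable_indicator) auto
  qed
  also have "\<dots> = (\<integral>\<^sup>+x. H (T x) \<partial>lebesgue)"
    unfolding F_eq H_eq nn[OF abs_f f(2)] by (subst nn[OF cov(1)]) (use f cov(2) in auto)
  also have "\<dots> = (\<integral>\<^sup>+x. H x \<partial>lebesgue)"
  proof (rule nn_integral_lebesgue_isometry[OF T(1,2,3,4,5) dT])
    have "(\<lambda>x. indicator S' x *\<^sub>R (\<bar>det (matrix (g' x))\<bar> *\<^sub>R f (V (g x)))) \<in> borel_measurable lebesgue"
      using cov(1) unfolding set_integrable_def by (rule borel_measurable_integrable)
    then have "(\<lambda>x. ennreal (indicator S' x *\<^sub>R (\<bar>det (matrix (g' x))\<bar> *\<^sub>R f (V (g x))))) \<in> borel_measurable lebesgue"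
      by measurable
    also have "(\<lambda>x. ennreal (indicator S' x *\<^sub>R (\<bar>det (matrix (g' x))\<bar> *\<^sub>R f (V (g x))))) = (\<lambda>x. H (T x))"
      unfolding H_eq by (auto simp: indicator_def)
    finally have "(\<lambda>x. H (T x)) \<in> borel_measurable lebesgue" .
    moreover have "T' \<in> lebesgue \<rightarrow>\<^sub>M lebesgue"
      by (rule distr_lebesgue_isometry(1)[OF T(3,6,1,5,4) dT[symmetric]])
    ultimately have "(\<lambda>x. H (T (T' x))) \<in> borel_measurable lebesgue"
      by (rule measurable_compose[rotated])
    then show "H \<in> borel_measurable lebesgue" by (simp add: T)
  qed
  finally show "(\<integral>\<^sup>+y. ennreal (f y) * indicator (G ` S) y \<partial>lebesgue) =
      (\<integral>\<^sup>+x. ennreal (\<bar>a x ^ (DIM('a) - 1) * (n x \<bullet> v x) / (n x \<bullet> u)\<bar> * f (G x)) * indicator S x \<partial>lebesgue)"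
    by (simp add: F_def H_def J_def)
qed

section \<open>Normals of a convex body\<close>

definition normals :: "'a::euclidean_space set \<Rightarrow> 'a \<Rightarrow> 'a set" where
  "normals K x = {u. norm u = 1 \<and> (\<forall>y\<in>K. (y - x) \<bullet> u \<le> 0)}"

text \<open>Having a normal places these points in the frontier of \<open>K\<close>.\<close>

definition smooth_points :: "'a::euclidean_space set \<Rightarrow> 'a set" where
  "smooth_points K = {x \<in> K. \<exists>!u. u \<in> normals K x}"

lemma normalsD: "u \<in> normals K x \<Longrightarrow> norm u = 1" "u \<in> normals K x \<Longrightarrow> y \<in> K \<Longrightarrow> (y - x) \<bullet> u \<le> 0"
  by (auto simp: normals_def)

lemma outer_unit_normal_eq:
  assumes "x \<in> smooth_points K" "u \<in> normals K x"
  shows "outer_unit_normal K x = u"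
proof -
  have "\<exists>!u. norm u = 1 \<and> (\<forall>y\<in>K. (y - x) \<bullet> u \<le> 0)"
    using assms(1) by (simp add: smooth_points_def normals_def)
  then show ?thesis
    using assms(2) by (auto simp: outer_unit_normal_def normals_def intro!: the1_equality)
qed

lemma outer_unit_normal_in_normals:
  assumes "x \<in> smooth_points K"
  shows "outer_unit_normal K x \<in> normals K x"
  using assms outer_unit_normal_eq[OF assms] by (auto simp: smooth_points_def)

lemma outer_unit_normal_not_smooth:
  assumes "x \<in> K" "x \<notin> smooth_points K"
  shows "outer_unit_normal K x = 0"
  using assms by (auto simp: smooth_points_def normals_def outer_unit_normal_def)

lemma not_interior_normal:
  assumes u: "u \<in> normals K x"
  shows "x \<notin> interior K"
proof
  assume "x \<in> interior K"
  then obtain e where e: "0 < e" "cball x e \<subseteq> K" by (meson mem_interior_cball)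
  have u1: "norm u = 1" using normalsD(1)[OF u] .
  have "x + e *\<^sub>R u \<in> cball x e" using e u1 by (simp add: dist_norm)
  then have "(x + e *\<^sub>R u - x) \<bullet> u \<le> 0" using e normalsD(2)[OF u] by blast
  then show False using e u1 by (simp add: dot_square_norm)
qed

text \<open>A hyperplane separating \<open>K\<close> from the half-line supports \<open>K\<close> at
  \<open>x\<close>. At a smooth point this determines the side to which the normal points, from
  a direction that leaves \<open>K\<close>.\<close>

lemma normals_halfline:
  fixes K :: "'a::euclidean_space set"
  assumes K: "convex K" and x: "x \<in> K" and out: "\<And>d. 0 < d \<Longrightarrow> x + d *\<^sub>R v \<notin> K"
  shows "\<exists>m\<in>normals K x. 0 \<le> m \<bullet> v"
proof -
  define R where "R = (\<lambda>d. x + d *\<^sub>R v) ` {0<..}"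
  have "convex R"
  proof -
    have "R = (+) x ` (\<lambda>d. d *\<^sub>R v) ` {0<..}" by (simp add: R_def image_image)
    then show ?thesis
      by (auto intro!: convex_translation convex_linear_image linearI simp: scaleR_add_left)
  qed
  moreover have "R \<noteq> {}" "K \<inter> R = {}" "K \<noteq> {}" using out x by (auto simp: R_def)
  ultimately obtain a b where ab: "a \<noteq> 0" "\<forall>y\<in>K. a \<bullet> y \<le> b" "\<forall>y\<in>R. b \<le> a \<bullet> y"
    using separating_hyperplane_sets[OF K, of R] by auto
  have R: "b \<le> a \<bullet> x + d * (a \<bullet> v)" if "0 < d" for d
    using ab(3) that by (auto simp: R_def inner_add_right)
  have "b \<le> a \<bullet> x + e" if e: "0 < e" for e
  proof -
    have "b \<le> a \<bullet> x + e / (\<bar>a \<bullet> v\<bar> + 1) * (a \<bullet> v)" using e by (intro R) simp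
    also have "e / (\<bar>a \<bullet> v\<bar> + 1) * (a \<bullet> v) \<le> e / (\<bar>a \<bullet> v\<bar> + 1) * (\<bar>a \<bullet> v\<bar> + 1)"
      using e by (intro mult_left_mono) auto
    finally show ?thesis by simp
  qed
  then have b: "b = a \<bullet> x" using ab(2) x by (meson antisym field_le_epsilon)
  let ?m = "a /\<^sub>R norm a"
  have "(y - x) \<bullet> ?m \<le> 0" if "y \<in> K" for y
    using ab that by (simp add: b inner_diff_right inner_commute[of _ a] mult_le_0_iff)
  then have "?m \<in> normals K x" using ab(1) by (simp add: normals_def)
  moreover have "0 \<le> ?m \<bullet> v" using R[of 1] by (simp add: b)
  ultimately show ?thesis by blast
qed

text \<open>The half-line from an interior point through \<open>x\<close> leaves \<open>K\<close> at
  \<open>x\<close>, so it can be separated from \<open>K\<close> there.\<close>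

lemma frontier_has_normal:
  fixes K :: "'a::euclidean_space set"
  assumes K: "convex K" "closed K" "interior K \<noteq> {}" and x: "x \<in> frontier K"
  shows "normals K x \<noteq> {}"
proof -
  have xK: "x \<in> K" "x \<notin> interior K" using x K(2) by (auto simp: frontier_def)
  obtain c where c: "c \<in> interior K" using K(3) by blast
  have "x + d *\<^sub>R (x - c) \<notin> K" if d: "0 < d" for d
  proof
    let ?y = "x + d *\<^sub>R (x - c)"
    assume "?y \<in> K"
    then have "?y - (d / (1 + d)) *\<^sub>R (?y - c) \<in> interior K"
      using d by (intro mem_interior_convex_shrink K c) (auto simp: field_simps)
    moreover have "?y - c = (1 + d) *\<^sub>R (x - c)" by (simp add: algebra_simps)
    then have "(d / (1 + d)) *\<^sub>R (?y - c) = d *\<^sub>R (x - c)" using d by simp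
    ultimately show False using xK(2) by simp
  qed
  from normals_halfline[OF K(1) xK(1) this] show ?thesis by blast
qed

lemma normals_not_antipodal:
  fixes K :: "'a::euclidean_space set"
  assumes K: "interior K \<noteq> {}" and u: "u \<in> normals K x" and v: "- u \<in> normals K x"
  shows False
proof -
  obtain y e where e: "0 < e" "cball y e \<subseteq> K" using K by (meson ex_in_conv mem_interior_cball)
  have u1: "norm u = 1" using normalsD(1)[OF u] .
  have "y \<in> K" "y + e *\<^sub>R u \<in> K" using e u1 by (auto intro!: subsetD[OF e(2)] simp: dist_norm)
  then have "(y - x) \<bullet> u = 0" "(y + e *\<^sub>R u - x) \<bullet> u = 0"
    using normalsD(2)[OF u] normalsD(2)[OF v] by (force intro: antisym)+
  then have "e * (u \<bullet> u) = 0" by (simp add: inner_diff_left inner_add_left)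
  then show False using e u1 by (simp add: dot_square_norm)
qed

lemma compact_normals_graph:
  fixes K :: "'a::euclidean_space set"
  assumes K: "compact K"
  shows "compact {(x, u). x \<in> K \<and> u \<in> normals K x}"
proof -
  have eq: "{(x, u). x \<in> K \<and> u \<in> normals K x} =
      (K \<times> sphere 0 1) \<inter> (\<Inter>y\<in>K. {p. (y - fst p) \<bullet> snd p \<le> 0})"
    by (auto simp: normals_def)
  have "closed (\<Inter>y\<in>K. {p. (y - fst p) \<bullet> snd p \<le> 0})"
    by (intro closed_INT ballI closed_Collect_le continuous_intros)
  then show ?thesis unfolding eq by (intro compact_Int_closed compact_Times K compact_sphere)
qed

lemma compact_normal_cap:
  fixes K :: "'a::euclidean_space set"
  assumes K: "compact K"
  shows "compact {x \<in> K. \<exists>m\<in>normals K x. c \<le> m \<bullet> u}"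
proof -
  have "compact ({(x, u). x \<in> K \<and> u \<in> normals K x} \<inter> {p. c \<le> snd p \<bullet> u})"
    by (intro compact_Int_closed compact_normals_graph K closed_Collect_le continuous_intros)
  then have "compact (fst ` ({(x, u). x \<in> K \<and> u \<in> normals K x} \<inter> {p. c \<le> snd p \<bullet> u}))"
    by (intro compact_continuous_image continuous_intros)
  also have "fst ` ({(x, u). x \<in> K \<and> u \<in> normals K x} \<inter> {p. c \<le> snd p \<bullet> u}) =
      {x \<in> K. \<exists>m\<in>normals K x. c \<le> m \<bullet> u}" by force
  finally show ?thesis .
qed

text \<open>The remaining points of \<open>K\<close> with a normal have two normals at distance at least
  \<open>1 / (m + 1)\<close> for some \<open>m\<close>; for each \<open>m\<close> they form a
  compact set.\<close>

lemma borel_smooth_points: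
  fixes K :: "'a::euclidean_space set"
  assumes K: "compact K"
  shows "smooth_points K \<in> sets borel"
proof -
  define N where "N = {(x, u). x \<in> K \<and> u \<in> normals K x}"
  define P where "P e = {(p, q). p \<in> N \<and> q \<in> N} \<inter> {r. fst (fst r) = fst (snd r)} \<inter>
    {r. e \<le> dist (snd (fst r)) (snd (snd r))}" for e
  have N: "compact N" unfolding N_def by (rule compact_normals_graph[OF K])
  have "compact (P e)" for e
  proof -
    have "P e = (N \<times> N) \<inter> {r. fst (fst r) = fst (snd r)} \<inter> {r. e \<le> dist (snd (fst r)) (snd (snd r))}"
      by (auto simp: P_def)
    moreover have "closed {r :: ('a \<times> 'a) \<times> ('a \<times> 'a). fst (fst r) = fst (snd r)}"
      "closed {r :: ('a \<times> 'a) \<times> ('a \<times> 'a). e \<le> dist (snd (fst r)) (snd (snd r))}"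
      by (intro closed_Collect_eq closed_Collect_le continuous_intros)+
    ultimately show ?thesis using N by (simp add: compact_Int_closed compact_Times)
  qed
  then have P: "closed ((\<lambda>r. fst (fst r)) ` P e)" for e
    by (intro compact_imp_closed compact_continuous_image continuous_intros)
  have NK: "closed (fst ` N)"
    using N by (intro compact_imp_closed compact_continuous_image continuous_intros)
  have "smooth_points K = fst ` N - (\<Union>m::nat. (\<lambda>r. fst (fst r)) ` P (1 / real (Suc m)))" (is "_ = ?R")
  proof (intro equalityI subsetI)
    fix x assume x: "x \<in> smooth_points K"
    then obtain u where u: "x \<in> K" "u \<in> normals K x" "\<And>v. v \<in> normals K x \<Longrightarrow> v = u"
      by (auto simp: smooth_points_def)
    have "x \<in> fst ` N" using u by (force simp: N_def)
    moreover have False if "r \<in> P (1 / real (Suc m))" "x = fst (fst r)" for r m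
    proof -
      have "snd (fst r) = snd (snd r)" using that u(3)[of "snd (fst r)"] u(3)[of "snd (snd r)"]
        by (auto simp: P_def N_def)
      then have "1 / real (Suc m) \<le> 0" using that(1) by (auto simp: P_def)
      then show False by simp
    qed
    ultimately show "x \<in> ?R" by blast
  next
    fix x assume x: "x \<in> ?R"
    then obtain u where u: "x \<in> K" "u \<in> normals K x" by (auto simp: N_def)
    have "v = u" if v: "v \<in> normals K x" for v
    proof (rule ccontr)
      assume "v \<noteq> u"
      then obtain m where m: "inverse (real (Suc m)) < dist u v"
        using reals_Archimedean[of "dist u v"] by auto
      then have "((x, u), (x, v)) \<in> P (1 / real (Suc m))"
        using u v by (auto simp: P_def N_def inverse_eq_divide)
      then show False using x by force
    qed
    then show "x \<in> smooth_points K" using u by (auto simp: smooth_points_def)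
  qed
  moreover have "?R \<in> sets borel"
    using P NK by (intro sets.Diff sets.countable_UN) auto
  ultimately show ?thesis by simp
qed

text \<open>A map into a compact set is continuous if its graph is closed.\<close>

lemma continuous_on_outer_unit_normal:
  fixes K :: "'a::euclidean_space set"
  assumes K: "compact K"
  shows "continuous_on (smooth_points K) (outer_unit_normal K)"
proof -
  have im: "outer_unit_normal K \<in> smooth_points K \<rightarrow> sphere 0 1"
    using outer_unit_normal_in_normals[of _ K] by (auto simp: normals_def)
  have "u = outer_unit_normal K x \<longleftrightarrow> u \<in> normals K x" if "x \<in> smooth_points K" for x u
    using outer_unit_normal_in_normals[OF that] outer_unit_normal_eq[OF that] by metis
  then have "(\<lambda>x. (x, outer_unit_normal K x)) ` smooth_points K =
      {(x, u). x \<in> smooth_points K \<and> u \<in> normals K x}" by auto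
  also have "\<dots> = (smooth_points K \<times> sphere 0 1) \<inter> {(x, u). x \<in> K \<and> u \<in> normals K x}"
    using normalsD(1)[of _ K] by (auto simp: smooth_points_def)
  finally have eq: "(\<lambda>x. (x, outer_unit_normal K x)) ` smooth_points K =
      (smooth_points K \<times> sphere 0 1) \<inter> {(x, u). x \<in> K \<and> u \<in> normals K x}" .
  have "closedin (top_of_set (smooth_points K \<times> sphere 0 1))
      ((\<lambda>x. (x, outer_unit_normal K x)) ` smooth_points K)"
    unfolding eq by (intro closedin_closed_Int compact_imp_closed compact_normals_graph K)
  then show ?thesis by (simp add: continuous_closed_graph_eq[OF compact_sphere im])
qed

section \<open>Cones over the boundary\<close>

definition open_cone :: "'a::euclidean_space \<Rightarrow> 'a set \<Rightarrow> 'a set" where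
  "open_cone z B = {z + s *\<^sub>R (x - z) | x s. x \<in> B \<and> 0 < s \<and> s < 1}"

lemma rational_between:
  fixes l h p t :: real
  assumes "l < h" "t \<noteq> 0"
  obtains \<alpha> where "l < \<alpha>" "\<alpha> < h" "p + \<alpha> * t \<in> \<rat>"
proof (cases "0 < t")
  case True
  then have "p + l * t < p + h * t" using assms by simp
  then obtain q where "q \<in> \<rat>" "p + l * t < q" "q < p + h * t" using Rats_dense_in_real by blast
  then show thesis using True that[of "(q - p) / t"] by (simp add: field_simps)
next
  case False
  then have t: "t < 0" using assms by simp
  then have "p + h * t < p + l * t" using assms by simp
  then obtain q where "q \<in> \<rat>" "p + h * t < q" "q < p + l * t" using Rats_dense_in_real by blast
  then show thesis using t that[of "(q - p) / t"] by (simp add: field_simps)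
qed

lemma closest_point_normal_direction:
  fixes K :: "'a::euclidean_space set"
  assumes K: "convex K" "closed K" and x: "x \<in> K" and y: "\<And>k. k \<in> K \<Longrightarrow> (k - x) \<bullet> (y - x) \<le> 0"
  shows "closest_point K y = x"
proof -
  have "dist y x \<le> dist y k" if k: "k \<in> K" for k
  proof -
    have "(norm (y - k))\<^sup>2 = (norm (y - x))\<^sup>2 + (norm (k - x))\<^sup>2 - 2 * ((k - x) \<bullet> (y - x))"
      by (simp add: power2_norm_eq_inner inner_diff_left inner_diff_right inner_commute algebra_simps)
    then have "(norm (y - x))\<^sup>2 \<le> (norm (y - k))\<^sup>2" using y[OF k] zero_le_power2[of "norm (k - x)"] by linarith
    then show ?thesis by (simp add: dist_norm)
  qed
  then show ?thesis using closest_point_unique[OF K x] by simp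
qed

text \<open>The points \<open>x + a u + b v\<close> with \<open>a, b > 0\<close> form an open sector of a
  plane, and their nearest point in \<open>K\<close> is \<open>x\<close>. Two of the coordinates
  embed this plane, so some point of the sector has rational values there.\<close>

lemma singular_point_on_rational_flat:
  fixes K :: "'a::euclidean_space set"
  assumes K: "convex K" "compact K" "interior K \<noteq> {}" and x: "x \<in> K"
    and uv: "u \<in> normals K x" "v \<in> normals K x" "u \<noteq> v"
  shows "\<exists>i\<in>Basis. \<exists>j\<in>Basis. \<exists>y. i \<noteq> j \<and> y \<bullet> i \<in> \<rat> \<and> y \<bullet> j \<in> \<rat> \<and> closest_point K y = x"
proof -
  have u1: "norm u = 1" "norm v = 1" using uv normalsD by auto
  then obtain i where i: "i \<in> Basis" "u \<bullet> i \<noteq> 0"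
    using euclidean_all_zero_iff[of u] by force
  \<comment> \<open>\<open>c\<close> is \<open>v\<close> made orthogonal to \<open>i\<close>: the
    \<open>i\<close>-th coordinate is adjusted by \<open>\<alpha>\<close> alone and then the
    \<open>j\<close>-th by \<open>\<beta>\<close>. The bounds on \<open>\<alpha>\<close> and
    \<open>\<beta>\<close> keep the coefficients of \<open>u\<close> and \<open>v\<close>
    positive.\<close>
  define l where "l = (v \<bullet> i) / (u \<bullet> i)"
  define c where "c = v - l *\<^sub>R u"
  have ci: "c \<bullet> i = 0" using i by (simp add: c_def l_def inner_diff_left)
  have "c \<noteq> 0"
  proof
    assume "c = 0"
    then have v: "v = l *\<^sub>R u" by (simp add: c_def)
    then have "\<bar>l\<bar> = 1" using u1 by simp
    then have "v = u \<or> v = - u" using v by (auto simp: abs_if split: if_splits)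
    then show False using uv normals_not_antipodal[OF K(3) uv(1)] by auto
  qed
  then obtain j where j: "j \<in> Basis" "c \<bullet> j \<noteq> 0"
    using euclidean_all_zero_iff[of c] by force
  obtain \<alpha> where \<alpha>: "\<bar>l\<bar> < \<alpha>" "x \<bullet> i + \<alpha> * (u \<bullet> i) \<in> \<rat>"
    using rational_between[of "\<bar>l\<bar>" "\<bar>l\<bar> + 1" "u \<bullet> i" "x \<bullet> i"] i by auto
  obtain \<beta> where \<beta>: "0 < \<beta>" "\<beta> < 1" "(x + \<alpha> *\<^sub>R u) \<bullet> j + \<beta> * (c \<bullet> j) \<in> \<rat>"
    using rational_between[of 0 1 "c \<bullet> j" "(x + \<alpha> *\<^sub>R u) \<bullet> j"] j by auto
  define y where "y = x + \<alpha> *\<^sub>R u + \<beta> *\<^sub>R c"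
  have "\<beta> * l \<le> \<beta> * \<bar>l\<bar>" "\<beta> * \<bar>l\<bar> \<le> 1 * \<bar>l\<bar>"
    using \<beta> by (intro mult_left_mono mult_right_mono; simp)+
  then have pos: "0 < \<alpha> - \<beta> * l" using \<alpha> by simp
  have "y - x = (\<alpha> - \<beta> * l) *\<^sub>R u + \<beta> *\<^sub>R v" by (simp add: y_def c_def algebra_simps)
  then have yx: "(k - x) \<bullet> (y - x) = (\<alpha> - \<beta> * l) * ((k - x) \<bullet> u) + \<beta> * ((k - x) \<bullet> v)" for k
    by (simp add: inner_add_right)
  have "(k - x) \<bullet> (y - x) \<le> 0" if "k \<in> K" for k
    unfolding yx using normalsD(2)[OF uv(1) that] normalsD(2)[OF uv(2) that] pos \<beta>(1)
    by (intro add_nonpos_nonpos mult_nonneg_nonpos) auto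
  then have "closest_point K y = x"
    using K x by (intro closest_point_normal_direction compact_imp_closed) auto
  moreover have "y \<bullet> i \<in> \<rat>" "y \<bullet> j \<in> \<rat>" using \<alpha> \<beta> ci by (simp_all add: y_def inner_add_left)
  moreover have "i \<noteq> j" using ci j by auto
  ultimately show ?thesis using i j by blast
qed

text \<open>The cone over the nearest-point projection of the flat \<open>y \<bullet> i = q, y \<bullet> j =
  r\<close>. On that flat the \<open>j\<close>-th coordinate carries no information; using it
  for the position on the ray makes the cone the image of a hyperplane under a locally Lipschitz
  map of the space to itself.\<close>

lemma negligible_cone_over_flat:
  fixes K :: "'a::euclidean_space set"
  assumes K: "convex K" "compact K" "K \<noteq> {}" and ij: "i \<in> Basis" "j \<in> Basis"
  shows "negligible ((\<lambda>y. z + (y \<bullet> j) *\<^sub>R (closest_point K (y + (r - y \<bullet> j) *\<^sub>R j) - z)) ` {y. y \<bullet> i = q})"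
    (is "negligible (?f ` ?S)")
proof (rule negligible_locally_Lipschitz_image)
  show "negligible ?S" by (rule negligible_standard_hyperplane[OF ij(1)])
  fix x assume "x \<in> ?S"
  let ?p = "\<lambda>y. closest_point K (y + (r - y \<bullet> j) *\<^sub>R j)"
  let ?B = "(\<bar>x \<bullet> j\<bar> + 1) * 2 + norm (?p x - z)"
  have "norm (?f y - ?f x) \<le> ?B * norm (y - x)" if y: "y \<in> ball x 1" for y
  proof -
    have yx: "\<bar>y \<bullet> j - x \<bullet> j\<bar> \<le> norm (y - x)"
      using Basis_le_norm[OF ij(2), of "y - x"] by (simp add: inner_diff_left)
    have "norm (?p y - ?p x) \<le> norm ((y + (r - y \<bullet> j) *\<^sub>R j) - (x + (r - x \<bullet> j) *\<^sub>R j))"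
      using closest_point_lipschitz[OF K(1) compact_imp_closed[OF K(2)] K(3)] by (simp add: dist_norm)
    also have "\<dots> = norm ((y - x) - (y \<bullet> j - x \<bullet> j) *\<^sub>R j)"
      by (simp add: algebra_simps)
    also have "\<dots> \<le> norm (y - x) + \<bar>y \<bullet> j - x \<bullet> j\<bar>"
      using norm_triangle_ineq4[of "y - x" "(y \<bullet> j - x \<bullet> j) *\<^sub>R j"] ij by simp
    finally have p: "norm (?p y - ?p x) \<le> 2 * norm (y - x)" using yx by simp
    have "\<bar>y \<bullet> j\<bar> \<le> \<bar>x \<bullet> j\<bar> + 1" using yx y by (simp add: dist_norm norm_minus_commute)
    then have "\<bar>y \<bullet> j\<bar> * norm (?p y - ?p x) \<le> (\<bar>x \<bullet> j\<bar> + 1) * (2 * norm (y - x))"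
      using p by (intro mult_mono) auto
    moreover have "\<bar>y \<bullet> j - x \<bullet> j\<bar> * norm (?p x - z) \<le> norm (y - x) * norm (?p x - z)"
      using yx by (intro mult_right_mono) auto
    moreover have "?f y - ?f x = (y \<bullet> j) *\<^sub>R (?p y - ?p x) + (y \<bullet> j - x \<bullet> j) *\<^sub>R (?p x - z)"
      by (simp add: algebra_simps)
    then have "norm (?f y - ?f x) \<le> \<bar>y \<bullet> j\<bar> * norm (?p y - ?p x) + \<bar>y \<bullet> j - x \<bullet> j\<bar> * norm (?p x - z)"
      by (metis norm_scaleR norm_triangle_ineq)
    ultimately show ?thesis by (simp add: algebra_simps)
  qed
  then show "\<exists>T B. open T \<and> x \<in> T \<and> (\<forall>y\<in>?S \<inter> T. norm (?f y - ?f x) \<le> B * norm (y - x))"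
    by (intro exI[of _ "ball x 1"] exI[of _ ?B]) auto
qed simp

lemma negligible_cone_singular:
  fixes K :: "'a::euclidean_space set"
  assumes body: "convex_body K"
  shows "negligible (open_cone z (frontier K - smooth_points K))"
proof -
  have K: "convex K" "compact K" "interior K \<noteq> {}" "closed K" "K \<noteq> {}"
    using body compact_imp_closed by (auto simp: convex_body_def)
  let ?f = "\<lambda>r j y. z + (y \<bullet> j) *\<^sub>R (closest_point K (y + (r - y \<bullet> j) *\<^sub>R j) - z)"
  let ?I = "(Basis :: 'a set) \<times> (Basis :: 'a set) \<times> \<rat> \<times> \<rat>"
  let ?U = "\<Union>(i, j, q, r)\<in>?I. ?f r j ` {y. y \<bullet> i = q}"
  have "negligible ?U"
  proof (rule negligible_countable_Union)
    show "countable ((\<lambda>(i, j, q, r). ?f r j ` {y. y \<bullet> i = q}) ` ?I)"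
      by (intro countable_image countable_SIGMA countable_rat) (auto intro: countable_finite)
  qed (auto intro!: negligible_cone_over_flat K)
  moreover have "open_cone z (frontier K - smooth_points K) \<subseteq> ?U"
  proof
    fix w assume "w \<in> open_cone z (frontier K - smooth_points K)"
    then obtain x s where w: "w = z + s *\<^sub>R (x - z)" "x \<in> frontier K" "x \<notin> smooth_points K"
      by (auto simp: open_cone_def)
    have x: "x \<in> K" using w(2) K(4) by (simp add: frontier_def)
    obtain u v where "u \<in> normals K x" "v \<in> normals K x" "u \<noteq> v"
      using frontier_has_normal[OF K(1,4,3) w(2)] w(3) x by (auto simp: smooth_points_def)
    from singular_point_on_rational_flat[OF K(1-3) x this] obtain i j y where
      ij: "i \<in> Basis" "j \<in> Basis" "i \<noteq> j" "y \<bullet> i \<in> \<rat>" "y \<bullet> j \<in> \<rat>" "closest_point K y = x" by blast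
    let ?y = "y + (s - y \<bullet> j) *\<^sub>R j"
    have 1: "?y \<bullet> j = s" "?y \<bullet> i = y \<bullet> i" using ij by (auto simp: inner_add_left inner_Basis)
    have "?f (y \<bullet> j) j ?y = w" unfolding 1 w(1) using ij(6) by (simp add: algebra_simps)
    then have "w \<in> ?f (y \<bullet> j) j ` {y'. y' \<bullet> i = y \<bullet> i}" using 1(2) by blast
    then show "w \<in> ?U" using ij by (intro UN_I[of "(i, j, y \<bullet> i, y \<bullet> j)"]) auto
  qed
  ultimately show ?thesis by (rule negligible_subset)
qed

text \<open>In a visible point a ray from \<open>z\<close> enters \<open>K\<close>, in a hidden point it
  leaves \<open>K\<close>.\<close>

definition visible :: "'a::euclidean_space set \<Rightarrow> 'a \<Rightarrow> 'a set" where
  "visible K z = {x \<in> smooth_points K. 0 < (z - x) \<bullet> outer_unit_normal K x}"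

definition hidden :: "'a::euclidean_space set \<Rightarrow> 'a \<Rightarrow> 'a set" where
  "hidden K z = {x \<in> smooth_points K. (z - x) \<bullet> outer_unit_normal K x < 0}"

text \<open>If two boundary points on a ray from \<open>z\<close> have normals turned towards
  \<open>z\<close>, then neither can come after the other; likewise if both normals are turned
  away.\<close>

lemma cone_injective:
  assumes x: "x \<in> K" "y \<in> K" "u \<in> normals K x" "v \<in> normals K y"
    and st: "0 < s" "0 < t" "z + s *\<^sub>R (x - z) = z + t *\<^sub>R (y - z)"
    and sign: "0 < ((z - x) \<bullet> u) * ((z - y) \<bullet> v)"
  shows "x = y \<and> s = t"
proof -
  have yz: "y - z = (s / t) *\<^sub>R (x - z)"
    using st by (metis add_left_imp_eq divide_inverse_commute less_irrefl scaleR_scaleR vector_fraction_eq_iff)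
  have xz: "x - z = (t / s) *\<^sub>R (y - z)"
    using st unfolding yz by simp
  have "y - x = (1 - s / t) *\<^sub>R (z - x)"
    using yz by (simp add: algebra_simps)
  then have 1: "(1 - s / t) * ((z - x) \<bullet> u) \<le> 0"
    using normalsD(2)[OF x(3,2)] by simp
  have "x - y = (1 - t / s) *\<^sub>R (z - y)"
    using xz by (simp add: algebra_simps)
  then have 2: "(1 - t / s) * ((z - y) \<bullet> v) \<le> 0"
    using normalsD(2)[OF x(4,1)] by simp
  have "s = t"
  proof (cases "0 < (z - x) \<bullet> u")
    case True
    then have "0 < (z - y) \<bullet> v" using sign by (simp add: zero_less_mult_iff)
    then have "1 - s / t \<le> 0" "1 - t / s \<le> 0" using 1 2 True by (auto simp: mult_le_0_iff)
    then show ?thesis using st by (simp add: field_simps)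
  next
    case False
    then have "(z - x) \<bullet> u < 0" "(z - y) \<bullet> v < 0" using sign by (auto simp: zero_less_mult_iff)
    then have "0 \<le> 1 - s / t" "0 \<le> 1 - t / s" using 1 2 by (auto simp: mult_le_0_iff)
    then show ?thesis using st by (simp add: field_simps)
  qed
  then show ?thesis using yz st by simp
qed

lemma cone_injective_visible:
  assumes "x \<in> visible K z" "y \<in> visible K z" "0 < s" "0 < t" "z + s *\<^sub>R (x - z) = z + t *\<^sub>R (y - z)"
  shows "x = y \<and> s = t"
proof (rule cone_injective[OF _ _ _ _ assms(3-5)])
  show "outer_unit_normal K x \<in> normals K x" "outer_unit_normal K y \<in> normals K y"
    using assms by (auto simp: visible_def intro: outer_unit_normal_in_normals)
qed (use assms in \<open>auto simp: visible_def smooth_points_def\<close>)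

lemma cone_injective_hidden:
  assumes "x \<in> hidden K z" "y \<in> hidden K z" "0 < s" "0 < t" "z + s *\<^sub>R (x - z) = z + t *\<^sub>R (y - z)"
  shows "x = y \<and> s = t"
proof (rule cone_injective[OF _ _ _ _ assms(3-5)])
  show "outer_unit_normal K x \<in> normals K x" "outer_unit_normal K y \<in> normals K y"
    using assms by (auto simp: hidden_def intro: outer_unit_normal_in_normals)
qed (use assms in \<open>auto simp: hidden_def smooth_points_def mult_neg_neg\<close>)

lemma mem_hull_insert_iff:
  assumes K: "convex K" "K \<noteq> {}"
  shows "y \<in> convex hull (insert z K) \<longleftrightarrow> (\<exists>k\<in>K. \<exists>a. 0 \<le> a \<and> a \<le> 1 \<and> y = z + a *\<^sub>R (k - z))"
proof -
  have "(1 - a) *\<^sub>R z + a *\<^sub>R k = z + a *\<^sub>R (k - z)" for a k by (simp add: algebra_simps)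
  then show ?thesis
    using K by (auto simp: convex_hull_insert_alt hull_same)
qed

lemma not_in_supporting_hyperplane_interior:
  assumes n: "n \<noteq> 0" "\<And>w. w \<in> C \<Longrightarrow> (w - x) \<bullet> n \<le> 0" and y: "(y - x) \<bullet> n = 0"
  shows "y \<notin> interior C"
proof
  assume "y \<in> interior C"
  then obtain e where e: "0 < e" "cball y e \<subseteq> C" by (meson mem_interior_cball)
  have "y + (e / norm n) *\<^sub>R n \<in> cball y e" using e n by (simp add: dist_norm)
  then have "(y + (e / norm n) *\<^sub>R n - x) \<bullet> n \<le> 0" using e n by blast
  then have "(e / norm n) * (n \<bullet> n) \<le> 0" using y by (simp add: inner_diff_left inner_add_left)
  moreover have "0 < (e / norm n) * (n \<bullet> n)" using e n by simp
  ultimately show False by linarith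
qed

text \<open>A supporting hyperplane of \<open>K\<close> at \<open>x\<close> that contains \<open>z\<close>
  supports the hull too, and contains the whole segment from \<open>z\<close> to
  \<open>x\<close>.\<close>

lemma tangential_cone_not_interior:
  fixes K :: "'a::euclidean_space set"
  assumes K: "convex K" and x: "x \<in> K" and m: "m \<in> normals K x" "(z - x) \<bullet> m = 0"
  shows "z + s *\<^sub>R (x - z) \<notin> interior (convex hull (insert z K))"
proof (rule not_in_supporting_hyperplane_interior[of m _ x])
  show "m \<noteq> 0" using normalsD(1)[OF m(1)] by auto
  fix w assume "w \<in> convex hull (insert z K)"
  then obtain k a where k: "k \<in> K" "0 \<le> a" "w = z + a *\<^sub>R (k - z)"
    using K x mem_hull_insert_iff[OF K] by blast
  have "w - x = (1 - a) *\<^sub>R (z - x) + a *\<^sub>R (k - x)" unfolding k by (simp add: algebra_simps)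
  then have "(w - x) \<bullet> m = a * ((k - x) \<bullet> m)" using m(2) by (simp add: inner_add_left)
  then show "(w - x) \<bullet> m \<le> 0" using k normalsD(2)[OF m(1) k(1)] by (simp add: mult_nonneg_nonpos)
next
  have "z + s *\<^sub>R (x - z) - x = (1 - s) *\<^sub>R (z - x)" by (simp add: algebra_simps)
  then show "(z + s *\<^sub>R (x - z) - x) \<bullet> m = 0" using m(2) by simp
qed

text \<open>The parameters at which the ray from \<open>z\<close> through \<open>y\<close> is in
  \<open>K\<close>. As \<open>y\<close> is interior to the hull, a point slightly beyond
  \<open>y\<close> is still on a segment from \<open>z\<close> to a point of \<open>K\<close>,
  so \<open>K\<close> is met beyond \<open>y\<close>.\<close>

lemma ray_through_hull:
  fixes K :: "'a::euclidean_space set"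
  assumes K: "convex K" "compact K" "K \<noteq> {}" and y: "y \<in> interior (convex hull (insert z K))" "y \<noteq> z"
  defines "T \<equiv> {t. z + t *\<^sub>R (y - z) \<in> K}"
  shows "compact T" "convex T" "\<exists>t\<in>T. 1 < t"
proof -
  have Teq: "T = (\<lambda>t. z + t *\<^sub>R (y - z)) -` K" by (auto simp: T_def)
  have "closed T"
    unfolding Teq using K by (intro continuous_closed_vimage compact_imp_closed continuous_intros) auto
  moreover have "bounded T"
  proof -
    obtain r where r: "\<And>k. k \<in> K \<Longrightarrow> norm (k - z) \<le> r"
      using compact_imp_bounded[OF K(2)] bounded_any_center[of K z]
      by (auto simp: bounded_def dist_norm norm_minus_commute)
    have "\<bar>t\<bar> \<le> r / norm (y - z)" if "t \<in> T" for t
    proof -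
      have "norm (t *\<^sub>R (y - z)) \<le> r" using r[of "z + t *\<^sub>R (y - z)"] that by (simp add: T_def)
      then have "\<bar>t\<bar> * norm (y - z) \<le> r" by simp
      then show ?thesis using y(2) by (simp add: pos_le_divide_eq)
    qed
    then show ?thesis by (auto simp: bounded_iff)
  qed
  ultimately show "compact T" by (simp add: compact_eq_bounded_closed)
  show "convex T"
  proof (rule convexI)
    fix s t u v :: real
    assume st: "s \<in> T" "t \<in> T" and uv: "0 \<le> u" "0 \<le> v" "u + v = 1"
    have "u *\<^sub>R (z + s *\<^sub>R (y - z)) + v *\<^sub>R (z + t *\<^sub>R (y - z)) = (u + v) *\<^sub>R z + (u * s + v * t) *\<^sub>R (y - z)"
      by (simp add: algebra_simps)
    then show "u *\<^sub>R s + v *\<^sub>R t \<in> T"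
      using convexD[OF K(1), of "z + s *\<^sub>R (y - z)" "z + t *\<^sub>R (y - z)" u v] st uv by (simp add: T_def)
  qed
  obtain e where e: "0 < e" "cball y e \<subseteq> convex hull (insert z K)"
    using y(1) by (meson mem_interior_cball)
  define d where "d = e / norm (y - z)"
  have d: "0 < d" using e y by (simp add: d_def)
  have "y + d *\<^sub>R (y - z) \<in> cball y e" using e y by (simp add: dist_norm d_def)
  then have "y + d *\<^sub>R (y - z) \<in> convex hull (insert z K)" using e by blast
  then obtain k a where k: "k \<in> K" "0 \<le> a" "a \<le> 1" "y + d *\<^sub>R (y - z) = z + a *\<^sub>R (k - z)"
    using mem_hull_insert_iff[OF K(1,3)] by blast
  have eq: "(1 + d) *\<^sub>R (y - z) = a *\<^sub>R (k - z)"
    using k(4) by (simp add: algebra_simps)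
  have a: "0 < a"
  proof (rule ccontr)
    assume "\<not> 0 < a"
    then have "(1 + d) *\<^sub>R (y - z) = 0" using eq k by simp
    then show False using d y by simp
  qed
  have "z + ((1 + d) / a) *\<^sub>R (y - z) = z + (1 / a) *\<^sub>R ((1 + d) *\<^sub>R (y - z))" by simp
  also have "\<dots> = k" unfolding eq using a by simp
  finally have "(1 + d) / a \<in> T" using k by (simp add: T_def)
  moreover have "1 < (1 + d) / a" using a k d by simp
  ultimately show "\<exists>t\<in>T. 1 < t" by blast
qed

lemma mem_open_cone_of_ray:
  assumes "x \<in> B" "1 < t" "x = z + t *\<^sub>R (y - z)"
  shows "y \<in> open_cone z B"
proof -
  have "x - z = t *\<^sub>R (y - z)" using assms by simp
  then have "y = z + (1 / t) *\<^sub>R (x - z)" using assms(2) by simp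
  then show ?thesis using assms unfolding open_cone_def
    by (intro CollectI exI[of _ x] exI[of _ "1 / t"]) auto
qed

text \<open>For almost every \<open>y\<close> in the hull, a boundary point beyond \<open>y\<close> on the
  ray from \<open>z\<close> is smooth and not tangential.\<close>

lemma boundary_point_of_ray:
  fixes K :: "'a::euclidean_space set"
  assumes body: "convex_body K" and y: "y \<in> interior (convex hull (insert z K))"
    and ns: "y \<notin> open_cone z (frontier K - smooth_points K)"
    and x: "x \<in> K" "m \<in> normals K x" and t: "1 < t" "x = z + t *\<^sub>R (y - z)"
  shows "x \<in> smooth_points K" "outer_unit_normal K x = m" "(z - x) \<bullet> m \<noteq> 0"
proof -
  have "x \<in> frontier K"
    using x not_interior_normal[OF x(2)] closure_subset by (auto simp: frontier_def)
  then show sm: "x \<in> smooth_points K" using ns mem_open_cone_of_ray[OF _ t] by blast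
  show "outer_unit_normal K x = m" by (rule outer_unit_normal_eq[OF sm x(2)])
  show "(z - x) \<bullet> m \<noteq> 0"
  proof
    assume "(z - x) \<bullet> m = 0"
    from tangential_cone_not_interior[OF _ x this, of "1 / t"]
    show False using y t body by (simp add: convex_body_def)
  qed
qed

text \<open>The last point of \<open>K\<close> on the ray through \<open>y\<close> is hidden.\<close>

lemma hull_subset_cone_hidden:
  fixes K :: "'a::euclidean_space set"
  assumes body: "convex_body K"
    and y: "y \<in> interior (convex hull (insert z K))" "y \<noteq> z"
    and ns: "y \<notin> open_cone z (frontier K - smooth_points K)"
  shows "y \<in> open_cone z (hidden K z)"
proof -
  have K: "convex K" "compact K" "K \<noteq> {}" using body by (auto simp: convex_body_def)
  define T where "T = {t. z + t *\<^sub>R (y - z) \<in> K}"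
  note T = ray_through_hull[OF K y, folded T_def]
  obtain t where t: "t \<in> T" "\<And>s. s \<in> T \<Longrightarrow> s \<le> t"
    using compact_attains_sup[OF T(1)] T(3) by blast
  have t1: "1 < t" using T(3) t(2) by force
  define x where "x = z + t *\<^sub>R (y - z)"
  have xK: "x \<in> K" using t(1) by (simp add: T_def x_def)
  have "x + d *\<^sub>R (x - z) \<notin> K" if d: "0 < d" for d
  proof
    assume "x + d *\<^sub>R (x - z) \<in> K"
    moreover have "x + d *\<^sub>R (x - z) = z + (t * (1 + d)) *\<^sub>R (y - z)" by (simp add: x_def algebra_simps)
    ultimately have "t * (1 + d) \<le> t" by (intro t(2)) (simp add: T_def)
    then show False using t1 d by (simp add: algebra_simps mult_le_0_iff)
  qed
  from normals_halfline[OF K(1) xK this] obtain m where m: "m \<in> normals K x" "0 \<le> m \<bullet> (x - z)" by blast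
  note x = boundary_point_of_ray[OF body y(1) ns xK m(1) t1 x_def]
  have "(z - x) \<bullet> m < 0" using m(2) x(3) by (simp add: inner_diff_left inner_diff_right inner_commute)
  then have "x \<in> hidden K z" using x by (simp add: hidden_def)
  then show ?thesis by (rule mem_open_cone_of_ray[OF _ t1 x_def])
qed

text \<open>The first point of \<open>K\<close> on the ray beyond \<open>y\<close> is visible.\<close>

lemma hull_diff_subset_cone_visible:
  fixes K :: "'a::euclidean_space set"
  assumes body: "convex_body K"
    and y: "y \<in> interior (convex hull (insert z K))" "y \<noteq> z" and yK: "y \<notin> K"
    and ns: "y \<notin> open_cone z (frontier K - smooth_points K)"
  shows "y \<in> open_cone z (visible K z)"
proof -
  have K: "convex K" "compact K" "K \<noteq> {}" using body by (auto simp: convex_body_def)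
  define T where "T = {t. z + t *\<^sub>R (y - z) \<in> K}"
  note T = ray_through_hull[OF K y, folded T_def]
  have T1: "1 \<notin> T" using yK by (simp add: T_def)
  have "compact (T \<inter> {1..})" using T(1) by (intro compact_Int_closed) auto
  moreover have "T \<inter> {1..} \<noteq> {}" using T(3) by force
  ultimately obtain t where t: "t \<in> T" "1 \<le> t" "\<And>s. s \<in> T \<Longrightarrow> 1 \<le> s \<Longrightarrow> t \<le> s"
    using compact_attains_inf[of "T \<inter> {1..}"] by auto
  have t1: "1 < t" using t(1,2) T1 by (metis order_le_less)
  define x where "x = z + t *\<^sub>R (y - z)"
  have xK: "x \<in> K" using t(1) by (simp add: T_def x_def)
  have "x + d *\<^sub>R (z - x) \<notin> K" if d: "0 < d" for d
  proof
    assume "x + d *\<^sub>R (z - x) \<in> K"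
    moreover have "x + d *\<^sub>R (z - x) = z + (t * (1 - d)) *\<^sub>R (y - z)" by (simp add: x_def algebra_simps)
    ultimately have s: "t * (1 - d) \<in> T" by (simp add: T_def)
    have lt: "t * (1 - d) < t" using t1 d by (simp add: algebra_simps)
    then have s1: "t * (1 - d) < 1" using t(3)[OF s] by (meson not_le)
    have "1 \<in> closed_segment (t * (1 - d)) t" using s1 t1 d by (simp add: closed_segment_eq_real_ivl)
    then have "1 \<in> T" using closed_segment_subset[OF s t(1) T(2)] by blast
    then show False using T1 by simp
  qed
  from normals_halfline[OF K(1) xK this] obtain m where m: "m \<in> normals K x" "0 \<le> m \<bullet> (z - x)" by blast
  note x = boundary_point_of_ray[OF body y(1) ns xK m(1) t1 x_def]
  have "0 < (z - x) \<bullet> m" using m(2) x(3) by (simp add: inner_commute)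
  then have "x \<in> visible K z" using x by (simp add: visible_def)
  then show ?thesis by (rule mem_open_cone_of_ray[OF _ t1 x_def])
qed

lemma cone_subset_hull:
  assumes "convex K" "B \<subseteq> K"
  shows "open_cone z B \<subseteq> convex hull (insert z K)"
proof
  fix y assume "y \<in> open_cone z B"
  then obtain x s where "x \<in> B" "0 < s" "s < 1" "y = z + s *\<^sub>R (x - z)" by (auto simp: open_cone_def)
  moreover have "K \<noteq> {}" using calculation assms by auto
  ultimately show "y \<in> convex hull (insert z K)"
    using assms by (subst mem_hull_insert_iff) (auto intro!: bexI[of _ x] exI[of _ s])
qed

lemma cone_visible_disjoint:
  "open_cone z (visible K z) \<inter> K = {}"
proof -
  have False if x: "x \<in> visible K z" and s: "s < 1" and k: "z + s *\<^sub>R (x - z) \<in> K" for x s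
  proof -
    have "outer_unit_normal K x \<in> normals K x"
      using x by (auto simp: visible_def intro: outer_unit_normal_in_normals)
    from normalsD(2)[OF this k] have "(z + s *\<^sub>R (x - z) - x) \<bullet> outer_unit_normal K x \<le> 0" .
    moreover have "z + s *\<^sub>R (x - z) - x = (1 - s) *\<^sub>R (z - x)" by (simp add: algebra_simps)
    ultimately show False using x s by (simp add: visible_def mult_le_0_iff)
  qed
  then show ?thesis by (auto simp: open_cone_def)
qed

lemma AE_cones:
  fixes K :: "'a::euclidean_space set"
  assumes body: "convex_body K"
  shows "AE y in lebesgue. y \<in> open_cone z (hidden K z) \<longleftrightarrow> y \<in> convex hull (insert z K)" (is ?h)
    and "AE y in lebesgue. y \<in> open_cone z (visible K z) \<longleftrightarrow> y \<in> convex hull (insert z K) - K" (is ?v)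
proof -
  have K: "convex K" "compact K" "K \<noteq> {}" using body by (auto simp: convex_body_def)
  let ?C = "convex hull (insert z K)"
  let ?N = "frontier ?C \<union> {z} \<union> open_cone z (frontier K - smooth_points K)"
  have "negligible ?N"
    using negligible_convex_frontier[OF convex_convex_hull] negligible_cone_singular[OF body] by auto
  then have "?N \<in> null_sets lebesgue" by (simp add: negligible_iff_null_sets)
  then have ae: "AE y in lebesgue. y \<notin> ?N" by (rule AE_not_in)
  have sub: "smooth_points K \<subseteq> K" by (auto simp: smooth_points_def)
  have int: "y \<in> interior ?C" if "y \<in> ?C" "y \<notin> ?N" for y
    using that closure_subset[of ?C] by (auto simp: frontier_def)
  have hid: "open_cone z (hidden K z) \<subseteq> ?C"
    using sub by (intro cone_subset_hull K) (auto simp: hidden_def)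
  have vis: "open_cone z (visible K z) \<subseteq> ?C - K"
    using sub cone_subset_hull[OF K(1), of "visible K z" z] cone_visible_disjoint[of z K]
    by (auto simp: visible_def)
  show ?h
    using ae by eventually_elim (use hid int hull_subset_cone_hidden[OF body] in blast)
  show ?v
    using ae by eventually_elim (use vis int hull_diff_subset_cone_visible[OF body] in blast)
qed

section \<open>Continuity of the added volume\<close>

text \<open>Moving the apex moves each point of the hull by at most the same distance.\<close>

lemma hull_insert_near:
  fixes K :: "'a::euclidean_space set"
  assumes K: "convex K" "K \<noteq> {}" and y: "y \<in> convex hull (insert z K)"
  obtains w where "w \<in> convex hull (insert z' K)" "norm (y - w) \<le> norm (z - z')"
proof -
  obtain k a where k: "k \<in> K" "0 \<le> a" "a \<le> 1" "y = z + a *\<^sub>R (k - z)"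
    using y mem_hull_insert_iff[OF K] by blast
  show thesis
  proof
    show "z' + a *\<^sub>R (k - z') \<in> convex hull (insert z' K)"
      using k by (subst mem_hull_insert_iff[OF K]) blast
    have "y - (z' + a *\<^sub>R (k - z')) = (1 - a) *\<^sub>R (z - z')" unfolding k by (simp add: algebra_simps)
    then show "norm (y - (z' + a *\<^sub>R (k - z'))) \<le> norm (z - z')"
      using k by (simp add: mult_left_le_one_le)
  qed
qed

text \<open>If \<open>y\<close> is interior to the limit hull but outside a nearby hull, then a hyperplane
  separates \<open>y\<close> from the nearby hull, and a point of the ball around
  \<open>y\<close> on the far side is too distant from it. Points at a positive distance from
  the limit hull are outside all nearby hulls.\<close>

lemma eventually_mem_hull_insert:
  fixes K :: "'a::euclidean_space set"
  assumes K: "convex K" "compact K" "K \<noteq> {}" and lim: "Z \<longlonglongrightarrow> z"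
    and y: "y \<notin> frontier (convex hull (insert z K))"
  shows "\<forall>\<^sub>F n in sequentially. y \<in> convex hull (insert (Z n) K) \<longleftrightarrow> y \<in> convex hull (insert z K)"
proof -
  let ?C = "\<lambda>z. convex hull (insert z K)"
  have cl: "closed (?C z)" for z using K by (intro compact_imp_closed compact_convex_hull) auto
  show ?thesis
  proof (cases "y \<in> ?C z")
    case True
    then have "y \<in> interior (?C z)" using y closure_subset[of "?C z"] by (auto simp: frontier_def)
    then obtain e where e: "0 < e" "cball y e \<subseteq> ?C z" by (meson mem_interior_cball)
    have "\<forall>\<^sub>F n in sequentially. norm (z - Z n) < e"
      using tendstoD[OF lim e(1)] by (simp add: dist_norm norm_minus_commute)
    then show ?thesis
    proof eventually_elim
      fix n assume n: "norm (z - Z n) < e"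
      have "y \<in> ?C (Z n)"
      proof (rule ccontr)
        assume "y \<notin> ?C (Z n)"
        then obtain a b where ab: "a \<bullet> y < b" "\<And>x. x \<in> ?C (Z n) \<Longrightarrow> b < a \<bullet> x"
          using separating_hyperplane_closed_point[OF convex_convex_hull cl] by metis
        have a0: "a \<noteq> 0" using ab hull_subset[of "insert (Z n) K" convex] by fastforce
        have "y - (e / norm a) *\<^sub>R a \<in> cball y e" using e a0 by (simp add: dist_norm)
        then have "y - (e / norm a) *\<^sub>R a \<in> ?C z" using e by blast
        then obtain w where w: "w \<in> ?C (Z n)" "norm (y - (e / norm a) *\<^sub>R a - w) \<le> norm (z - Z n)"
          using hull_insert_near[OF K(1,3)] by metis
        have "norm (w - (y - (e / norm a) *\<^sub>R a)) \<le> norm (z - Z n)"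
          using w(2) by (subst norm_minus_commute)
        then have "a \<bullet> (w - (y - (e / norm a) *\<^sub>R a)) \<le> norm a * norm (z - Z n)"
          by (intro order_trans[OF norm_cauchy_schwarz] mult_left_mono) auto
        moreover have "a \<bullet> (w - (y - (e / norm a) *\<^sub>R a)) = a \<bullet> w - a \<bullet> y + e * norm a"
          using a0 by (simp add: inner_diff_right inner_add_right dot_square_norm power2_eq_square)
        moreover have "norm a * norm (z - Z n) < norm a * e" using n a0 by simp
        ultimately show False using ab(1) ab(2)[OF w(1)] by (simp add: mult.commute)
      qed
      then show "y \<in> ?C (Z n) \<longleftrightarrow> y \<in> ?C z" using True by simp
    qed
  next
    case False
    then have "open (- ?C z)" "y \<in> - ?C z" using cl[of z] by auto
    then obtain e where e: "0 < e" "ball y e \<subseteq> - ?C z" by (rule openE)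
    have "\<forall>\<^sub>F n in sequentially. norm (Z n - z) < e"
      using tendstoD[OF lim e(1)] by (simp add: dist_norm)
    then show ?thesis
    proof eventually_elim
      fix n assume n: "norm (Z n - z) < e"
      have "y \<notin> ?C (Z n)"
      proof
        assume "y \<in> ?C (Z n)"
        then obtain w where w: "w \<in> ?C z" "norm (y - w) \<le> norm (Z n - z)"
          using hull_insert_near[OF K(1,3)] by metis
        then have "w \<in> ball y e" using n by (simp add: dist_norm)
        then show False using e w by blast
      qed
      then show "y \<in> ?C (Z n) \<longleftrightarrow> y \<in> ?C z" using False by simp
    qed
  qed
qed

lemma continuous_added_vol:
  fixes K U :: "'a::euclidean_space set"
  assumes body: "convex_body K" and U: "U \<in> sets lebesgue" and int: "set_integrable lebesgue U \<phi>"
  shows "continuous_on UNIV (added_vol U \<phi> K)"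
  unfolding continuous_on_sequentially
proof (intro allI ballI impI)
  fix Z and z :: 'a
  assume "z \<in> UNIV" and "(\<forall>n. Z n \<in> UNIV) \<and> Z \<longlonglongrightarrow> z"
  then have lim: "Z \<longlonglongrightarrow> z" by simp
  have K: "convex K" "compact K" "K \<noteq> {}" using body by (auto simp: convex_body_def)
  let ?C = "\<lambda>z. convex hull (insert z K)"
  have C: "?C z \<in> sets lebesgue" "K \<in> sets lebesgue" for z
    using compact_imp_closed[OF compact_convex_hull[OF compact_insert[OF K(2)]]] compact_imp_closed[OF K(2)]
    by auto
  define f where "f y = indicator U y *\<^sub>R \<phi> y" for y
  have f: "integrable lebesgue f" using int by (simp add: f_def[abs_def] set_integrable_def)
  have eq: "added_vol U \<phi> K w = (LINT y|lebesgue. indicator (?C w - K) y * f y)" for w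
    unfolding added_vol_def weighted_vol_def set_lebesgue_integral_def f_def
    by (intro Bochner_Integration.integral_cong) (auto simp: indicator_def)
  have "(\<lambda>n. LINT y|lebesgue. indicator (?C (Z n) - K) y * f y) \<longlonglongrightarrow>
      (LINT y|lebesgue. indicator (?C z - K) y * f y)"
  proof (rule integral_dominated_convergence[where w = "\<lambda>y. \<bar>f y\<bar>"])
    show "(\<lambda>y. indicator (?C w - K) y * f y) \<in> borel_measurable lebesgue" for w
      using C borel_measurable_integrable[OF f] by (intro borel_measurable_times borel_measurable_indicator) auto
    then show "(\<lambda>y. indicator (?C w - K) y * f y) \<in> borel_measurable lebesgue" for w .
    show "integrable lebesgue (\<lambda>y. \<bar>f y\<bar>)" using f by simp
    have "AE y in lebesgue. y \<notin> frontier (?C z)"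
      using negligible_convex_frontier[OF convex_convex_hull] by (intro AE_not_in) (simp add: negligible_iff_null_sets)
    then show "AE y in lebesgue. (\<lambda>n. indicator (?C (Z n) - K) y * f y) \<longlonglongrightarrow> indicator (?C z - K) y * f y"
    proof eventually_elim
      fix y assume "y \<notin> frontier (?C z)"
      from eventually_mem_hull_insert[OF K lim this]
      have "\<forall>\<^sub>F n in sequentially. indicator (?C (Z n) - K) y * f y = indicator (?C z - K) y * f y"
        by eventually_elim (simp add: indicator_def)
      then show "(\<lambda>n. indicator (?C (Z n) - K) y * f y) \<longlonglongrightarrow> indicator (?C z - K) y * f y"
        by (rule tendsto_eventually)
    qed
  qed (auto simp: indicator_def)
  then show "(added_vol U \<phi> K \<circ> Z) \<longlonglongrightarrow> added_vol U \<phi> K z" by (simp add: eq comp_def)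
qed

section \<open>The boundary as a graph over a hyperplane\<close>

text \<open>The chart in the direction \<open>u\<close>. The isometry \<open>W\<close> presents the space as
  the product of a hyperplane and the line spanned by \<open>u\<close>. The normals considered
  make an angle with \<open>u\<close> whose cosine is at least \<open>c\<close>. If
  \<open>x\<close> and \<open>y\<close> have such normals, then \<open>y - x\<close> has a
  component of at most \<open>sqrt (2 - 2 * c) * norm (y - x)\<close> along \<open>u\<close>,
  and for \<open>c > 1 / 2\<close> this factor is less than 1.\<close>

locale boundary_chart =
  fixes K :: "'a::euclidean_space set" and W :: "'b::euclidean_space \<times> real \<Rightarrow> 'a" and W' :: "'a \<Rightarrow> 'b \<times> real"
    and u :: 'a and c :: real
  assumes compact_K: "compact K"
    and W: "linear W" "\<And>p. norm (W p) = norm p" and W': "linear W'" "\<And>x. W (W' x) = x" "\<And>p. W' (W p) = p"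
    and W_u: "W (0, 1) = u" and c: "1 / 2 < c" "c \<le> 1"
begin

text \<open>Using all points with a suitable normal, whether smooth or not, makes the set compact.\<close>

definition cap :: "'a set" where
  "cap = {x \<in> K. \<exists>m\<in>normals K x. c \<le> m \<bullet> u}"

definition proj :: "'a \<Rightarrow> 'b" where
  "proj x = fst (W' x)"

definition param :: "'b \<Rightarrow> 'a" where
  "param y = (if y \<in> proj ` cap then inv_into cap proj y else 0)"

text \<open>A Lipschitz constant of the inverse of the projection; it tends to 1 as \<open>c\<close> does.\<close>

definition L :: real where
  "L = 1 / sqrt (2 * c - 1)"

lemma inner_W: "W p \<bullet> W q = p \<bullet> q"
  by (rule isometry_inner[OF W])

lemma norm_u: "norm u = 1" "u \<bullet> u = 1"
  using inner_W[of "(0, 1)" "(0, 1)"] W(2)[of "(0, 1)"] by (auto simp: W_u norm_Pair)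

lemma W_eq: "W (h, t) = W (h, 0) + t *\<^sub>R u"
proof -
  have "(h, t) = (h, 0) + t *\<^sub>R (0, 1)" by simp
  then have "W (h, t) = W ((h, 0) + t *\<^sub>R (0, 1))" by (rule arg_cong)
  also have "\<dots> = W (h, 0) + t *\<^sub>R u" by (simp only: linear_add[OF W(1)] linear_scale[OF W(1)] W_u)
  finally show ?thesis .
qed

lemma inner_u_W: "u \<bullet> W (h, t) = t"
  using inner_W[of "(0, 1)" "(h, t)"] by (simp add: W_u)

lemma W'_eq: "W' x = (proj x, x \<bullet> u)"
proof -
  have "x \<bullet> u = snd (W' x)"
    using inner_u_W[of "fst (W' x)" "snd (W' x)"] W'(2)[of x] by (simp add: inner_commute)
  then show ?thesis by (simp add: proj_def prod_eq_iff)
qed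

lemma decompose: "x = W (proj x, 0) + (x \<bullet> u) *\<^sub>R u"
  using W'(2)[of x] W_eq[of "proj x" "x \<bullet> u"] by (simp add: W'_eq)

lemma linear_proj: "linear proj"
  unfolding proj_def[abs_def] using linear_compose[OF W'(1) linear_fst] by (simp add: o_def)

lemma proj_diff: "proj (x - y) = proj x - proj y"
  by (rule linear_diff[OF linear_proj])

lemma norm_proj: "(norm x)\<^sup>2 = (norm (proj x))\<^sup>2 + (x \<bullet> u)\<^sup>2"
proof -
  have "norm x = norm (W' x)" using W(2)[of "W' x"] W'(2) by simp
  then show ?thesis by (simp add: W'_eq norm_Pair)
qed

lemma norm_proj_le: "norm (proj x) \<le> norm x"
  using norm_proj[of x] zero_le_power2[of "x \<bullet> u"] by (intro power2_le_imp_le[OF _ norm_ge_zero]) linarith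

lemma L: "0 < L" "1 \<le> L"
  using c by (auto simp: L_def)

text \<open>If \<open>m\<close> is a normal at \<open>x\<close> close to \<open>u\<close>, then \<open>(y -
  x) \<bullet> m \<le> 0\<close> bounds \<open>(y - x) \<bullet> u\<close> from above by a small
  multiple of \<open>norm (y - x)\<close>; exchanging the two points gives the lower bound.\<close>

lemma cap_flat:
  assumes x: "x \<in> cap" and y: "y \<in> cap"
  shows "norm (y - x) \<le> L * norm (proj y - proj x)"
proof -
  have half: "(y - x) \<bullet> u \<le> sqrt (2 - 2 * c) * norm (y - x)" if x: "x \<in> cap" and y: "y \<in> cap" for x y
  proof -
    obtain m where m: "m \<in> normals K x" "c \<le> m \<bullet> u" using x by (auto simp: cap_def)
    have "(norm (u - m))\<^sup>2 = 2 - 2 * (m \<bullet> u)"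
      using normalsD(1)[OF m(1)] norm_u
      by (simp add: power2_norm_eq_inner inner_diff_left inner_diff_right inner_commute norm_eq_1)
    then have "norm (u - m) \<le> sqrt (2 - 2 * c)" using m(2) by (intro real_le_rsqrt) simp
    moreover have "(y - x) \<bullet> u = (y - x) \<bullet> m + (y - x) \<bullet> (u - m)" by (simp add: inner_diff_right)
    moreover have "(y - x) \<bullet> m \<le> 0" using normalsD(2)[OF m(1)] y by (simp add: cap_def)
    moreover have "(y - x) \<bullet> (u - m) \<le> norm (y - x) * norm (u - m)" by (rule norm_cauchy_schwarz)
    ultimately show ?thesis
      by (smt (verit) mult.commute mult_right_mono norm_ge_zero)
  qed
  have "\<bar>(y - x) \<bullet> u\<bar> \<le> sqrt (2 - 2 * c) * norm (y - x)"
    using half[OF x y] half[OF y x] by (simp add: inner_diff_left norm_minus_commute abs_le_iff)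
  then have "((y - x) \<bullet> u)\<^sup>2 \<le> (sqrt (2 - 2 * c) * norm (y - x))\<^sup>2"
    by (metis abs_ge_zero power2_abs power_mono)
  also have "\<dots> = (2 - 2 * c) * (norm (y - x))\<^sup>2" using c by (simp add: power_mult_distrib)
  finally have "(2 * c - 1) * (norm (y - x))\<^sup>2 \<le> (norm (proj y - proj x))\<^sup>2"
    using norm_proj[of "y - x"] by (simp add: proj_diff algebra_simps)
  then have "(sqrt (2 * c - 1) * norm (y - x))\<^sup>2 \<le> (norm (proj y - proj x))\<^sup>2"
    using c by (simp add: power_mult_distrib)
  then have "sqrt (2 * c - 1) * norm (y - x) \<le> norm (proj y - proj x)"
    by (rule power2_le_imp_le) simp
  then show ?thesis using c by (simp add: L_def field_simps)
qed

lemma inj_proj: "inj_on proj cap"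
  using cap_flat by (force simp: inj_on_def)

lemma param_proj: "x \<in> cap \<Longrightarrow> param (proj x) = x"
  using inj_proj by (simp add: param_def inv_into_f_f)

lemma param_in_cap: "y \<in> proj ` cap \<Longrightarrow> param y \<in> cap" "y \<in> proj ` cap \<Longrightarrow> proj (param y) = y"
  by (auto simp: param_proj)

lemma image_param: "B \<subseteq> cap \<Longrightarrow> param ` proj ` B = B"
  by (force simp: param_proj image_iff)

lemma param_lipschitz:
  assumes "y \<in> proj ` cap" "y' \<in> proj ` cap"
  shows "dist (param y) (param y') \<le> L * dist y y'"
  using cap_flat[of "param y'" "param y"] param_in_cap[OF assms(1)] param_in_cap[OF assms(2)]
  by (simp add: dist_norm)

lemma compact_proj_cap: "compact (proj ` cap)"
  unfolding cap_def
  by (intro compact_continuous_image compact_normal_cap compact_K linear_continuous_on)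
    (simp add: linear_linear linear_proj)

lemma borel_cap: "cap \<in> sets borel" "proj ` cap \<in> sets borel"
  using compact_proj_cap compact_normal_cap[OF compact_K] by (auto simp: cap_def intro: borel_compact)

lemma continuous_param: "continuous_on (proj ` cap) param"
  using param_lipschitz by (intro lipschitz_on_continuous_on[of L] lipschitz_onI) (use L in auto)

lemma measurable_param [measurable]: "param \<in> borel_measurable borel"
proof -
  have "(\<lambda>y. if y \<in> proj ` cap then param y else 0) \<in> borel_measurable borel"
    using borel_cap by (intro borel_measurable_continuous_on_if continuous_param) auto
  also have "(\<lambda>y. if y \<in> proj ` cap then param y else 0) = param"
    by (auto simp: param_def fun_eq_iff)
  finally show ?thesis .
qed

lemma proj_image_eq:
  assumes "B \<subseteq> cap"
  shows "proj ` B = proj ` cap \<inter> (param -` B \<inter> space borel)"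
  using assms by (force simp: param_proj image_iff)

lemma borel_proj_image:
  assumes "B \<subseteq> cap" "B \<in> sets borel"
  shows "proj ` B \<in> sets borel"
  unfolding proj_image_eq[OF assms(1)]
  by (rule sets.Int[OF borel_cap(2) measurable_sets[OF measurable_param assms(2)]])

lemma hausdorff_proj:
  assumes B: "B \<subseteq> cap" "B \<in> sets borel"
  shows "emeasure lborel (proj ` B) \<le> hausdorff_outer (DIM('b)) B"
    and "hausdorff_outer (DIM('b)) B \<le> ennreal (L ^ DIM('b)) * emeasure lborel (proj ` B)"
proof -
  have pB: "proj ` B \<in> sets borel" by (rule borel_proj_image[OF B])
  then have eq: "hausdorff_outer (DIM('b)) (proj ` B) = emeasure lborel (proj ` B)"
    by (subst hausdorff_outer_eq_lebesgue) auto
  have "hausdorff_outer (DIM('b)) (proj ` B) \<le> ennreal (1 ^ DIM('b)) * hausdorff_outer (DIM('b)) B"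
    by (rule hausdorff_outer_lipschitz_image)
      (auto simp: dist_norm norm_proj_le simp flip: proj_diff)
  then show "emeasure lborel (proj ` B) \<le> hausdorff_outer (DIM('b)) B" by (simp add: eq)
  have "hausdorff_outer (DIM('b)) (param ` proj ` B) \<le> ennreal (L ^ DIM('b)) * hausdorff_outer (DIM('b)) (proj ` B)"
    using B by (intro hausdorff_outer_lipschitz_image param_lipschitz L) auto
  then show "hausdorff_outer (DIM('b)) B \<le> ennreal (L ^ DIM('b)) * emeasure lborel (proj ` B)"
    by (simp add: eq image_param B)
qed

text \<open>The image measure of Lebesgue measure under the parametrization, restricted to \<open>B\<close>,
  and the restriction of Hausdorff measure to \<open>B\<close> differ at most by the factor by
  which the parametrization can stretch.\<close>

lemma nn_integral_hausdorff_param: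
  fixes g :: "'a \<Rightarrow> ennreal"
  assumes B: "B \<subseteq> cap" "B \<in> sets borel" and g [measurable]: "g \<in> borel_measurable borel"
  shows "(\<integral>\<^sup>+y. indicator (proj ` B) y * g (param y) \<partial>lborel) \<le>
      (\<integral>\<^sup>+x. indicator B x * g x \<partial>hausdorff_measure (DIM('b)))" (is "?I \<le> ?J")
    and "(\<integral>\<^sup>+x. indicator B x * g x \<partial>hausdorff_measure (DIM('b))) \<le>
      ennreal (L ^ DIM('b)) * (\<integral>\<^sup>+y. indicator (proj ` B) y * g (param y) \<partial>lborel)"
proof -
  let ?H = "hausdorff_measure (DIM('b)) :: 'a measure"
  have BH: "A \<in> sets ?H" if "A \<in> sets borel" for A
    using that borel_subset_hausdorff_measure by blast
  have idm: "(\<lambda>x. x) \<in> ?H \<rightarrow>\<^sub>M borel"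
    by (rule measurableI) (auto simp: BH)
  have pB [measurable]: "proj ` B \<in> sets borel" by (rule borel_proj_image[OF B])
  define \<nu> where "\<nu> = distr (density lborel (indicator (proj ` B))) borel param"
  define \<mu> where "\<mu> = distr (density ?H (indicator B)) borel (\<lambda>x. x)"
  have I: "?I = (\<integral>\<^sup>+x. g x \<partial>\<nu>)"
    unfolding \<nu>_def by (simp add: nn_integral_distr nn_integral_density)
  have gH: "g \<in> borel_measurable ?H" using measurable_compose[OF idm g] by simp
  have J: "?J = (\<integral>\<^sup>+x. g x \<partial>\<mu>)"
    unfolding \<mu>_def using idm gH B by (simp add: nn_integral_distr nn_integral_density BH)
  have \<nu>: "emeasure \<nu> A = emeasure lborel (proj ` (A \<inter> B))" if A [measurable]: "A \<in> sets borel" for A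
  proof -
    have "emeasure \<nu> A = emeasure lborel (proj ` B \<inter> (param -` A \<inter> space borel))"
      unfolding \<nu>_def using measurable_sets[OF measurable_param A]
      by (simp add: emeasure_distr emeasure_density nn_integral_indicator' indicator_inter_arith[symmetric])
    also have "proj ` B \<inter> (param -` A \<inter> space borel) = proj ` (A \<inter> B)"
      using B(1) by (force simp: param_proj image_iff)
    finally show ?thesis .
  qed
  have \<mu>: "emeasure \<mu> A = hausdorff_outer (DIM('b)) (A \<inter> B)" if A: "A \<in> sets borel" for A
  proof -
    have "emeasure \<mu> A = emeasure ?H (B \<inter> A)"
      unfolding \<mu>_def using idm A B
      by (simp add: emeasure_distr emeasure_density BH indicator_inter_arith[symmetric])
    then show ?thesis using A B by (simp add: emeasure_hausdorff_measure BH Int_commute)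
  qed
  have AB: "A \<inter> B \<subseteq> cap" "A \<inter> B \<in> sets borel" if "A \<in> sets borel" for A
    using that B by auto
  have sets: "sets \<nu> = sets borel" "sets \<mu> = sets borel" by (simp_all add: \<nu>_def \<mu>_def)
  have "\<nu> \<le> \<mu>"
    using sets by (subst le_measure) (auto simp: \<nu> \<mu> hausdorff_proj(1)[OF AB])
  then show "?I \<le> ?J" unfolding I J using sets by (intro nn_integral_mono_measure) auto
  have "\<mu> \<le> scale_measure (ennreal (L ^ DIM('b))) \<nu>"
    using sets by (subst le_measure) (auto simp: \<nu> \<mu> hausdorff_proj(2)[OF AB])
  then have "(\<integral>\<^sup>+x. g x \<partial>\<mu>) \<le> (\<integral>\<^sup>+x. g x \<partial>scale_measure (ennreal (L ^ DIM('b))) \<nu>)"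
    using sets by (intro nn_integral_mono_measure) auto
  also have "\<dots> = ennreal (L ^ DIM('b)) * (\<integral>\<^sup>+x. g x \<partial>\<nu>)"
    by (rule nn_integral_scale_measure) (simp add: \<nu>_def)
  finally show "?J \<le> ennreal (L ^ DIM('b)) * ?I" unfolding I J .
qed

lemma cap_normal:
  assumes "x \<in> cap" "x \<in> smooth_points K"
  shows "c \<le> outer_unit_normal K x \<bullet> u" "outer_unit_normal K x \<bullet> u \<le> 1"
proof -
  show "c \<le> outer_unit_normal K x \<bullet> u"
    using assms outer_unit_normal_eq[OF assms(2)] by (auto simp: cap_def)
  show "outer_unit_normal K x \<bullet> u \<le> 1"
    using norm_cauchy_schwarz[of "outer_unit_normal K x" u] norm_u
      normalsD(1)[OF outer_unit_normal_in_normals[OF assms(2)]] by simp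
qed

text \<open>The tangent plane at the base point \<open>x0\<close> is parametrized by the stated linear map,
  and the error is \<open>n0 \<bullet> (x - x0)\<close> up to the factor \<open>n0 \<bullet>
  u\<close>. Since \<open>x\<close> and \<open>x0\<close> lie below each other's supporting
  hyperplanes, this error is at most \<open>norm (x - x0)\<close> times the distance of their
  normals, which is small by continuity of the normal.\<close>

lemma param_has_derivative:
  assumes B: "B \<subseteq> cap" "B \<subseteq> smooth_points K" and y0: "y0 \<in> proj ` B"
  defines "n0 \<equiv> outer_unit_normal K (param y0)"
  shows "(param has_derivative (\<lambda>h. W (h, 0) - ((n0 \<bullet> W (h, 0)) / (n0 \<bullet> u)) *\<^sub>R u)) (at y0 within proj ` B)"
  unfolding has_derivative_within_alt
proof (intro conjI allI impI)
  let ?D = "\<lambda>h. W (h, 0) - ((n0 \<bullet> W (h, 0)) / (n0 \<bullet> u)) *\<^sub>R u"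
  let ?base = "param y0"
  have "linear (\<lambda>h. W (h, 0 :: real))"
    using linear_compose[OF _ W(1), of "\<lambda>h. (h, 0)"] by (simp add: o_def linear_iff)
  then have "linear ?D"
    by (auto simp: linear_iff inner_add_right scaleR_add_left add_divide_distrib scaleR_diff_right)
  then show "bounded_linear ?D" by (simp add: linear_linear)
  have x0: "?base \<in> B" "proj ?base = y0" using y0 B by (auto simp: param_proj subset_eq)
  have n0: "n0 \<in> normals K ?base" "c \<le> n0 \<bullet> u"
    using x0 B cap_normal[of ?base] unfolding n0_def by (auto intro: outer_unit_normal_in_normals)
  have nu: "0 < n0 \<bullet> u" using n0 c by simp
  fix e :: real assume e: "0 < e"
  have "continuous_on (proj ` B) (\<lambda>y. outer_unit_normal K (param y))"
  proof (rule continuous_on_compose2[OF continuous_on_outer_unit_normal[OF compact_K]])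
    show "continuous_on (proj ` B) param" using B by (intro continuous_on_subset[OF continuous_param]) auto
    show "param ` proj ` B \<subseteq> smooth_points K" using B by (simp add: image_param)
  qed
  moreover have "0 < e * c / L" using e c L by simp
  ultimately obtain d where d: "0 < d" "\<And>y. y \<in> proj ` B \<Longrightarrow> dist y y0 < d \<Longrightarrow>
      dist (outer_unit_normal K (param y)) n0 < e * c / L"
    using y0 unfolding continuous_on_iff n0_def by meson
  have "norm (param y - ?base - ?D (y - y0)) \<le> e * norm (y - y0)"
    if y: "y \<in> proj ` B" "norm (y - y0) < d" for y
  proof -
    let ?x = "param y"
    let ?d = "?x - ?base"
    have x: "?x \<in> B" "proj ?x = y" using y B by (auto simp: param_proj subset_eq)
    define m where "m = outer_unit_normal K ?x"
    have m: "m \<in> normals K ?x" using x B unfolding m_def by (auto intro: outer_unit_normal_in_normals)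
    have d_eq: "?d = W (y - y0, 0) + (?d \<bullet> u) *\<^sub>R u"
      using decompose[of ?d] unfolding proj_diff x(2) x0(2) .
    then have "n0 \<bullet> ?d = n0 \<bullet> W (y - y0, 0) + (?d \<bullet> u) * (n0 \<bullet> u)"
      by (metis inner_add_right inner_scaleR_right)
    then have du: "?d \<bullet> u = (n0 \<bullet> ?d - n0 \<bullet> W (y - y0, 0)) / (n0 \<bullet> u)"
      using nu by (simp add: field_simps)
    have "?d - ?D (y - y0) = (?d \<bullet> u + (n0 \<bullet> W (y - y0, 0)) / (n0 \<bullet> u)) *\<^sub>R u"
    proof -
      have "?d - W (y - y0, 0) = (?d \<bullet> u) *\<^sub>R u"
        using d_eq by (metis add_diff_cancel_left')
      then show ?thesis by (simp add: scaleR_add_left diff_diff_eq2 diff_add_eq)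
    qed
    also have "?d \<bullet> u + (n0 \<bullet> W (y - y0, 0)) / (n0 \<bullet> u) = (n0 \<bullet> ?d) / (n0 \<bullet> u)"
      unfolding du by (simp add: diff_divide_distrib)
    finally have err: "norm (?d - ?D (y - y0)) = \<bar>n0 \<bullet> ?d\<bar> / (n0 \<bullet> u)"
      using nu norm_u by simp
    have K: "?x \<in> K" "?base \<in> K" using x x0 B by (auto simp: cap_def)
    have "?d \<bullet> n0 \<le> 0" "(?base - ?x) \<bullet> m \<le> 0"
      using normalsD(2)[OF n0(1) K(1)] normalsD(2)[OF m K(2)] by auto
    then have "\<bar>n0 \<bullet> ?d\<bar> \<le> ?d \<bullet> (m - n0)"
      by (simp add: inner_diff_left inner_diff_right inner_commute)
    also have "\<dots> \<le> norm ?d * norm (m - n0)" by (rule norm_cauchy_schwarz)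
    also have "\<dots> \<le> (L * norm (y - y0)) * (e * c / L)"
    proof (intro mult_mono)
      show "norm ?d \<le> L * norm (y - y0)"
        using cap_flat[of ?base ?x] x x0 B by auto
      show "norm (m - n0) \<le> e * c / L"
        using d(2)[OF y(1)] y(2) by (simp add: dist_norm m_def less_imp_le)
    qed (use L in auto)
    also have "\<dots> = e * norm (y - y0) * c" using L by simp
    finally have "\<bar>n0 \<bullet> ?d\<bar> \<le> e * norm (y - y0) * c" .
    also have "\<dots> \<le> e * norm (y - y0) * (n0 \<bullet> u)"
      using e n0 by (intro mult_left_mono) auto
    finally show ?thesis unfolding err using nu by (simp add: pos_divide_le_eq)
  qed
  then show "\<exists>d>0. \<forall>y\<in>proj ` B. norm (y - y0) < d \<longrightarrow> norm (param y - ?base - ?D (y - y0)) \<le> e * norm (y - y0)"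
    using d(1) by blast
qed

end

section \<open>The cone formula\<close>

text \<open>This agrees with \<^const>\<open>outer_unit_normal\<close> on \<open>K\<close> and is Borel
  measurable on the whole space.\<close>

definition smooth_normal :: "'a::euclidean_space set \<Rightarrow> 'a \<Rightarrow> 'a" where
  "smooth_normal K x = indicator (smooth_points K) x *\<^sub>R outer_unit_normal K x"

definition ray_mass :: "('a::euclidean_space \<Rightarrow> real) \<Rightarrow> 'a \<Rightarrow> 'a \<Rightarrow> ennreal" where
  "ray_mass \<phi> z x =
    (\<integral>\<^sup>+s. ennreal (\<phi> (z + s *\<^sub>R (x - z)) * s ^ (DIM('a) - 1)) * indicator {0..1} s \<partial>lborel)"

definition cone_density :: "'a::euclidean_space set \<Rightarrow> ('a \<Rightarrow> real) \<Rightarrow> 'a \<Rightarrow> 'a \<Rightarrow> ennreal" where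
  "cone_density K \<phi> z x = ennreal \<bar>(z - x) \<bullet> smooth_normal K x\<bar> * ray_mass \<phi> z x"

lemma borel_smooth_normal:
  assumes "compact K"
  shows "smooth_normal K \<in> borel_measurable borel"
  unfolding smooth_normal_def[abs_def]
  using borel_measurable_continuous_on_indicator[OF borel_smooth_points continuous_on_outer_unit_normal] assms
  by auto

lemma borel_ray_mass:
  fixes \<phi> :: "'a::euclidean_space \<Rightarrow> real"
  assumes [measurable]: "\<phi> \<in> borel_measurable borel"
  shows "ray_mass \<phi> z \<in> borel_measurable borel"
  unfolding ray_mass_def[abs_def] by measurable

lemma borel_cone_density:
  fixes \<phi> :: "'a::euclidean_space \<Rightarrow> real"
  assumes "compact K" "\<phi> \<in> borel_measurable borel"
  shows "cone_density K \<phi> z \<in> borel_measurable borel"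
  unfolding cone_density_def[abs_def]
  using borel_smooth_normal[OF assms(1)] borel_ray_mass[OF assms(2), of z] by measurable

lemma ray_mass_open:
  fixes \<phi> :: "'a::euclidean_space \<Rightarrow> real"
  shows "ray_mass \<phi> z x =
    (\<integral>\<^sup>+s. ennreal (\<phi> (z + s *\<^sub>R (x - z)) * s ^ (DIM('a) - 1)) * indicator {0<..<1} s \<partial>lborel)"
  unfolding ray_mass_def
proof (rule nn_integral_cong_AE)
  show "AE s in lborel. ennreal (\<phi> (z + s *\<^sub>R (x - z)) * s ^ (DIM('a) - 1)) * indicator {0..1} s =
      ennreal (\<phi> (z + s *\<^sub>R (x - z)) * s ^ (DIM('a) - 1)) * indicator {0<..<1} s"
    using AE_lborel_singleton[of "0::real"] AE_lborel_singleton[of "1::real"]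
    by eventually_elim (auto simp: indicator_def)
qed

text \<open>No ray from \<open>z\<close> meets \<open>B\<close> twice. The requirement \<open>s = t\<close>
  excludes in addition that \<open>z\<close> is in \<open>B\<close>.\<close>

definition cone_injective_on :: "'a::euclidean_space \<Rightarrow> 'a set \<Rightarrow> bool" where
  "cone_injective_on z B \<longleftrightarrow> (\<forall>x\<in>B. \<forall>y\<in>B. \<forall>s>0. \<forall>t>0.
     z + s *\<^sub>R (x - z) = z + t *\<^sub>R (y - z) \<longrightarrow> x = y \<and> s = t)"

context boundary_chart
begin

text \<open>Change of variables followed by Tonelli's theorem.\<close>

lemma cone_integral:
  fixes \<phi> :: "'a \<Rightarrow> real"
  assumes m: "CARD('m::{finite,wellorder}) = DIM('a)" and dim: "DIM('b) + 1 = DIM('a)"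
    and B: "B \<subseteq> cap" "B \<subseteq> smooth_points K" "B \<in> sets borel" and inj: "cone_injective_on z B"
    and \<phi>: "integrable lebesgue \<phi>" "\<And>x. 0 \<le> \<phi> x" and \<phi>_borel [measurable]: "\<phi> \<in> borel_measurable borel"
  shows "open_cone z B \<in> sets lebesgue"
    and "(\<integral>\<^sup>+y. ennreal (\<phi> y) * indicator (open_cone z B) y \<partial>lebesgue) =
      (\<integral>\<^sup>+y. indicator (proj ` B) y *
        (ennreal (1 / (smooth_normal K (param y) \<bullet> u)) * cone_density K \<phi> z (param y)) \<partial>lborel)"
proof -
  define G where "G p = z + snd p *\<^sub>R (param (fst p) - z)" for p :: "'b \<times> real"
  define S where "S = proj ` B \<times> {0<..<1::real}"
  define n where "n p = outer_unit_normal K (param (fst p))" for p :: "'b \<times> real"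
  have pB [measurable]: "proj ` B \<in> sets borel" by (rule borel_proj_image[OF B(1,3)])
  have S_borel [measurable]: "S \<in> sets borel" unfolding S_def by (intro borel_Times pB) auto
  have par: "param y \<in> B" "proj (param y) = y" if "y \<in> proj ` B" for y
    using that B(1) by (auto simp: param_proj subset_eq)
  have GS: "G ` S = open_cone z B"
  proof (intro equalityI subsetI)
    fix w assume "w \<in> G ` S"
    then obtain y s where ys: "(y, s) \<in> S" "w = G (y, s)" by auto
    then have "y \<in> proj ` B" "0 < s" "s < 1" "w = z + s *\<^sub>R (param y - z)"
      unfolding G_def S_def by (simp_all only: mem_Times_iff fst_conv snd_conv greaterThanLessThan_iff)
    then show "w \<in> open_cone z B" using par(1)[of y] unfolding open_cone_def by blast
  next
    fix w assume "w \<in> open_cone z B"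
    then obtain x s where "x \<in> B" "0 < s" "s < 1" "w = z + s *\<^sub>R (x - z)" by (auto simp: open_cone_def)
    then show "w \<in> G ` S"
      using B(1) by (intro image_eqI[of _ _ "(proj x, s)"]) (auto simp: G_def S_def param_proj subset_eq)
  qed
  have injG: "inj_on G S"
  proof (rule inj_onI)
    fix p q assume p: "p \<in> S" and q: "q \<in> S" and eq: "G p = G q"
    have "param (fst p) = param (fst q) \<and> snd p = snd q"
      using inj p q eq par(1) unfolding cone_injective_on_def G_def S_def
      by (metis greaterThanLessThan_iff mem_Times_iff)
    then show "p = q" using par(2) p q by (metis S_def mem_Times_iff prod_eq_iff)
  qed
  have cn: "c \<le> n p \<bullet> u" "n p \<bullet> u \<le> 1" if "p \<in> S" for p
  proof -
    have "param (fst p) \<in> B" using par(1)[of "fst p"] that by (auto simp: S_def)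
    then have "param (fst p) \<in> cap" "param (fst p) \<in> smooth_points K" using B by auto
    then show "c \<le> n p \<bullet> u" "n p \<bullet> u \<le> 1" unfolding n_def by (rule cap_normal)+
  qed
  have nu: "n p \<bullet> u \<noteq> 0" if "p \<in> S" for p using cn[OF that] c by auto
  have der: "(G has_derivative (\<lambda>h. snd p *\<^sub>R W h - (snd p * (n p \<bullet> W h) / (n p \<bullet> u)) *\<^sub>R u +
        (u \<bullet> W h) *\<^sub>R (param (fst p) - z))) (at p within S)" if p: "p \<in> S" for p
  proof -
    have fp: "fst p \<in> proj ` B" using p by (auto simp: S_def)
    let ?D = "\<lambda>h. W (h, 0) - ((n p \<bullet> W (h, 0)) / (n p \<bullet> u)) *\<^sub>R u"
    have "(param has_derivative ?D) (at (fst p) within proj ` B)"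
      using param_has_derivative[OF B(1,2) fp] by (simp add: n_def)
    then have "(param has_derivative ?D) (at (fst p) within fst ` S)"
      by (rule has_derivative_subset) (auto simp: S_def)
    from has_derivative_in_compose[OF has_derivative_fst[OF has_derivative_ident] this]
    have P: "((\<lambda>p. param (fst p)) has_derivative (\<lambda>h. ?D (fst h))) (at p within S)" .
    have "(G has_derivative (\<lambda>h. snd p *\<^sub>R ?D (fst h) + snd h *\<^sub>R (param (fst p) - z))) (at p within S)"
      unfolding G_def by (rule derivative_eq_intros P refl | simp)+
    moreover have "snd p *\<^sub>R ?D (fst h) + snd h *\<^sub>R (param (fst p) - z) =
        snd p *\<^sub>R W h - (snd p * (n p \<bullet> W h) / (n p \<bullet> u)) *\<^sub>R u + (u \<bullet> W h) *\<^sub>R (param (fst p) - z)" for h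
    proof -
      have Wh: "W h = W (fst h, 0) + snd h *\<^sub>R u" using W_eq[of "fst h" "snd h"] by simp
      have uW: "u \<bullet> W h = snd h" using inner_u_W[of "fst h" "snd h"] by simp
      have "(snd p * (n p \<bullet> W h) / (n p \<bullet> u)) = snd p * ((n p \<bullet> W (fst h, 0)) / (n p \<bullet> u)) + snd p * snd h"
        unfolding Wh using nu[OF p] by (simp add: inner_add_right field_simps)
      then show ?thesis unfolding uW by (simp add: Wh algebra_simps)
    qed
    ultimately show ?thesis by simp
  qed
  have dimp: "DIM('b \<times> real) = DIM('a)" using dim by simp
  have S_leb: "S \<in> sets lebesgue" using S_borel by simp
  have pos: "0 < snd p" if "p \<in> S" for p using that by (auto simp: S_def)
  note cov = nn_integral_cone_map[OF m dimp W W' S_leb injG norm_u(2) nu pos der \<phi>]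
  show "open_cone z B \<in> sets lebesgue" using cov(1) by (simp add: GS)
  let ?N = "smooth_normal K"
  have N [measurable]: "?N \<in> borel_measurable borel" by (rule borel_smooth_normal[OF compact_K])
  define H where "H p = ennreal (\<bar>snd p ^ (DIM('a) - 1) * (?N (param (fst p)) \<bullet> (param (fst p) - z)) /
      (?N (param (fst p)) \<bullet> u)\<bar> * \<phi> (G p)) * indicator S p" for p
  have [measurable]: "S \<in> sets (borel \<Otimes>\<^sub>M borel)"
    unfolding S_def by (intro pair_measureI pB) auto
  have "H \<in> borel_measurable (borel \<Otimes>\<^sub>M borel)" unfolding H_def G_def by measurable
  then have H_borel [measurable]: "H \<in> borel_measurable borel" unfolding borel_prod .
  have nN: "?N (param y) = outer_unit_normal K (param y)" if "y \<in> proj ` B" for y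
    using par(1)[OF that] B(2) by (auto simp: smooth_normal_def)
  have "(\<integral>\<^sup>+y. ennreal (\<phi> y) * indicator (open_cone z B) y \<partial>lebesgue) =
      (\<integral>\<^sup>+p. ennreal (\<bar>snd p ^ (DIM('a) - 1) * (n p \<bullet> (param (fst p) - z)) / (n p \<bullet> u)\<bar> * \<phi> (G p)) *
        indicator S p \<partial>lebesgue)"
    using cov(2) unfolding GS .
  also have "\<dots> = (\<integral>\<^sup>+p. H p \<partial>lebesgue)"
    by (intro nn_integral_cong) (auto simp: H_def n_def nN S_def indicator_def)
  also have "\<dots> = (\<integral>\<^sup>+p. H p \<partial>(lborel \<Otimes>\<^sub>M lborel))"
    by (simp add: nn_integral_completion lborel_prod)
  also have "\<dots> = (\<integral>\<^sup>+y. \<integral>\<^sup>+s. H (y, s) \<partial>lborel \<partial>lborel)"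
    by (rule lborel.nn_integral_fst[symmetric]) (simp add: lborel_prod)
  also have "\<dots> = (\<integral>\<^sup>+y. indicator (proj ` B) y *
        (ennreal (1 / (?N (param y) \<bullet> u)) * cone_density K \<phi> z (param y)) \<partial>lborel)"
  proof (rule nn_integral_cong)
    fix y :: 'b
    show "(\<integral>\<^sup>+s. H (y, s) \<partial>lborel) = indicator (proj ` B) y *
        (ennreal (1 / (?N (param y) \<bullet> u)) * cone_density K \<phi> z (param y))"
    proof (cases "y \<in> proj ` B")
      case False
      then show ?thesis by (simp add: H_def S_def)
    next
      case True
      let ?x = "param y"
      let ?q = "\<bar>(z - ?x) \<bullet> ?N ?x\<bar>"
      have "(y, 1 / 2) \<in> S" using True by (simp add: S_def)
      then have nu: "0 < ?N ?x \<bullet> u" using cn[of "(y, 1 / 2)"] c by (simp add: n_def nN[OF True])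
      have "H (y, s) = ennreal (1 / (?N ?x \<bullet> u)) * (ennreal ?q *
          (ennreal (\<phi> (z + s *\<^sub>R (?x - z)) * s ^ (DIM('a) - 1)) * indicator {0<..<1} s))" for s
      proof (cases "0 < s \<and> s < 1")
        case s: True
        have "\<bar>s ^ (DIM('a) - 1) * (?N ?x \<bullet> (?x - z)) / (?N ?x \<bullet> u)\<bar> * \<phi> (z + s *\<^sub>R (?x - z)) =
            (1 / (?N ?x \<bullet> u)) * (?q * (\<phi> (z + s *\<^sub>R (?x - z)) * s ^ (DIM('a) - 1)))"
        proof -
          have "?N ?x \<bullet> (?x - z) = - ((z - ?x) \<bullet> ?N ?x)" by (simp add: inner_diff_left inner_diff_right inner_commute)
          then show ?thesis using s nu by (simp add: abs_mult)
        qed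
        then show ?thesis
          using True s nu \<phi>(2) by (simp add: H_def S_def G_def flip: ennreal_mult)
      qed (auto simp: H_def S_def)
      then show ?thesis
        using True by (simp add: cone_density_def ray_mass_open nn_integral_cmult)
    qed
  qed
  finally show "(\<integral>\<^sup>+y. ennreal (\<phi> y) * indicator (open_cone z B) y \<partial>lebesgue) =
      (\<integral>\<^sup>+y. indicator (proj ` B) y *
        (ennreal (1 / (smooth_normal K (param y) \<bullet> u)) * cone_density K \<phi> z (param y)) \<partial>lborel)" .
qed

text \<open>Two errors enter: the Jacobian has the factor \<open>1 / (n \<bullet> u)\<close>, which lies
  between \<open>1\<close> and \<open>1 / c\<close>, and Hausdorff measure differs from the
  Lebesgue measure of the projection by at most the power of \<open>L\<close>.\<close>

lemma cone_integral_bounds: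
  fixes \<phi> :: "'a \<Rightarrow> real"
  assumes m: "CARD('m::{finite,wellorder}) = DIM('a)" and dim: "DIM('b) + 1 = DIM('a)"
    and B: "B \<subseteq> cap" "B \<subseteq> smooth_points K" "B \<in> sets borel" and inj: "cone_injective_on z B"
    and \<phi>: "integrable lebesgue \<phi>" "\<And>x. 0 \<le> \<phi> x" "\<phi> \<in> borel_measurable borel"
  defines "I \<equiv> (\<integral>\<^sup>+y. ennreal (\<phi> y) * indicator (open_cone z B) y \<partial>lebesgue)"
    and "J \<equiv> (\<integral>\<^sup>+x. indicator B x * cone_density K \<phi> z x \<partial>hausdorff_measure (DIM('b)))"
  shows "I \<le> ennreal (1 / c) * J" and "J \<le> ennreal (L ^ DIM('b)) * I"
proof -
  let ?g = "cone_density K \<phi> z"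
  let ?M = "\<integral>\<^sup>+y. indicator (proj ` B) y * ?g (param y) \<partial>lborel"
  have g [measurable]: "?g \<in> borel_measurable borel" by (rule borel_cone_density[OF compact_K \<phi>(3)])
  have [measurable]: "proj ` B \<in> sets borel" by (rule borel_proj_image[OF B(1,3)])
  have I: "I = (\<integral>\<^sup>+y. indicator (proj ` B) y * (ennreal (1 / (smooth_normal K (param y) \<bullet> u)) * ?g (param y)) \<partial>lborel)"
    unfolding I_def by (rule cone_integral(2)[OF m dim B inj \<phi>])
  have nu: "c \<le> smooth_normal K (param y) \<bullet> u" "smooth_normal K (param y) \<bullet> u \<le> 1" if "y \<in> proj ` B" for y
  proof -
    have "param y \<in> B" using that B(1) by (auto simp: param_proj subset_eq)
    then have "param y \<in> cap" "param y \<in> smooth_points K" using B by auto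
    then show "c \<le> smooth_normal K (param y) \<bullet> u" "smooth_normal K (param y) \<bullet> u \<le> 1"
      using cap_normal[of "param y"] by (auto simp: smooth_normal_def)
  qed
  have "I \<le> (\<integral>\<^sup>+y. ennreal (1 / c) * (indicator (proj ` B) y * ?g (param y)) \<partial>lborel)"
    unfolding I
  proof (rule nn_integral_mono)
    fix y
    show "indicator (proj ` B) y * (ennreal (1 / (smooth_normal K (param y) \<bullet> u)) * ?g (param y)) \<le>
        ennreal (1 / c) * (indicator (proj ` B) y * ?g (param y))"
    proof (cases "y \<in> proj ` B")
      case True
      then have "1 / (smooth_normal K (param y) \<bullet> u) \<le> 1 / c"
        using nu[OF True] c by (intro divide_left_mono) auto
      then show ?thesis using True by (simp add: mult_right_mono ennreal_leI)
    qed simp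
  qed
  also have "\<dots> = ennreal (1 / c) * ?M" by (rule nn_integral_cmult) measurable
  also have "\<dots> \<le> ennreal (1 / c) * J"
    unfolding J_def by (intro mult_left_mono nn_integral_hausdorff_param(1)[OF B(1,3) g]) simp
  finally show "I \<le> ennreal (1 / c) * J" .
  have "?M \<le> I"
    unfolding I
  proof (rule nn_integral_mono)
    fix y
    show "indicator (proj ` B) y * ?g (param y) \<le>
        indicator (proj ` B) y * (ennreal (1 / (smooth_normal K (param y) \<bullet> u)) * ?g (param y))"
    proof (cases "y \<in> proj ` B")
      case True
      then have "1 \<le> 1 / (smooth_normal K (param y) \<bullet> u)" using nu[OF True] c by simp
      then have "1 \<le> ennreal (1 / (smooth_normal K (param y) \<bullet> u))"
        by (metis ennreal_1 ennreal_leI)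
      from mult_right_mono[OF this, of "?g (param y)"] show ?thesis using True by simp
    qed simp
  qed
  then show "J \<le> ennreal (L ^ DIM('b)) * I"
    unfolding J_def
    by (rule order_trans[OF nn_integral_hausdorff_param(2)[OF B(1,3) g] mult_left_mono]) simp
qed

end

text \<open>Any isometry composed with a rotation that corrects the image of the last unit vector.\<close>

lemma isometry_to_direction:
  fixes u :: "real ^ 'n"
  assumes dim: "DIM('b::euclidean_space) + 1 = CARD('n)" and u: "norm u = 1"
  obtains W :: "'b::euclidean_space \<times> real \<Rightarrow> real ^ 'n" and W'
  where "linear W" "\<And>p. norm (W p) = norm p" "linear W'" "\<And>x. W (W' x) = x" "\<And>p. W' (W p) = p" "W (0, 1) = u"
proof -
  have "DIM('b \<times> real) = DIM(real ^ 'n)" using dim by simp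
  from isomorphisms_UNIV_UNIV[OF this] obtain V :: "'b \<times> real \<Rightarrow> real ^ 'n" and V' where
    V: "linear V" "linear V'" "\<And>p. norm (V p) = norm p" "\<And>x. norm (V' x) = norm x"
      "\<And>p. V' (V p) = p" "\<And>x. V (V' x) = x" by metis
  have "norm (V (0, 1)) = 1" using V(3) by (simp add: norm_Pair)
  then obtain Q where Q: "orthogonal_transformation Q" "Q (V (0, 1)) = u"
    using orthogonal_transformation_exists_1[OF _ u] by metis
  obtain P where P: "orthogonal_transformation P" "\<And>x. P (Q x) = x" "\<And>x. Q (P x) = x"
    using orthogonal_transformation_inv[OF Q(1)] orthogonal_transformation_bij[OF Q(1)]
    by (metis bij_inv_eq_iff)
  show thesis
  proof (rule that[of "Q \<circ> V" "V' \<circ> P"])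
    show "linear (Q \<circ> V)" "linear (V' \<circ> P)"
      using Q P V by (auto intro: linear_compose simp: orthogonal_transformation_linear)
  qed (use Q P V in \<open>auto simp: orthogonal_transformation_norm\<close>)
qed

lemma cone_injective_on_subset: "cone_injective_on z B \<Longrightarrow> A \<subseteq> B \<Longrightarrow> cone_injective_on z A"
  unfolding cone_injective_on_def by blast

lemma open_cone_Un: "open_cone z (A \<union> B) = open_cone z A \<union> open_cone z B"
  by (auto simp: open_cone_def)

lemma open_cone_disjoint:
  assumes "cone_injective_on z (A \<union> B)" "A \<inter> B = {}"
  shows "open_cone z A \<inter> open_cone z B = {}"
proof -
  have False if "x \<in> A" "y \<in> B" "0 < s" "0 < t" "z + s *\<^sub>R (x - z) = z + t *\<^sub>R (y - z)" for x y s t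
    using assms that unfolding cone_injective_on_def by blast
  then show ?thesis unfolding open_cone_def by blast
qed

text \<open>The bounds of a single chart add up over disjoint pieces of \<open>B\<close>, one for each
  direction of the cover.\<close>

lemma cone_formula_caps:
  fixes K :: "(real ^ 'n) set" and \<phi> :: "real ^ 'n \<Rightarrow> real"
  assumes n: "CARD('n) \<ge> 2" and K: "compact K"
    and \<phi>: "integrable lebesgue \<phi>" "\<And>x. 0 \<le> \<phi> x" "\<phi> \<in> borel_measurable borel"
    and c: "1 / 2 < c" "c < 1" and U: "finite U" "\<And>u. u \<in> U \<Longrightarrow> norm u = 1"
    and B: "B \<subseteq> smooth_points K" "B \<in> sets borel" "cone_injective_on z B"
    and cov: "\<And>x. x \<in> B \<Longrightarrow> \<exists>u\<in>U. c \<le> outer_unit_normal K x \<bullet> u"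
  shows "open_cone z B \<in> sets lebesgue \<and>
    (\<integral>\<^sup>+y. ennreal (\<phi> y) * indicator (open_cone z B) y \<partial>lebesgue) \<le> ennreal (1 / c) *
      (\<integral>\<^sup>+x. indicator B x * cone_density K \<phi> z x \<partial>hausdorff_measure (CARD('n) - 1)) \<and>
    (\<integral>\<^sup>+x. indicator B x * cone_density K \<phi> z x \<partial>hausdorff_measure (CARD('n) - 1)) \<le>
      ennreal ((1 / sqrt (2 * c - 1)) ^ (CARD('n) - 1)) *
      (\<integral>\<^sup>+y. ennreal (\<phi> y) * indicator (open_cone z B) y \<partial>lebesgue)"
  using U B cov
proof (induction U arbitrary: B rule: finite_induct)
  case empty
  then have "B = {}" by auto
  then show ?case by (simp add: open_cone_def)
next
  case (insert u U)
  let ?d = "CARD('n) - 1"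
  let ?I = "\<lambda>B. \<integral>\<^sup>+y. ennreal (\<phi> y) * indicator (open_cone z B) y \<partial>lebesgue"
  let ?J = "\<lambda>B. \<integral>\<^sup>+x. indicator B x * cone_density K \<phi> z x \<partial>hausdorff_measure ?d"
  let ?P = "\<lambda>B. open_cone z B \<in> sets lebesgue \<and> ?I B \<le> ennreal (1 / c) * ?J B \<and>
      ?J B \<le> ennreal ((1 / sqrt (2 * c - 1)) ^ ?d) * ?I B"
  define A where "A = B \<inter> {x. c \<le> smooth_normal K x \<bullet> u}"
  have [measurable]: "smooth_normal K \<in> borel_measurable borel" by (rule borel_smooth_normal[OF K])
  have A: "A \<subseteq> B" "A \<in> sets borel" unfolding A_def using insert.prems(3) by auto
  have NA: "outer_unit_normal K x = smooth_normal K x" if "x \<in> B" for x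
    using that insert.prems(2) by (auto simp: smooth_normal_def)
  have "?P A"
  proof -
    have d: "DIM((real, 'n pred_index) vec) = ?d" using n by (simp add: card_pred_index)
    then have dim: "DIM((real, 'n pred_index) vec) + 1 = CARD('n)" using n by simp
    \<comment> \<open>This provides the well-ordered copy of the index type \<open>'n\<close>.\<close>
    have m: "CARD('n option pred_index) = DIM(real ^ 'n)" using n by (simp add: card_pred_index)
    obtain W :: "(real, 'n pred_index) vec \<times> real \<Rightarrow> real ^ 'n" and W' where
      W: "linear W" "\<And>p. norm (W p) = norm p" "linear W'" "\<And>x. W (W' x) = x" "\<And>p. W' (W p) = p" "W (0, 1) = u"
      using isometry_to_direction[OF dim, of u] insert.prems(1) by blast
    interpret boundary_chart K W W' u c
      by (rule boundary_chart.intro) (rule K W c(1) less_imp_le[OF c(2)])+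
    have cap: "A \<subseteq> cap"
    proof
      fix x assume x: "x \<in> A"
      then have sm: "x \<in> smooth_points K" using A insert.prems(2) by blast
      have "c \<le> outer_unit_normal K x \<bullet> u" using x NA A by (auto simp: A_def)
      then show "x \<in> cap"
        using sm outer_unit_normal_in_normals[OF sm] by (auto simp: cap_def smooth_points_def)
    qed
    have sm: "A \<subseteq> smooth_points K" using A insert.prems(2) by blast
    have inj: "cone_injective_on z A" using cone_injective_on_subset[OF insert.prems(4) A(1)] .
    have dim': "DIM((real, 'n pred_index) vec) + 1 = DIM(real ^ 'n)" using dim by simp
    show "?P A"
      by (intro conjI cone_integral(1)[OF m dim' cap sm A(2) inj \<phi>]
          cone_integral_bounds[OF m dim' cap sm A(2) inj \<phi>, unfolded d L_def])
  qed
  moreover have "?P (B - A)"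
  proof (rule insert.IH)
    show "B - A \<in> sets borel" using insert.prems(3) A by auto
    show "cone_injective_on z (B - A)" by (rule cone_injective_on_subset[OF insert.prems(4)]) auto
    show "\<exists>v\<in>U. c \<le> outer_unit_normal K x \<bullet> v" if "x \<in> B - A" for x
      using insert.prems(5)[of x] that NA[of x] by (auto simp: A_def)
  qed (use insert.prems in auto)
  moreover have "?I B = ?I A + ?I (B - A)"
  proof -
    have BA: "A \<union> (B - A) = B" using A by auto
    have dis: "open_cone z A \<inter> open_cone z (B - A) = {}"
      by (rule open_cone_disjoint) (use BA insert.prems(4) in auto)
    have "ennreal (\<phi> y) * indicator (open_cone z B) y = ennreal (\<phi> y) * indicator (open_cone z A) y +
        ennreal (\<phi> y) * indicator (open_cone z (B - A)) y" for y
      using open_cone_Un[of z A "B - A"] dis unfolding BA by (auto simp: indicator_def)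
    then have "?I B = (\<integral>\<^sup>+y. ennreal (\<phi> y) * indicator (open_cone z A) y +
        ennreal (\<phi> y) * indicator (open_cone z (B - A)) y \<partial>lebesgue)" by simp
    also have "\<dots> = ?I A + ?I (B - A)"
      using \<open>?P A\<close> \<open>?P (B - A)\<close> borel_measurable_integrable[OF \<phi>(1)]
      by (intro nn_integral_add borel_measurable_times_ennreal borel_measurable_indicator measurable_compose[OF _ measurable_ennreal]) auto
    finally show ?thesis .
  qed
  moreover have "?J B = ?J A + ?J (B - A)"
  proof -
    have g: "cone_density K \<phi> z \<in> borel_measurable (hausdorff_measure ?d)"
      by (rule borel_measurable_hausdorff_measure[OF borel_cone_density[OF K \<phi>(3)]])
    have "indicator B x * cone_density K \<phi> z x = indicator A x * cone_density K \<phi> z x +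
        indicator (B - A) x * cone_density K \<phi> z x" for x
      using A(1) by (auto simp: indicator_def)
    then have "?J B = (\<integral>\<^sup>+x. indicator A x * cone_density K \<phi> z x +
        indicator (B - A) x * cone_density K \<phi> z x \<partial>hausdorff_measure ?d)" by simp
    also have "\<dots> = ?J A + ?J (B - A)"
    proof -
      have "A \<in> sets (hausdorff_measure ?d)" "B - A \<in> sets (hausdorff_measure ?d)"
        using A insert.prems(3) borel_subset_hausdorff_measure by auto
      then show ?thesis
        by (intro nn_integral_add borel_measurable_times_ennreal borel_measurable_indicator g)
    qed
    finally show ?thesis .
  qed
  moreover have "open_cone z B = open_cone z A \<union> open_cone z (B - A)"
    using open_cone_Un[of z A "B - A"] A by (simp add: Un_absorb1)
  ultimately show ?case by (auto simp: distrib_left intro: add_mono)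
qed

text \<open>For every \<open>c < 1\<close> finitely many caps of opening \<open>c\<close> cover the unit
  sphere of normals, and both factors in the bounds tend to 1 as \<open>c\<close> tends to 1.\<close>

theorem cone_formula:
  fixes K :: "(real ^ 'n) set" and \<phi> :: "real ^ 'n \<Rightarrow> real"
  assumes n: "CARD('n) \<ge> 2" and K: "compact K"
    and \<phi>: "integrable lebesgue \<phi>" "\<And>x. 0 \<le> \<phi> x" "\<phi> \<in> borel_measurable borel"
    and B: "B \<subseteq> smooth_points K" "B \<in> sets borel" "cone_injective_on z B"
  shows "(\<integral>\<^sup>+x. indicator B x * cone_density K \<phi> z x \<partial>hausdorff_measure (CARD('n) - 1)) =
    (\<integral>\<^sup>+y. ennreal (\<phi> y) * indicator (open_cone z B) y \<partial>lebesgue)" (is "?J = ?I")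
proof -
  let ?d = "CARD('n) - 1"
  have bounds: "?I \<le> ennreal (1 / c) * ?J" "?J \<le> ennreal ((1 / sqrt (2 * c - 1)) ^ ?d) * ?I"
    if c: "1 / 2 < c" "c < 1" for c
  proof -
    have "sphere 0 1 \<subseteq> (\<Union>u\<in>sphere 0 1. {m :: real ^ 'n. c < m \<bullet> u})"
      using c by (auto simp: dot_square_norm)
    moreover have "open {m :: real ^ 'n. c < m \<bullet> u}" for u
      by (intro open_Collect_less continuous_intros)
    ultimately obtain U where U: "U \<subseteq> sphere 0 1" "finite U" "sphere 0 1 \<subseteq> (\<Union>u\<in>U. {m :: real ^ 'n. c < m \<bullet> u})"
      using compactE_image[OF compact_sphere, of "sphere 0 1" "\<lambda>u. {m :: real ^ 'n. c < m \<bullet> u}" 0 1] by auto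
    have cov: "\<exists>u\<in>U. c \<le> outer_unit_normal K x \<bullet> u" if "x \<in> B" for x
    proof -
      have "outer_unit_normal K x \<in> sphere 0 1"
        using normalsD(1)[OF outer_unit_normal_in_normals] that B(1) by auto
      then obtain u where "u \<in> U" "c < outer_unit_normal K x \<bullet> u" using U(3) by blast
      then show ?thesis by (intro bexI[of _ u]) auto
    qed
    have u1: "norm u = 1" if "u \<in> U" for u using U(1) that by auto
    show "?I \<le> ennreal (1 / c) * ?J" "?J \<le> ennreal ((1 / sqrt (2 * c - 1)) ^ ?d) * ?I"
      using cone_formula_caps[OF n K \<phi> c U(2) u1 B cov] by auto
  qed
  have ev: "eventually (\<lambda>c. 1 / 2 < c \<and> c < 1) (at_left (1::real))"
    using eventually_at_left_real[of "1 / 2" "1::real"] by (simp add: greaterThanLessThan_iff)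
  have "?I \<le> (\<integral>\<^sup>+y. ennreal (\<phi> y) \<partial>lebesgue)"
    by (intro nn_integral_mono) (auto simp: indicator_def)
  also have "\<dots> < top" using \<phi> by (simp add: nn_integral_eq_integral)
  finally have I: "?I < top" .
  have "?J < top"
    using le_less_trans[OF bounds(2)[of "3 / 4"] ennreal_mult_less_top[THEN iffD2]] I by auto
  then have lim1: "((\<lambda>c. ?J * ennreal (1 / c)) \<longlongrightarrow> ?J * ennreal (1 / 1)) (at_left 1)"
    by (intro ennreal_tendsto_cmult tendsto_ennrealI tendsto_intros) auto
  have lim2: "((\<lambda>c. ?I * ennreal ((1 / sqrt (2 * c - 1)) ^ ?d)) \<longlongrightarrow> ?I * ennreal ((1 / sqrt (2 * 1 - 1)) ^ ?d)) (at_left 1)"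
    using I by (intro ennreal_tendsto_cmult tendsto_ennrealI tendsto_intros) auto
  have "?I \<le> ?J * ennreal (1 / 1)"
    by (rule tendsto_lowerbound[OF lim1]) (use ev bounds(1) in \<open>auto elim!: eventually_mono simp: mult.commute\<close>)
  moreover have "?J \<le> ?I * ennreal ((1 / sqrt (2 * 1 - 1)) ^ ?d)"
    by (rule tendsto_lowerbound[OF lim2]) (use ev bounds(2) in \<open>auto elim!: eventually_mono simp: mult.commute\<close>)
  ultimately show ?thesis by (simp add: antisym)
qed

section \<open>The boundary integral\<close>

lemma nn_integral_weighted_vol:
  fixes \<phi> :: "'a::euclidean_space \<Rightarrow> real"
  assumes \<phi>: "integrable lebesgue \<phi>" "\<And>x. 0 \<le> \<phi> x" and ext: "\<And>y. y \<notin> U \<Longrightarrow> \<phi> y = 0"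
    and A: "A \<in> sets lebesgue"
  shows "(\<integral>\<^sup>+y. ennreal (\<phi> y) * indicator A y \<partial>lebesgue) = ennreal (weighted_vol U \<phi> A)"
    and "0 \<le> weighted_vol U \<phi> A"
proof -
  have eq: "weighted_vol U \<phi> A = (LINT y|lebesgue. indicator A y * \<phi> y)"
    unfolding weighted_vol_def set_lebesgue_integral_def
    using ext by (intro Bochner_Integration.integral_cong) (auto simp: indicator_def)
  have int: "integrable lebesgue (\<lambda>y. indicator A y * \<phi> y)"
    using integrable_mult_indicator[OF A \<phi>(1)] by simp
  have "(\<integral>\<^sup>+y. ennreal (\<phi> y) * indicator A y \<partial>lebesgue) = (\<integral>\<^sup>+y. ennreal (indicator A y * \<phi> y) \<partial>lebesgue)"
    by (intro nn_integral_cong) (simp add: indicator_def)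
  also have "\<dots> = ennreal (weighted_vol U \<phi> A)"
    unfolding eq by (rule nn_integral_eq_integral[OF int]) (simp add: \<phi>)
  finally show "(\<integral>\<^sup>+y. ennreal (\<phi> y) * indicator A y \<partial>lebesgue) = ennreal (weighted_vol U \<phi> A)" .
  show "0 \<le> weighted_vol U \<phi> A" unfolding eq by (intro integral_nonneg_AE) (simp add: \<phi>)
qed

lemma borel_cone_sides:
  assumes "compact K"
  shows "visible K z \<in> sets borel" "hidden K z \<in> sets borel"
proof -
  have [measurable]: "smooth_normal K \<in> borel_measurable borel" "smooth_points K \<in> sets borel"
    using assms by (auto intro: borel_smooth_normal borel_smooth_points)
  have "visible K z = smooth_points K \<inter> {x. 0 < (z - x) \<bullet> smooth_normal K x}"
    "hidden K z = smooth_points K \<inter> {x. (z - x) \<bullet> smooth_normal K x < 0}"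
    by (auto simp: visible_def hidden_def smooth_normal_def)
  then show "visible K z \<in> sets borel" "hidden K z \<in> sets borel" by auto
qed

text \<open>Boundary points that are not smooth or are tangential contribute nothing, so the integral is the
  sum of the \<open>\<phi>\<close>-volumes of the cones over the hidden and over the visible
  part.\<close>

lemma nn_integral_cone_density:
  fixes K :: "(real ^ 'n) set" and \<phi> :: "real ^ 'n \<Rightarrow> real"
  assumes n: "CARD('n) \<ge> 2" and body: "convex_body K"
    and \<phi>: "integrable lebesgue \<phi>" "\<And>x. 0 \<le> \<phi> x" "\<phi> \<in> borel_measurable borel"
    and ext: "\<And>y. y \<notin> U \<Longrightarrow> \<phi> y = 0"
  shows "(\<integral>\<^sup>+x. indicator (frontier K) x * cone_density K \<phi> z x \<partial>hausdorff_measure (CARD('n) - 1)) =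
    ennreal (weighted_vol U \<phi> K + 2 * added_vol U \<phi> K z)"
proof -
  let ?H = "hausdorff_measure (CARD('n) - 1) :: (real ^ 'n) measure"
  let ?g = "cone_density K \<phi> z"
  let ?C = "convex hull (insert z K)"
  have K: "compact K" "convex K" using body by (auto simp: convex_body_def)
  have sm: "smooth_points K \<subseteq> frontier K"
  proof
    fix x assume x: "x \<in> smooth_points K"
    then have "x \<in> K" by (simp add: smooth_points_def)
    then show "x \<in> frontier K"
      using not_interior_normal[OF outer_unit_normal_in_normals[OF x]] closure_subset by (auto simp: frontier_def)
  qed
  have split: "indicator (frontier K) x * ?g x = indicator (hidden K z) x * ?g x + indicator (visible K z) x * ?g x" for x
  proof (cases "x \<in> smooth_points K \<and> (z - x) \<bullet> outer_unit_normal K x \<noteq> 0")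
    case True
    then show ?thesis using sm by (auto simp: indicator_def hidden_def visible_def)
  next
    case False
    then have "?g x = 0" by (auto simp: cone_density_def smooth_normal_def)
    then show ?thesis by simp
  qed
  have g: "?g \<in> borel_measurable ?H"
    by (rule borel_measurable_hausdorff_measure[OF borel_cone_density[OF K(1) \<phi>(3)]])
  have sides: "hidden K z \<in> sets ?H" "visible K z \<in> sets ?H"
    using borel_cone_sides[OF K(1)] borel_subset_hausdorff_measure by blast+
  have inj: "cone_injective_on z (hidden K z)" "cone_injective_on z (visible K z)"
    unfolding cone_injective_on_def
    by (intro ballI allI impI; rule cone_injective_hidden cone_injective_visible; assumption)+
  have subs: "hidden K z \<subseteq> smooth_points K" "visible K z \<subseteq> smooth_points K"
    by (auto simp: hidden_def visible_def)
  have CK: "?C \<in> sets lebesgue" "K \<in> sets lebesgue"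
    using compact_imp_closed[OF compact_convex_hull[OF compact_insert[OF K(1)]]] compact_imp_closed[OF K(1)]
    by auto
  have hid: "(\<integral>\<^sup>+x. indicator (hidden K z) x * ?g x \<partial>?H) = ennreal (weighted_vol U \<phi> ?C)"
  proof -
    have "(\<integral>\<^sup>+x. indicator (hidden K z) x * ?g x \<partial>?H) =
        (\<integral>\<^sup>+y. ennreal (\<phi> y) * indicator (open_cone z (hidden K z)) y \<partial>lebesgue)"
      by (rule cone_formula[OF n K(1) \<phi> subs(1) borel_cone_sides(2)[OF K(1)] inj(1)])
    also have "\<dots> = (\<integral>\<^sup>+y. ennreal (\<phi> y) * indicator ?C y \<partial>lebesgue)"
      using AE_cones(1)[OF body, of z]
      by (intro nn_integral_cong_AE) (auto elim!: eventually_mono simp: indicator_def)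
    also have "\<dots> = ennreal (weighted_vol U \<phi> ?C)"
      by (rule nn_integral_weighted_vol(1)[OF \<phi>(1,2) ext CK(1)])
    finally show ?thesis .
  qed
  have vis: "(\<integral>\<^sup>+x. indicator (visible K z) x * ?g x \<partial>?H) = ennreal (added_vol U \<phi> K z)"
  proof -
    have "(\<integral>\<^sup>+x. indicator (visible K z) x * ?g x \<partial>?H) =
        (\<integral>\<^sup>+y. ennreal (\<phi> y) * indicator (open_cone z (visible K z)) y \<partial>lebesgue)"
      by (rule cone_formula[OF n K(1) \<phi> subs(2) borel_cone_sides(1)[OF K(1)] inj(2)])
    also have "\<dots> = (\<integral>\<^sup>+y. ennreal (\<phi> y) * indicator (?C - K) y \<partial>lebesgue)"
      using AE_cones(2)[OF body, of z]
      by (intro nn_integral_cong_AE) (auto elim!: eventually_mono simp: indicator_def)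
    also have "\<dots> = ennreal (added_vol U \<phi> K z)"
      unfolding added_vol_def
      by (rule nn_integral_weighted_vol(1)[OF \<phi>(1,2) ext]) (use CK in auto)
    finally show ?thesis .
  qed
  have nonneg: "0 \<le> weighted_vol U \<phi> ?C" "0 \<le> added_vol U \<phi> K z" "0 \<le> weighted_vol U \<phi> K"
    unfolding added_vol_def using CK by (auto intro!: nn_integral_weighted_vol(2)[OF \<phi>(1,2) ext])
  have vol_C: "ennreal (weighted_vol U \<phi> ?C) = ennreal (weighted_vol U \<phi> K + added_vol U \<phi> K z)"
  proof -
    have "K \<subseteq> ?C" using hull_subset[of "insert z K" convex] by auto
    then have "ennreal (\<phi> y) * indicator ?C y =
        ennreal (\<phi> y) * indicator K y + ennreal (\<phi> y) * indicator (?C - K) y" for y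
      by (auto simp: indicator_def)
    then have "(\<integral>\<^sup>+y. ennreal (\<phi> y) * indicator ?C y \<partial>lebesgue) =
        (\<integral>\<^sup>+y. ennreal (\<phi> y) * indicator K y + ennreal (\<phi> y) * indicator (?C - K) y \<partial>lebesgue)" by simp
    also have "\<dots> = (\<integral>\<^sup>+y. ennreal (\<phi> y) * indicator K y \<partial>lebesgue) +
        (\<integral>\<^sup>+y. ennreal (\<phi> y) * indicator (?C - K) y \<partial>lebesgue)"
      using CK borel_measurable_integrable[OF \<phi>(1)]
      by (intro nn_integral_add borel_measurable_times_ennreal borel_measurable_indicator measurable_compose[OF _ measurable_ennreal]) auto
    finally show ?thesis
      using CK nonneg
      by (simp add: nn_integral_weighted_vol(1)[OF \<phi>(1,2) ext] added_vol_def)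
  qed
  have "(\<integral>\<^sup>+x. indicator (frontier K) x * ?g x \<partial>?H) =
      (\<integral>\<^sup>+x. indicator (hidden K z) x * ?g x + indicator (visible K z) x * ?g x \<partial>?H)"
    by (simp add: split)
  also have "\<dots> = (\<integral>\<^sup>+x. indicator (hidden K z) x * ?g x \<partial>?H) + (\<integral>\<^sup>+x. indicator (visible K z) x * ?g x \<partial>?H)"
    by (intro nn_integral_add borel_measurable_times_ennreal borel_measurable_indicator sides g)
  also have "\<dots> = ennreal (weighted_vol U \<phi> K + added_vol U \<phi> K z) + ennreal (added_vol U \<phi> K z)"
    unfolding hid vis vol_C ..
  also have "\<dots> = ennreal (weighted_vol U \<phi> K + 2 * added_vol U \<phi> K z)"
    using nonneg by (simp flip: ennreal_plus)
  finally show ?thesis .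
qed

text \<open>The extended nonnegative integral also covers rays on which the real integral fails to exist and
  has the value 0 by convention.\<close>

lemma ray_integral:
  fixes \<phi> :: "'a::euclidean_space \<Rightarrow> real"
  assumes [measurable]: "\<phi> \<in> borel_measurable borel" and nonneg: "\<And>x. 0 \<le> \<phi> x"
  shows "(LINT s:{0..1}|lborel. \<phi> ((1 - s) *\<^sub>R z + s *\<^sub>R x) * s ^ (DIM('a) - 1)) = enn2real (ray_mass \<phi> z x)"
    and "ray_mass \<phi> z x < top \<Longrightarrow>
      set_integrable lborel {0..1} (\<lambda>s. \<phi> ((1 - s) *\<^sub>R z + s *\<^sub>R x) * s ^ (DIM('a) - 1))"
proof -
  let ?f = "\<lambda>s. indicator {0..1} s *\<^sub>R (\<phi> ((1 - s) *\<^sub>R z + s *\<^sub>R x) * s ^ (DIM('a) - 1))"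
  have [measurable]: "?f \<in> borel_measurable lborel" by measurable
  have f0: "0 \<le> ?f s" for s using nonneg by (auto simp: indicator_def)
  have "(1 - s) *\<^sub>R z + s *\<^sub>R x = z + s *\<^sub>R (x - z)" for s by (simp add: algebra_simps)
  then have eq: "(\<integral>\<^sup>+s. ennreal (?f s) \<partial>lborel) = ray_mass \<phi> z x"
    unfolding ray_mass_def by (intro nn_integral_cong) (simp add: indicator_def)
  show "(LINT s:{0..1}|lborel. \<phi> ((1 - s) *\<^sub>R z + s *\<^sub>R x) * s ^ (DIM('a) - 1)) = enn2real (ray_mass \<phi> z x)"
    unfolding set_lebesgue_integral_def eq[symmetric] using f0 by (intro integral_eq_nn_integral) auto
  show "set_integrable lborel {0..1} (\<lambda>s. \<phi> ((1 - s) *\<^sub>R z + s *\<^sub>R x) * s ^ (DIM('a) - 1))" if "ray_mass \<phi> z x < top"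
    unfolding set_integrable_def
  proof (rule integrableI_nonneg)
    show "(\<integral>\<^sup>+s. ennreal (?f s) \<partial>lborel) < \<infinity>" unfolding eq using that by simp
  qed (use f0 in auto)
qed

theorem theorem1p9:
  fixes K U :: "(real ^ 'n) set" and \<phi> :: "real ^ 'n \<Rightarrow> real"
  assumes dim: "CARD('n) \<ge> 2"
    and body: "convex_body K"
    and U: "open U" "K \<subseteq> U"
    and pos: "\<And>y. y \<in> U \<Longrightarrow> 0 < \<phi> y"
    and cont: "continuous_on U \<phi>"
    and int: "set_integrable lebesgue U \<phi>"
    and ext: "\<And>y. y \<notin> U \<Longrightarrow> \<phi> y = 0"
  shows "(\<forall>z.
      (AE x in hausdorff_measure (CARD('n) - 1). x \<in> frontier K \<longrightarrow>
         (z - x) \<bullet> outer_unit_normal K x \<noteq> 0 \<longrightarrow>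
         set_integrable lborel {0..1}
           (\<lambda>s. \<phi> ((1 - s) *\<^sub>R z + s *\<^sub>R x) * s ^ (CARD('n) - 1))) \<and>
      set_integrable (hausdorff_measure (CARD('n) - 1)) (frontier K)
        (\<lambda>x. \<bar>(z - x) \<bullet> outer_unit_normal K x\<bar> *
           (LINT s:{0..1}|lborel. \<phi> ((1 - s) *\<^sub>R z + s *\<^sub>R x) * s ^ (CARD('n) - 1))) \<and>
      added_vol U \<phi> K z = - (1/2) * weighted_vol U \<phi> K +
        (1/2) * (LINT x:frontier K|hausdorff_measure (CARD('n) - 1).
          \<bar>(z - x) \<bullet> outer_unit_normal K x\<bar> *
          (LINT s:{0..1}|lborel. \<phi> ((1 - s) *\<^sub>R z + s *\<^sub>R x) * s ^ (CARD('n) - 1)))) \<and>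
    continuous_on UNIV (added_vol U \<phi> K)"
proof (intro conjI allI)
  have K: "compact K" "closed K" using body by (auto simp: convex_body_def intro: compact_imp_closed)
  have nonneg: "0 \<le> \<phi> x" for x using pos[of x] ext[of x] by (cases "x \<in> U") auto
  have "(\<lambda>y. indicator U y *\<^sub>R \<phi> y) = \<phi>" using ext by (auto simp: fun_eq_iff indicator_def)
  then have \<phi>_int: "integrable lebesgue \<phi>" using int unfolding set_integrable_def by metis
  have \<phi>_borel: "\<phi> \<in> borel_measurable borel"
  proof -
    have "(\<lambda>y. if y \<in> U then \<phi> y else 0) \<in> borel_measurable borel"
      using U cont by (intro borel_measurable_continuous_on_if) auto
    moreover have "(\<lambda>y. if y \<in> U then \<phi> y else 0) = \<phi>" using ext by auto
    ultimately show ?thesis by simp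
  qed
  show "continuous_on UNIV (added_vol U \<phi> K)"
    using continuous_added_vol[OF body _ int] U(1) by auto
  fix z :: "real ^ 'n"
  let ?H = "hausdorff_measure (CARD('n) - 1) :: (real ^ 'n) measure"
  let ?T = "\<integral>\<^sup>+x. indicator (frontier K) x * cone_density K \<phi> z x \<partial>?H"
  have T: "?T = ennreal (weighted_vol U \<phi> K + 2 * added_vol U \<phi> K z)"
    by (rule nn_integral_cone_density[OF dim body \<phi>_int nonneg \<phi>_borel ext])
  define g where "g x = indicator (frontier K) x * cone_density K \<phi> z x" for x
  have "g \<in> borel_measurable borel"
    unfolding g_def using borel_cone_density[OF K(1) \<phi>_borel, of z] by measurable
  then have g [measurable]: "g \<in> borel_measurable ?H" by (rule borel_measurable_hausdorff_measure)
  have normal: "outer_unit_normal K x = smooth_normal K x" if "x \<in> frontier K" for x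
    using that K(2) frontier_subset_closed[OF K(2)] outer_unit_normal_not_smooth[of x K]
    by (auto simp: smooth_normal_def indicator_def)
  have ae: "AE x in ?H. g x < top"
  proof -
    have "(\<integral>\<^sup>+x. g x \<partial>?H) \<noteq> \<infinity>" using T unfolding g_def[symmetric] by simp
    from nn_integral_PInf_AE[OF g this] show ?thesis by (simp add: less_top)
  qed
  have ray: "(LINT s:{0..1}|lborel. \<phi> ((1 - s) *\<^sub>R z + s *\<^sub>R x) * s ^ (CARD('n) - 1)) = enn2real (ray_mass \<phi> z x)" for x
    using ray_integral(1)[OF \<phi>_borel nonneg, of z x] by simp
  have integrand: "indicator (frontier K) x *\<^sub>R (\<bar>(z - x) \<bullet> outer_unit_normal K x\<bar> *
      (LINT s:{0..1}|lborel. \<phi> ((1 - s) *\<^sub>R z + s *\<^sub>R x) * s ^ (CARD('n) - 1))) = enn2real (g x)" for x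
    using normal[of x] unfolding ray by (auto simp: g_def cone_density_def indicator_def enn2real_mult)
  have enn_g: "(\<lambda>x. enn2real (g x)) \<in> borel_measurable ?H" by measurable
  have nn: "(\<integral>\<^sup>+x. ennreal (enn2real (g x)) \<partial>?H) = ennreal (weighted_vol U \<phi> K + 2 * added_vol U \<phi> K z)"
  proof -
    have "(\<integral>\<^sup>+x. ennreal (enn2real (g x)) \<partial>?H) = (\<integral>\<^sup>+x. g x \<partial>?H)"
      using ae by (intro nn_integral_cong_AE) (auto elim!: eventually_mono)
    then show ?thesis using T unfolding g_def[symmetric] by simp
  qed
  show "AE x in ?H. x \<in> frontier K \<longrightarrow> (z - x) \<bullet> outer_unit_normal K x \<noteq> 0 \<longrightarrow>
      set_integrable lborel {0..1} (\<lambda>s. \<phi> ((1 - s) *\<^sub>R z + s *\<^sub>R x) * s ^ (CARD('n) - 1))"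
    using ae
  proof eventually_elim
    fix x assume fin: "g x < top"
    show "x \<in> frontier K \<longrightarrow> (z - x) \<bullet> outer_unit_normal K x \<noteq> 0 \<longrightarrow>
      set_integrable lborel {0..1} (\<lambda>s. \<phi> ((1 - s) *\<^sub>R z + s *\<^sub>R x) * s ^ (CARD('n) - 1))"
    proof (intro impI)
      assume x: "x \<in> frontier K" "(z - x) \<bullet> outer_unit_normal K x \<noteq> 0"
      then have "ray_mass \<phi> z x < top"
        using fin normal[OF x(1)] by (auto simp: g_def cone_density_def ennreal_mult_less_top)
      from ray_integral(2)[OF \<phi>_borel nonneg this]
      show "set_integrable lborel {0..1} (\<lambda>s. \<phi> ((1 - s) *\<^sub>R z + s *\<^sub>R x) * s ^ (CARD('n) - 1))" by simp
    qed
  qed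
  show "set_integrable ?H (frontier K) (\<lambda>x. \<bar>(z - x) \<bullet> outer_unit_normal K x\<bar> *
      (LINT s:{0..1}|lborel. \<phi> ((1 - s) *\<^sub>R z + s *\<^sub>R x) * s ^ (CARD('n) - 1)))"
    unfolding set_integrable_def integrand
  proof (rule integrableI_nonneg)
    show "(\<integral>\<^sup>+x. ennreal (enn2real (g x)) \<partial>?H) < \<infinity>" unfolding nn by simp
  qed (use enn_g in auto)
  have "0 \<le> weighted_vol U \<phi> K + 2 * added_vol U \<phi> K z"
  proof -
    have "K \<in> sets lebesgue" "convex hull insert z K - K \<in> sets lebesgue"
      using K compact_imp_closed[OF compact_convex_hull[OF compact_insert[OF K(1)]]] by auto
    then show ?thesis
      unfolding added_vol_def by (intro add_nonneg_nonneg mult_nonneg_nonneg nn_integral_weighted_vol(2)[OF \<phi>_int nonneg ext]) auto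
  qed
  then have "(LINT x:frontier K|?H. \<bar>(z - x) \<bullet> outer_unit_normal K x\<bar> *
      (LINT s:{0..1}|lborel. \<phi> ((1 - s) *\<^sub>R z + s *\<^sub>R x) * s ^ (CARD('n) - 1))) =
      weighted_vol U \<phi> K + 2 * added_vol U \<phi> K z"
    unfolding set_lebesgue_integral_def[of ?H] integrand
    using integral_eq_nn_integral[OF enn_g] unfolding nn by simp
  then show "added_vol U \<phi> K z = - (1/2) * weighted_vol U \<phi> K +
        (1/2) * (LINT x:frontier K|?H. \<bar>(z - x) \<bullet> outer_unit_normal K x\<bar> *
          (LINT s:{0..1}|lborel. \<phi> ((1 - s) *\<^sub>R z + s *\<^sub>R x) * s ^ (CARD('n) - 1)))"
    by linarith
qed

end
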